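(* Let $\Omega\subset\mathbb{R}^d$, $d\ge 1$, be a domain of finite measure and let $0<\alpha<d$. Let $K(x)$, $x\in\mathbb{R}^d$, be a homogeneous function of order $\alpha-d$ (that is, $K(tx)=t^{\alpha-d}K(x)$ for $t>0$) satisfying $K(x)=\overline{K(-x)}$, and let $\mathcal{K}$ be the compact self-adjoint integral operator in $L^2(\Omega)$ defined by $$\mathcal{K}u(x)=\int_\Omega K(x-y)\,u(y)\,dy,$$ with positive and negative eigenvalues $\{\lambda_k^{\pm}\}$. Then the following inequality holds for the Riesz means of the eigenvalues of $\mathcal{K}$, for $\lambda>0$: $$\sum_k(|\lambda_k^{\pm}|-\lambda)_+\le (2\pi)^{-d}\,|\Omega|\,\lambda^{1-\frac{d}{\alpha}}\int_{\mathbb{R}^d}(|\widehat{K}(\xi)|-1)_+\,d\xi .$$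
   Context: $|\Omega|$ is the Lebesgue measure of $\Omega$ and $(t)_+=\max(t,0)$. $\widehat{K}(\xi)=\int_{\mathbb{R}^d}e^{-ix\xi}K(x)\,dx$ is the Fourier transform of $K$ in the sense of the theory of distributions; it is a real-valued function, homogeneous of order $-\alpha$. The operator $\mathcal{K}$ may have positive eigenvalues $\lambda_k^+$ and negative eigenvalues $\lambda_k^-$, accumulating at zero; the sum runs over all of them, counted with multiplicity. *)

theory Defs
  imports "HOL-Analysis.Analysis"
begin

section \<open>Schwartz functions and the Fourier transform of tempered distributions\<close>

primrec iter_partial ::
  "'a::euclidean_space list \<Rightarrow> ('a \<Rightarrow> complex) \<Rightarrow> 'a \<Rightarrow> complex" where
  "iter_partial [] f = f"
| "iter_partial (b # bs) f = (\<lambda>x. frechet_derivative (iter_partial bs f) (at x) b)"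

text \<open>Differentiability of all iterated partial derivatives is the same as smoothness.\<close>

definition schwartz :: "('a::euclidean_space \<Rightarrow> complex) set" where
  "schwartz = {f. \<forall>bs \<in> lists Basis.
     (\<forall>x. iter_partial bs f differentiable at x) \<and>
     (\<forall>k::nat. bounded (range (\<lambda>x. norm x ^ k * norm (iter_partial bs f x))))}"

definition fourier :: "('a::euclidean_space \<Rightarrow> complex) \<Rightarrow> 'a \<Rightarrow> complex" where
  "fourier \<phi> \<xi> = (LINT x|lebesgue. exp (- \<i> * of_real (x \<bullet> \<xi>)) * \<phi> x)"

text \<open>
  A function that is integrable against every Schwartz function is locally integrable (test it
  with a Gaussian) and acts on Schwartz functions as a tempered distribution.
\<close>

definition tempered_function :: "('a::euclidean_space \<Rightarrow> complex) \<Rightarrow> bool" where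
  "tempered_function f \<longleftrightarrow> (\<forall>\<phi> \<in> schwartz. integrable lebesgue (\<lambda>x. f x * \<phi> x))"

text \<open>The distributional Fourier transform of \<open>f\<close> is (represented by) the function \<open>g\<close>.\<close>

definition has_fourier_transform ::
  "('a::euclidean_space \<Rightarrow> complex) \<Rightarrow> ('a \<Rightarrow> complex) \<Rightarrow> bool" where
  "has_fourier_transform f g \<longleftrightarrow>
     tempered_function f \<and> tempered_function g \<and>
     (\<forall>\<phi> \<in> schwartz. (LINT \<xi>|lebesgue. g \<xi> * \<phi> \<xi>) = (LINT x|lebesgue. f x * fourier \<phi> x))"

text \<open>Homogeneity is imposed away from the origin, where such functions may be singular.\<close>

definition homogeneous_of_order :: "real \<Rightarrow> ('a::euclidean_space \<Rightarrow> complex) \<Rightarrow> bool" where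
  "homogeneous_of_order p f \<longleftrightarrow>
     (\<forall>t>0. \<forall>x. x \<noteq> 0 \<longrightarrow> f (t *\<^sub>R x) = of_real (t powr p) * f x)"


section \<open>Operators on \<open>L\<^sup>2(\<Omega>)\<close>\<close>

text \<open>
  Elements of \<open>L\<^sup>2(\<Omega>)\<close> are represented by functions; functions that agree almost everywhere
  on \<open>\<Omega>\<close> represent the same element, and values outside \<open>\<Omega>\<close> are irrelevant.
\<close>

definition L2 :: "'a::euclidean_space set \<Rightarrow> ('a \<Rightarrow> complex) set" where
  "L2 \<Omega> = {u \<in> borel_measurable (lebesgue_on \<Omega>). integrable (lebesgue_on \<Omega>) (\<lambda>x. (norm (u x))\<^sup>2)}"

definition L2_inner ::
  "'a::euclidean_space set \<Rightarrow> ('a \<Rightarrow> complex) \<Rightarrow> ('a \<Rightarrow> complex) \<Rightarrow> complex" where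
  "L2_inner \<Omega> u v = (LINT x|lebesgue_on \<Omega>. u x * cnj (v x))"

definition L2_norm :: "'a::euclidean_space set \<Rightarrow> ('a \<Rightarrow> complex) \<Rightarrow> real" where
  "L2_norm \<Omega> u = sqrt (LINT x|lebesgue_on \<Omega>. (norm (u x))\<^sup>2)"

definition compact_on_L2 ::
  "'a::euclidean_space set \<Rightarrow> (('a \<Rightarrow> complex) \<Rightarrow> 'a \<Rightarrow> complex) \<Rightarrow> bool" where
  "compact_on_L2 \<Omega> T \<longleftrightarrow>
     (\<forall>u :: nat \<Rightarrow> 'a \<Rightarrow> complex. (\<forall>n. u n \<in> L2 \<Omega>) \<and> (\<exists>B. \<forall>n. L2_norm \<Omega> (u n) \<le> B) \<longrightarrow>
        (\<exists>v \<in> L2 \<Omega>. \<exists>r :: nat \<Rightarrow> nat. strict_mono r \<and>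
           (\<lambda>n. L2_norm \<Omega> (\<lambda>x. T (u (r n)) x - v x)) \<longlonglongrightarrow> 0))"

definition selfadjoint_on_L2 ::
  "'a::euclidean_space set \<Rightarrow> (('a \<Rightarrow> complex) \<Rightarrow> 'a \<Rightarrow> complex) \<Rightarrow> bool" where
  "selfadjoint_on_L2 \<Omega> T \<longleftrightarrow>
     (\<forall>u \<in> L2 \<Omega>. \<forall>v \<in> L2 \<Omega>. L2_inner \<Omega> (T u) v = L2_inner \<Omega> u (T v))"

definition conv_operator ::
  "('a::euclidean_space \<Rightarrow> complex) \<Rightarrow> 'a set \<Rightarrow> ('a \<Rightarrow> complex) \<Rightarrow> 'a \<Rightarrow> complex" where
  "conv_operator K \<Omega> u x = (LINT y|lebesgue_on \<Omega>. K (x - y) * u y)"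

text \<open>
  The integral converges absolutely for almost every \<open>x\<close>, so that the value 0 of a
  non-convergent Bochner integral plays no role, and it defines a map of \<open>L\<^sup>2(\<Omega>)\<close> into itself.
\<close>

definition conv_operator_on_L2 :: "('a::euclidean_space \<Rightarrow> complex) \<Rightarrow> 'a set \<Rightarrow> bool" where
  "conv_operator_on_L2 K \<Omega> \<longleftrightarrow>
     (\<forall>u \<in> L2 \<Omega>. (AE x in lebesgue_on \<Omega>. integrable (lebesgue_on \<Omega>) (\<lambda>y. K (x - y) * u y)) \<and>
                 conv_operator K \<Omega> u \<in> L2 \<Omega>)"


section \<open>Eigenvalues and Riesz means\<close>

definition eigenspace ::
  "'a::euclidean_space set \<Rightarrow> (('a \<Rightarrow> complex) \<Rightarrow> 'a \<Rightarrow> complex) \<Rightarrow> real \<Rightarrow> ('a \<Rightarrow> complex) set" where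
  "eigenspace \<Omega> T \<mu> = {u \<in> L2 \<Omega>. AE x in lebesgue_on \<Omega>. T u x = of_real \<mu> * u x}"

text \<open>The real eigenvalues; a self-adjoint operator has no others.\<close>

definition eigenvalues ::
  "'a::euclidean_space set \<Rightarrow> (('a \<Rightarrow> complex) \<Rightarrow> 'a \<Rightarrow> complex) \<Rightarrow> real set" where
  "eigenvalues \<Omega> T = {\<mu>. \<exists>u \<in> eigenspace \<Omega> T \<mu>. \<not> (AE x in lebesgue_on \<Omega>. u x = 0)}"

text \<open>Linear independence over the complex numbers, modulo almost everywhere equality.\<close>

definition ae_independent :: "'a measure \<Rightarrow> nat \<Rightarrow> (nat \<Rightarrow> 'a \<Rightarrow> complex) \<Rightarrow> bool" where
  "ae_independent M n f \<longleftrightarrow>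
     (\<forall>c :: nat \<Rightarrow> complex. (AE x in M. (\<Sum>i<n. c i * f i x) = 0) \<longrightarrow> (\<forall>i<n. c i = 0))"

definition multiplicity_on_L2 ::
  "'a::euclidean_space set \<Rightarrow> (('a \<Rightarrow> complex) \<Rightarrow> 'a \<Rightarrow> complex) \<Rightarrow> real \<Rightarrow> enat" where
  "multiplicity_on_L2 \<Omega> T \<mu> =
     Sup {enat n | n. \<exists>f. (\<forall>i<n. f i \<in> eigenspace \<Omega> T \<mu>) \<and> ae_independent (lebesgue_on \<Omega>) n f}"

text \<open>
  The sum over all positive and negative eigenvalues, counted with multiplicity, of
  \<open>(\<bar>\<mu>\<bar> - s)\<^sub>+\<close>; it is taken in \<open>[0, \<infinity>]\<close>.
\<close>

definition riesz_mean ::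
  "'a::euclidean_space set \<Rightarrow> (('a \<Rightarrow> complex) \<Rightarrow> 'a \<Rightarrow> complex) \<Rightarrow> real \<Rightarrow> ennreal" where
  "riesz_mean \<Omega> T s =
     (\<Sum>\<^sub>\<infinity>\<mu> \<in> {\<mu> \<in> eigenvalues \<Omega> T. \<mu> > 0 \<or> \<mu> < 0}.
        ennreal_of_enat (multiplicity_on_L2 \<Omega> T \<mu>) * ennreal (max (\<bar>\<mu>\<bar> - s) 0))"

end

theory Submission
  imports Defs "HOL-Probability.Characteristic_Functions"
begin

text \<open>
  Write \<open>T u(x) = \<integral>\<^sub>\<Omega> K(x - y) u(y) dy\<close> and \<open>\<langle>\<cdot>,\<cdot>\<rangle>\<close> for the inner product of \<open>L\<^sup>2(\<Omega>)\<close>, and let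
  \<open>u\<^sub>k\<close> be orthonormal eigenfunctions with eigenvalues \<open>\<mu>\<^sub>k\<close>. On the Fourier side \<open>T\<close> is
  multiplication by \<open>Khat\<close> followed by restriction to \<open>\<Omega>\<close>, so that, formally,
  \<open>\<bar>\<mu>\<^sub>k\<bar> = sgn \<mu>\<^sub>k \<cdot> \<langle>T u\<^sub>k, u\<^sub>k\<rangle> \<le> (2\<pi>)\<^bsup>-d\<^esup> \<integral> \<bar>Khat\<bar> \<bar>fourier u\<^sub>k\<bar>\<^sup>2\<close>. Subtract
  \<open>s = s (2\<pi>)\<^bsup>-d\<^esup> \<integral> \<bar>fourier u\<^sub>k\<bar>\<^sup>2\<close> and add up. Since \<open>fourier u\<^sub>k \<xi>\<close> is the coefficient of
  \<open>u\<^sub>k\<close> along the wave \<open>x \<mapsto> exp(i x \<cdot> \<xi>)\<close>, whose squared norm in \<open>L\<^sup>2(\<Omega>)\<close> is \<open>\<bar>\<Omega>\<bar>\<close>, Bessel's inequality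
  gives \<open>\<Sum>\<^sub>k \<bar>fourier u\<^sub>k \<xi>\<bar>\<^sup>2 \<le> \<bar>\<Omega>\<bar>\<close> for every \<open>\<xi>\<close>. What remains is
  \<open>\<Sum>\<^sub>k (\<bar>\<mu>\<^sub>k\<bar> - s) \<le> (2\<pi>)\<^bsup>-d\<^esup> \<bar>\<Omega>\<bar> \<integral> (\<bar>Khat\<bar> - s)\<^sub>+\<close>, and homogeneity turns \<open>s\<close> into the power of
  \<open>s\<close> in the theorem. The infinite sum is the supremum of its finite parts.

  The transform \<open>Khat\<close> is only known through its pairing with Schwartz functions, and \<open>K\<close> is only
  locally integrable. The formula for \<open>\<langle>T u\<^sub>k, u\<^sub>k\<rangle>\<close> is therefore replaced by an inequality for
  continuous functions \<open>w\<close> of compact support in \<open>\<Omega>\<close>. Their quadratic form is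
  \<open>\<integral> K(z) A(-z) dz\<close> with the autocorrelation \<open>A\<close> of \<open>w\<close> (\<open>L2_inner_conv_operator\<close>), and
  \<open>fourier A = \<bar>fourier w\<bar>\<^sup>2\<close>. Multiplied by a Gaussian, \<open>fourier A\<close> becomes a Schwartz function
  (\<open>gauss_cutoff_schwartz\<close>), whose own transform is an average of \<open>A\<close> with a Gaussian weight
  (\<open>fourier_gauss_cutoff\<close>). Hence the pairing with \<open>Khat\<close> makes sense, it converges to the quadratic
  form as the Gaussian flattens (\<open>gauss_cutoff_limit\<close>), and the total mass of the Schwartz function
  is at most \<open>\<parallel>w\<parallel>\<^sup>2\<close>, which is the half of Plancherel's theorem that the argument uses. The outcome is
  \<open>trace_inequality_test_functions\<close>.

  The homogeneity of \<open>K\<close> is used on the test functions: dilating \<open>w\<close> multiplies the quadratic form by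
  a power of the dilation factor (\<open>quadratic_form_scaled\<close>), which reduces the level \<open>s\<close> to the
  level 1. Compactness makes \<open>T\<close> bounded (\<open>T_bounded\<close>), and the
  test functions are dense in \<open>L\<^sup>2(\<Omega>)\<close> (\<open>L2_dense_Cc\<close>), so the inequality passes to the eigenfunctions
  (\<open>trace_inequality_eigenfunctions\<close>). The Gram-Schmidt process and the orthogonality of different
  eigenspaces provide the orthonormal families that the multiplicities count.
\<close>

section \<open>The Gaussian and its Fourier transform\<close>

lemma lborel_integral_affine:
  fixes f :: "'a::euclidean_space \<Rightarrow> 'b::{banach, second_countable_topology}"
  assumes "c \<noteq> 0" and [measurable]: "f \<in> borel_measurable borel"
  shows "(LINT x|lborel. f x) = \<bar>c\<bar> ^ DIM('a) *\<^sub>R (LINT x|lborel. f (t + c *\<^sub>R x))"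
  by (subst lborel_affine[OF assms(1), of t]) (simp add: integral_density integral_distr)

lemma lborel_integrable_affine:
  fixes f :: "'a::euclidean_space \<Rightarrow> 'b::{banach, second_countable_topology}"
  assumes "c \<noteq> 0" and f: "integrable lborel f"
  shows "integrable lborel (\<lambda>x. f (t + c *\<^sub>R x))"
proof -
  have [measurable]: "f \<in> borel_measurable borel"
    using f by simp
  have "integrable (density (distr lborel borel (\<lambda>x. t + c *\<^sub>R x)) (\<lambda>_. \<bar>c\<bar> ^ DIM('a))) f"
    using f by (subst (asm) lborel_affine[OF assms(1), of t]) simp
  then have "integrable lborel (\<lambda>x. \<bar>c\<bar> ^ DIM('a) *\<^sub>R f (t + c *\<^sub>R x))"
    by (simp add: integrable_density integrable_distr_eq)
  then have "integrable lborel (\<lambda>x. (1 / \<bar>c\<bar> ^ DIM('a)) *\<^sub>R (\<bar>c\<bar> ^ DIM('a) *\<^sub>R f (t + c *\<^sub>R x)))"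
    by (rule integrable_scaleR_right)
  then show ?thesis using assms(1) by simp
qed

definition gauss :: "'a::euclidean_space \<Rightarrow> real" where
  "gauss x = (1 / sqrt (2 * pi)) ^ DIM('a) * exp (- (norm x)\<^sup>2 / 2)"

lemma gauss_pos: "gauss x > 0"
  by (simp add: gauss_def)

lemma continuous_gauss [continuous_intros]: "continuous_on S gauss"
  unfolding gauss_def by (intro continuous_intros) auto

lemma borel_measurable_gauss [measurable]: "gauss \<in> borel_measurable borel"
  by (rule borel_measurable_continuous_onI) (rule continuous_gauss)

text \<open>
  The density is a product of one-dimensional normal densities, so its Fourier transform reduces to
  the characteristic function of the standard normal distribution.
\<close>

lemma gauss_eq_prod: "gauss x = (\<Prod>b\<in>Basis. std_normal_density (x \<bullet> b))"
proof -
  have "(norm x)\<^sup>2 = (\<Sum>b\<in>Basis. (x \<bullet> b)\<^sup>2)"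
    unfolding power2_norm_eq_inner by (subst euclidean_inner) (simp add: power2_eq_square)
  then have "exp (- (norm x)\<^sup>2 / 2) = (\<Prod>b\<in>Basis. exp (- (x \<bullet> b)\<^sup>2 / 2))"
    by (simp add: exp_sum[symmetric] sum_negf sum_divide_distrib)
  then show ?thesis
    by (simp add: gauss_def std_normal_density_def prod_dividef power_one_over)
qed

lemma gauss_char_1d:
  "integrable lborel (\<lambda>x. exp (- \<i> * of_real (a * x)) * of_real (std_normal_density x) :: complex)"
  "(LINT x|lborel. exp (- \<i> * of_real (a * x)) * of_real (std_normal_density x) :: complex)
     = of_real (exp (- a\<^sup>2 / 2))"
proof -
  have "char std_normal_distribution (- a) = complex_of_real (exp (- a\<^sup>2 / 2))"
    by (simp add: char_std_normal_distribution)
  moreover have "char std_normal_distribution (- a)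
     = (LINT x|lborel. std_normal_density x *\<^sub>R exp (\<i> * of_real (- a * x)))"
    unfolding char_def by (subst integral_density) (auto simp: normal_density_nonneg)
  ultimately show "(LINT x|lborel. exp (- \<i> * of_real (a * x)) * of_real (std_normal_density x) :: complex)
     = of_real (exp (- a\<^sup>2 / 2))"
    by (simp add: scaleR_conv_of_real mult.commute)
  have "integrable lborel (\<lambda>x. norm (std_normal_density x))"
    by (intro integrable_norm) simp
  then show "integrable lborel (\<lambda>x. exp (- \<i> * of_real (a * x)) * of_real (std_normal_density x) :: complex)"
    by (rule Bochner_Integration.integrable_bound) (auto simp: norm_mult)
qed

lemma lborel_integral_prod_Basis:
  fixes f :: "'a::euclidean_space \<Rightarrow> real \<Rightarrow> complex"
  assumes "\<And>b. b \<in> Basis \<Longrightarrow> integrable lborel (f b)"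
  shows "integrable lborel (\<lambda>x::'a. \<Prod>b\<in>Basis. f b (x \<bullet> b))"
    and "(LINT x|lborel. (\<Prod>b\<in>Basis. f b ((x::'a) \<bullet> b))) = (\<Prod>b\<in>Basis. LINT x|lborel. f b x)"
proof -
  interpret product_sigma_finite "\<lambda>_::'a. lborel :: real measure" ..
  have meas: "\<And>b. b \<in> Basis \<Longrightarrow> f b \<in> borel_measurable borel"
    using assms by (auto dest: borel_measurable_integrable)
  have [measurable]: "(\<lambda>x::'a. \<Prod>b\<in>Basis. f b (x \<bullet> b)) \<in> borel_measurable borel"
    by (intro borel_measurable_prod measurable_compose[OF _ meas]) auto
  have [simp]: "(\<Sum>c\<in>Basis. g c *\<^sub>R c) \<bullet> b = g b" if "b \<in> Basis" for b :: 'a and g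
    using that by (simp add: inner_sum_left inner_Basis if_distrib cong: if_cong)
  show "integrable lborel (\<lambda>x::'a. \<Prod>b\<in>Basis. f b (x \<bullet> b))"
    by (subst lborel_eq, subst integrable_distr_eq)
       (auto intro!: product_integrable_prod assms cong: prod.cong)
  show "(LINT x|lborel. (\<Prod>b\<in>Basis. f b ((x::'a) \<bullet> b))) = (\<Prod>b\<in>Basis. LINT x|lborel. f b x)"
    by (subst lborel_eq, subst integral_distr)
       (auto simp: product_integral_prod[OF finite_Basis assms, symmetric] cong: prod.cong)
qed

lemma fourier_gauss:
  fixes a :: "'a::euclidean_space"
  shows "integrable lborel (\<lambda>x. exp (- \<i> * of_real (a \<bullet> x)) * of_real (gauss x) :: complex)" (is ?A)
    and "(LINT x|lborel. exp (- \<i> * of_real (a \<bullet> x)) * of_real (gauss x) :: complex)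
           = of_real (exp (- (norm a)\<^sup>2 / 2))" (is ?B)
proof -
  have eq: "exp (- \<i> * of_real (a \<bullet> x)) * of_real (gauss x) =
     (\<Prod>b\<in>Basis. exp (- \<i> * of_real ((a \<bullet> b) * (x \<bullet> b))) * of_real (std_normal_density (x \<bullet> b)))"
    for x :: 'a
    unfolding gauss_eq_prod prod.distrib of_real_prod
    by (subst euclidean_inner) (simp add: exp_sum[symmetric] sum_distrib_left sum_negf)
  show ?A unfolding eq by (rule lborel_integral_prod_Basis) (rule gauss_char_1d)
  have "(norm a)\<^sup>2 = (\<Sum>b\<in>Basis. (a \<bullet> b)\<^sup>2)"
    unfolding power2_norm_eq_inner by (subst euclidean_inner) (simp add: power2_eq_square)
  then have "complex_of_real (exp (- (norm a)\<^sup>2 / 2)) = (\<Prod>b\<in>Basis. of_real (exp (- (a \<bullet> b)\<^sup>2 / 2)))"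
    by (simp add: exp_sum[symmetric] sum_negf sum_divide_distrib flip: of_real_prod)
  then show ?B
    unfolding eq lborel_integral_prod_Basis(2)[OF gauss_char_1d(1)] gauss_char_1d(2) by (rule sym)
qed

lemma integrable_gauss [simp]: "integrable lborel (gauss :: 'a::euclidean_space \<Rightarrow> real)"
  and integral_gauss [simp]: "(LINT x|lborel. gauss (x::'a)) = 1"
proof -
  have "integrable lborel (\<lambda>x::'a. complex_of_real (gauss x))"
    and 2: "(LINT x|lborel. complex_of_real (gauss (x::'a))) = 1"
    using fourier_gauss[of "0::'a"] by simp_all
  then show "integrable lborel (gauss :: 'a \<Rightarrow> real)"
    using integrable_Re[of lborel "\<lambda>x::'a. complex_of_real (gauss x)"] by simp
  show "(LINT x|lborel. gauss (x::'a)) = 1"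
    using 2 by (simp del: of_real_eq_1_iff add: of_real_eq_1_iff[where 'a=complex])
qed

text \<open>
  The constant is the one of Fourier inversion: up to the factor \<open>(2\<pi>)\<^bsup>d/2\<^esup>\<close>, the right-hand side is
  the Gaussian probability density of width \<open>e\<close> at \<open>a\<close>.
\<close>

lemma fourier_gauss_scaled:
  fixes a :: "'a::euclidean_space"
  assumes "e > 0"
  shows "integrable lborel (\<lambda>x. exp (- \<i> * of_real (a \<bullet> x)) * of_real (gauss (e *\<^sub>R x)) :: complex)" (is ?A)
    and "(LINT x|lborel. exp (- \<i> * of_real (a \<bullet> x)) * of_real (gauss (e *\<^sub>R x)) :: complex)
           = of_real (sqrt (2 * pi) ^ DIM('a) / e ^ DIM('a) * gauss (a /\<^sub>R e))" (is ?B)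
proof -
  let ?f = "\<lambda>x. exp (- \<i> * of_real ((a /\<^sub>R e) \<bullet> x)) * of_real (gauss x) :: complex"
  have eq: "?f (0 + e *\<^sub>R x) = exp (- \<i> * of_real (a \<bullet> x)) * of_real (gauss (e *\<^sub>R x))" for x
  proof -
    have "(a /\<^sub>R e) \<bullet> (0 + e *\<^sub>R x) = a \<bullet> x"
      using assms by simp
    then show ?thesis by (simp only: add_0)
  qed
  show ?A
    using lborel_integrable_affine[of e ?f 0] fourier_gauss(1)[of "a /\<^sub>R e"] assms
    unfolding eq by simp
  have "(LINT x|lborel. ?f x) = e ^ DIM('a) *\<^sub>R (LINT x|lborel. ?f (0 + e *\<^sub>R x))"
    using assms by (subst lborel_integral_affine[of e _ 0]) auto
  then have "of_real (exp (- (norm (a /\<^sub>R e))\<^sup>2 / 2)) =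
     e ^ DIM('a) *\<^sub>R (LINT x|lborel. exp (- \<i> * of_real (a \<bullet> x)) * of_real (gauss (e *\<^sub>R x)) :: complex)"
    unfolding eq fourier_gauss(2) .
  then show ?B
    using assms by (simp add: gauss_def scaleR_conv_of_real field_simps power_divide)
qed

section \<open>Continuous functions of compact support\<close>

text \<open>
  Continuity gives bounded integrands, pointwise limits and Borel measurability at the same time. In
  particular all integrals can be taken over \<open>lborel\<close>, where Fubini's theorem is available.
\<close>

definition Cc :: "('a::euclidean_space \<Rightarrow> complex) set" where
  "Cc = {w. continuous_on UNIV w \<and> (\<exists>R>0. \<forall>x. R < norm x \<longrightarrow> w x = 0)}"

lemma Cc_continuous: "w \<in> Cc \<Longrightarrow> continuous_on S w"
  by (auto simp: Cc_def intro: continuous_on_subset)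

lemma Cc_support:
  assumes "w \<in> Cc" obtains R where "R > 0" "\<And>x. R < norm x \<Longrightarrow> w x = 0"
  using assms by (auto simp: Cc_def)

lemma Cc_borel [measurable_dest]: "w \<in> Cc \<Longrightarrow> w \<in> borel_measurable borel"
  by (intro borel_measurable_continuous_onI Cc_continuous)

lemma Cc_bounded:
  assumes "w \<in> Cc" obtains M where "M > 0" "\<And>x. norm (w x) \<le> M"
proof -
  obtain R where R: "\<And>x. R < norm x \<Longrightarrow> w x = 0"
    using Cc_support[OF assms] by blast
  have "bounded (w ` cball 0 R)"
    by (intro compact_imp_bounded compact_continuous_image Cc_continuous assms) auto
  then obtain M where M: "M > 0" "\<And>x. x \<in> cball 0 R \<Longrightarrow> norm (w x) \<le> M"
    unfolding bounded_pos by auto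
  have "norm (w x) \<le> M" for x
    using M R[of x] by (cases "R < norm x") auto
  with M(1) show thesis using that by blast
qed

lemma Cc_integrable: assumes "w \<in> Cc" shows "integrable lborel w"
proof -
  obtain R where R: "\<And>x. R < norm x \<Longrightarrow> w x = 0"
    using Cc_support[OF assms] by blast
  have "integrable lborel (\<lambda>x. indicator (cball 0 R) x *\<^sub>R w x)"
    by (intro borel_integrable_compact Cc_continuous assms) auto
  also have "(\<lambda>x. indicator (cball 0 R) x *\<^sub>R w x) = w"
    using R by (auto simp: fun_eq_iff indicator_def)
  finally show ?thesis .
qed

lemma Cc_mult:
  assumes "w \<in> Cc" "continuous_on UNIV f" shows "(\<lambda>x. f x * w x) \<in> Cc"
  using assms by (auto simp: Cc_def intro!: continuous_intros)

lemma Cc_cnj: "w \<in> Cc \<Longrightarrow> (\<lambda>x. cnj (w x)) \<in> Cc"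
  by (auto simp: Cc_def intro!: continuous_intros)

lemma Cc_affine:
  fixes w :: "'a::euclidean_space \<Rightarrow> complex"
  assumes "w \<in> Cc" "c \<noteq> 0" shows "(\<lambda>x. w (a + c *\<^sub>R x)) \<in> Cc"
proof -
  obtain R where R: "R > 0" "\<And>x. R < norm x \<Longrightarrow> w x = 0"
    using Cc_support[OF assms(1)] by blast
  have "w (a + c *\<^sub>R x) = 0" if "(R + norm a) / \<bar>c\<bar> < norm x" for x
  proof (rule R(2))
    have "R + norm a < \<bar>c\<bar> * norm x"
      using that assms(2) by (simp add: field_simps)
    also have "\<bar>c\<bar> * norm x \<le> norm (a + c *\<^sub>R x) + norm a"
      using norm_triangle_ineq4[of "a + c *\<^sub>R x" a] by simp
    finally show "R < norm (a + c *\<^sub>R x)" by simp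
  qed
  moreover have "(R + norm a) / \<bar>c\<bar> > 0"
    using R(1) assms(2) by (intro divide_pos_pos add_pos_nonneg) auto
  moreover have "continuous_on UNIV (\<lambda>x. w (a + c *\<^sub>R x))"
    by (intro continuous_on_compose2[OF Cc_continuous[OF assms(1), of UNIV]] continuous_intros) auto
  ultimately show ?thesis by (auto simp: Cc_def)
qed

lemma fourier_lborel:
  assumes [measurable]: "f \<in> borel_measurable borel"
  shows "fourier f \<xi> = (LINT x|lborel. exp (- \<i> * of_real (x \<bullet> \<xi>)) * f x)"
  unfolding fourier_def by (subst integral_completion) auto

lemma norm_exp_iof_real [simp]: "norm (exp (- (\<i> * complex_of_real t))) = 1"
  by (metis mult_minus_right norm_exp_i_times of_real_minus)

lemma norm_fourier_le: "norm (fourier f \<xi>) \<le> (LINT x|lebesgue. norm (f x))"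
  unfolding fourier_def
  by (rule order_trans[OF integral_norm_bound]) (simp add: norm_mult)

lemma fourier_Cc_bounded:
  assumes "h \<in> Cc" obtains M where "M \<ge> 0" "\<And>\<xi>. norm (fourier h \<xi>) \<le> M"
  using norm_fourier_le[of h] that[of "LINT x|lebesgue. norm (h x)"] by (simp add: integral_nonneg_AE)

text \<open>
  Differentiation under the integral sign. The remainder is controlled by
  \<open>\<bar>exp(i t) - 1 - i t\<bar> \<le> t\<^sup>2 / 2\<close> and the second moment of \<open>h\<close>, which is finite because \<open>h\<close> has
  compact support. The derivative is again a transform of such a function.
\<close>

lemma has_derivative_fourier:
  fixes h :: "'a::euclidean_space \<Rightarrow> complex"
  assumes "h \<in> Cc"
  shows "(fourier h has_derivative (\<lambda>v. fourier (\<lambda>x. - \<i> * of_real (x \<bullet> v) * h x) \<xi>)) (at \<xi>)"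
proof -
  have [measurable]: "h \<in> borel_measurable borel"
    using assms by (rule Cc_borel)
  have cont: "continuous_on UNIV (\<lambda>x::'a. exp (- \<i> * of_real (x \<bullet> \<xi>)))" for \<xi>
    by (intro continuous_intros)
  have in_Cc: "(\<lambda>x. - \<i> * of_real (x \<bullet> v) * h x) \<in> Cc" for v
    by (intro Cc_mult assms continuous_intros)
  have int0: "integrable lborel (\<lambda>x. exp (- \<i> * of_real (x \<bullet> \<xi>)) * h x)" for \<xi>
    by (intro Cc_integrable Cc_mult assms cont)
  have int1: "integrable lborel (\<lambda>x. exp (- \<i> * of_real (x \<bullet> \<xi>)) * (- \<i> * of_real (x \<bullet> v) * h x))" for v \<xi>
    by (intro Cc_integrable Cc_mult[OF in_Cc] cont)
  let ?D = "\<lambda>v. fourier (\<lambda>x. - \<i> * of_real (x \<bullet> v) * h x) \<xi>"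
  have D_eq: "?D v = (LINT x|lborel. exp (- \<i> * of_real (x \<bullet> \<xi>)) * (- \<i> * of_real (x \<bullet> v) * h x))" for v
    by (rule fourier_lborel) measurable
  define M where "M = (LINT x|lborel. (norm x)\<^sup>2 * norm (h x))"
  have intM: "integrable lborel (\<lambda>x. (norm x)\<^sup>2 * norm (h x))"
  proof -
    have "integrable lborel (\<lambda>x. norm (of_real ((norm x)\<^sup>2) * h x))"
      by (intro integrable_norm Cc_integrable Cc_mult assms continuous_intros)
    then show ?thesis by (simp add: norm_mult norm_power)
  qed
  have main: "norm (fourier h \<eta> - fourier h \<xi> - ?D (\<eta> - \<xi>)) \<le> M / 2 * (norm (\<eta> - \<xi>))\<^sup>2" for \<eta>
  proof -
    let ?v = "\<eta> - \<xi>"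
    have "fourier h \<eta> - fourier h \<xi> - ?D ?v = (LINT x|lborel.
      exp (- \<i> * of_real (x \<bullet> \<eta>)) * h x - exp (- \<i> * of_real (x \<bullet> \<xi>)) * h x
       - exp (- \<i> * of_real (x \<bullet> \<xi>)) * (- \<i> * of_real (x \<bullet> ?v) * h x))"
      unfolding D_eq by (subst (1 2) fourier_lborel) (use int0 int1 in \<open>simp_all add: Bochner_Integration.integral_diff\<close>)
    also have "norm \<dots> \<le> (LINT x|lborel. (norm x)\<^sup>2 * norm (h x) * ((norm ?v)\<^sup>2 / 2))"
    proof (rule Bochner_Integration.integral_norm_bound_integral)
      show "integrable lborel (\<lambda>x. exp (- \<i> * of_real (x \<bullet> \<eta>)) * h x - exp (- \<i> * of_real (x \<bullet> \<xi>)) * h x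
       - exp (- \<i> * of_real (x \<bullet> \<xi>)) * (- \<i> * of_real (x \<bullet> ?v) * h x))"
        by (intro Bochner_Integration.integrable_diff int0 int1)
      show "integrable lborel (\<lambda>x. (norm x)\<^sup>2 * norm (h x) * ((norm ?v)\<^sup>2 / 2))"
        using intM by simp
      fix x :: 'a
      let ?t = "x \<bullet> ?v"
      have "exp (- \<i> * of_real (x \<bullet> \<eta>)) = exp (- \<i> * of_real (x \<bullet> \<xi>)) * exp (\<i> * complex_of_real (- ?t))"
        by (simp add: exp_add[symmetric] inner_diff_right algebra_simps)
      then have "norm (exp (- \<i> * of_real (x \<bullet> \<eta>)) * h x - exp (- \<i> * of_real (x \<bullet> \<xi>)) * h x
       - exp (- \<i> * of_real (x \<bullet> \<xi>)) * (- \<i> * of_real (x \<bullet> ?v) * h x))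
       = norm (exp (- \<i> * of_real (x \<bullet> \<xi>)) * (exp (\<i> * complex_of_real (- ?t)) - (1 + \<i> * complex_of_real (- ?t))) * h x)"
        by (simp add: algebra_simps)
      also have "\<dots> = norm (exp (\<i> * complex_of_real (- ?t)) - (1 + \<i> * complex_of_real (- ?t))) * norm (h x)"
        by (simp add: norm_mult)
      also have "\<dots> \<le> (?t\<^sup>2 / 2) * norm (h x)"
        using iexp_approx1[of "- ?t" 1] by (intro mult_right_mono) (auto simp: numeral_2_eq_2)
      also have "\<dots> \<le> ((norm x)\<^sup>2 * (norm ?v)\<^sup>2 / 2) * norm (h x)"
        using Cauchy_Schwarz_ineq[of x ?v]
        by (intro mult_right_mono divide_right_mono) (auto simp: power2_norm_eq_inner)
      finally show "norm (exp (- \<i> * of_real (x \<bullet> \<eta>)) * h x - exp (- \<i> * of_real (x \<bullet> \<xi>)) * h x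
       - exp (- \<i> * of_real (x \<bullet> \<xi>)) * (- \<i> * of_real (x \<bullet> ?v) * h x)) \<le> (norm x)\<^sup>2 * norm (h x) * ((norm ?v)\<^sup>2 / 2)"
        by (simp add: mult_ac)
    qed
    also have "\<dots> = M / 2 * (norm ?v)\<^sup>2"
      by (simp add: M_def)
    finally show ?thesis .
  qed
  show ?thesis
  proof (rule has_derivativeI_sandwich[where e = 1 and H = "\<lambda>\<eta>. M / 2 * norm (\<eta> - \<xi>)"])
    show "bounded_linear ?D"
    proof (intro linear_conv_bounded_linear[THEN iffD1] linearI)
      show "?D (v + v') = ?D v + ?D v'" for v v'
        unfolding D_eq using int1
        by (simp add: Bochner_Integration.integral_add[symmetric] inner_add_right algebra_simps
             del: Bochner_Integration.integral_add)
      show "?D (r *\<^sub>R v) = r *\<^sub>R ?D v" for r v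
        unfolding D_eq
        by (subst integral_scaleR_right[symmetric]) (simp add: scaleR_conv_of_real mult_ac)
    qed
    show "((\<lambda>\<eta>. M / 2 * norm (\<eta> - \<xi>)) \<longlongrightarrow> 0) (at \<xi> within UNIV)"
      by (auto intro!: tendsto_eq_intros)
    fix \<eta> assume "\<eta> \<noteq> \<xi>"
    then show "norm (fourier h \<eta> - fourier h \<xi> - ?D (\<eta> - \<xi>)) / norm (\<eta> - \<xi>) \<le> M / 2 * norm (\<eta> - \<xi>)"
      using main[of \<eta>] by (simp add: divide_le_eq power2_eq_square)
  qed simp
qed

section \<open>Schwartz functions built from a Gaussian\<close>

text \<open>
  A class that contains \<open>fourier h\<close> times a Gaussian and that is closed under partial derivatives:
  a derivative falls on \<open>fourier h\<close>, on the Gaussian, which produces a coordinate factor, or on a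
  coordinate. The plain Gaussian is included so that tempered functions can be integrated against it.
\<close>

inductive_set gauss_class :: "real \<Rightarrow> ('a::euclidean_space \<Rightarrow> complex) set" for c :: real where
  pure: "(\<lambda>x. of_real (gauss (c *\<^sub>R x))) \<in> gauss_class c"
| transform: "h \<in> Cc \<Longrightarrow> (\<lambda>x. fourier h x * of_real (gauss (c *\<^sub>R x))) \<in> gauss_class c"
| coord: "f \<in> gauss_class c \<Longrightarrow> (\<lambda>x. of_real (x \<bullet> b) * f x) \<in> gauss_class c"
| scale: "f \<in> gauss_class c \<Longrightarrow> (\<lambda>x. a * f x) \<in> gauss_class c"
| add: "f \<in> gauss_class c \<Longrightarrow> g \<in> gauss_class c \<Longrightarrow> (\<lambda>x. f x + g x) \<in> gauss_class c"

lemma has_derivative_gauss_scaled: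
  fixes x :: "'a::euclidean_space"
  shows "((\<lambda>x. complex_of_real (gauss (c *\<^sub>R x))) has_derivative
     (\<lambda>v. of_real (- c\<^sup>2 * (x \<bullet> v)) * of_real (gauss (c *\<^sub>R x)))) (at x)"
proof -
  have "((\<lambda>x. (1 / sqrt (2 * pi)) ^ DIM('a) * exp (- (c\<^sup>2 * (x \<bullet> x)) / 2)) has_derivative
     (\<lambda>v. - c\<^sup>2 * (x \<bullet> v) * ((1 / sqrt (2 * pi)) ^ DIM('a) * exp (- (c\<^sup>2 * (x \<bullet> x)) / 2)))) (at x)"
    by (auto intro!: derivative_eq_intros simp: fun_eq_iff inner_commute algebra_simps)
  also have "(\<lambda>x::'a. (1 / sqrt (2 * pi)) ^ DIM('a) * exp (- (c\<^sup>2 * (x \<bullet> x)) / 2)) = (\<lambda>x. gauss (c *\<^sub>R x))"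
    by (simp add: gauss_def power_mult_distrib power2_norm_eq_inner fun_eq_iff)
  finally show ?thesis
    by (auto intro!: derivative_eq_intros)
qed

lemma gauss_class_derivative:
  fixes f :: "'a::euclidean_space \<Rightarrow> complex"
  assumes "f \<in> gauss_class c"
  shows "\<exists>f'. (\<forall>x. (f has_derivative f' x) (at x)) \<and> (\<forall>v. (\<lambda>x. f' x v) \<in> gauss_class c)"
  using assms
proof induction
  case pure
  have "(\<lambda>x::'a. of_real (- c\<^sup>2 * (x \<bullet> v)) * complex_of_real (gauss (c *\<^sub>R x))) \<in> gauss_class c" for v
    using gauss_class.scale[OF gauss_class.coord[OF gauss_class.pure], of "of_real (- c\<^sup>2)"]
    by (simp add: mult_ac)
  then show ?case
    using has_derivative_gauss_scaled
    by (intro exI[of _ "\<lambda>x v. of_real (- c\<^sup>2 * (x \<bullet> v)) * complex_of_real (gauss (c *\<^sub>R x))"]) blast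
next
  case (transform h)
  let ?f' = "\<lambda>(x::'a) v. fourier (\<lambda>y. - \<i> * of_real (y \<bullet> v) * h y) x * of_real (gauss (c *\<^sub>R x))
     + of_real (- c\<^sup>2) * (of_real (x \<bullet> v) * (fourier h x * complex_of_real (gauss (c *\<^sub>R x))))"
  have "((\<lambda>x. fourier h x * complex_of_real (gauss (c *\<^sub>R x))) has_derivative ?f' x) (at x)" for x
    by (rule has_derivative_eq_rhs[OF has_derivative_mult[OF has_derivative_fourier[OF transform] has_derivative_gauss_scaled]])
       (simp add: fun_eq_iff algebra_simps)
  moreover have "(\<lambda>x. ?f' x v) \<in> gauss_class c" for v
    by (intro gauss_class.intros Cc_mult transform continuous_intros)
  ultimately show ?case by (intro exI[of _ ?f']) blast
next
  case (coord f b)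
  then obtain f' where f': "\<And>x. (f has_derivative f' x) (at x)" "\<And>v. (\<lambda>x. f' x v) \<in> gauss_class c"
    by blast
  let ?f' = "\<lambda>x v. of_real (x \<bullet> b) * f' x v + of_real (v \<bullet> b) * f x"
  have "((\<lambda>x. of_real (x \<bullet> b) * f x) has_derivative ?f' x) (at x)" for x
    using f'(1) by (auto intro!: derivative_eq_intros)
  moreover have "(\<lambda>x. ?f' x v) \<in> gauss_class c" for v
    by (intro gauss_class.intros f' coord.hyps)
  ultimately show ?case by (intro exI[of _ ?f']) blast
next
  case (scale f a)
  then obtain f' where f': "\<And>x. (f has_derivative f' x) (at x)" "\<And>v. (\<lambda>x. f' x v) \<in> gauss_class c"
    by blast
  then have "((\<lambda>x. a * f x) has_derivative (\<lambda>v. a * f' x v)) (at x)" for x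
    by (auto intro!: derivative_eq_intros)
  moreover have "(\<lambda>x. a * f' x v) \<in> gauss_class c" for v
    by (intro gauss_class.intros f')
  ultimately show ?case by (intro exI[of _ "\<lambda>x v. a * f' x v"]) blast
next
  case (add f g)
  then obtain f' g' where
    f': "\<And>x. (f has_derivative f' x) (at x)" "\<And>v. (\<lambda>x. f' x v) \<in> gauss_class c" and
    g': "\<And>x. (g has_derivative g' x) (at x)" "\<And>v. (\<lambda>x. g' x v) \<in> gauss_class c"
    by blast
  then have "((\<lambda>x. f x + g x) has_derivative (\<lambda>v. f' x v + g' x v)) (at x)" for x
    by (auto intro!: derivative_eq_intros)
  moreover have "(\<lambda>x. f' x v + g' x v) \<in> gauss_class c" for v
    by (intro gauss_class.intros f' g')
  ultimately show ?case by (intro exI[of _ "\<lambda>x v. f' x v + g' x v"]) blast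
qed

text \<open>
  The exponential dominates every term of its series, in particular the one of order \<open>k\<close>.
\<close>

lemma power_mult_exp_neg_square_bounded:
  assumes "a > 0" obtains B where "\<And>t::real. t \<ge> 0 \<Longrightarrow> t ^ k * exp (- a * t\<^sup>2) \<le> B"
proof
  fix t :: real assume "t \<ge> 0"
  have "(a * t\<^sup>2) ^ k / fact k \<le> exp (a * t\<^sup>2)"
  proof -
    have "(\<Sum>i\<in>{k}. (a * t\<^sup>2) ^ i /\<^sub>R fact i) \<le> (\<Sum>i. (a * t\<^sup>2) ^ i /\<^sub>R fact i)"
      using assms by (intro sum_le_suminf summable_exp_generic) auto
    then show ?thesis by (simp add: exp_def divide_inverse mult.commute)
  qed
  then have 1: "t ^ (2 * k) \<le> fact k / a ^ k * exp (a * t\<^sup>2)"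
  proof -
    have "(a * t\<^sup>2) ^ k = a ^ k * t ^ (2 * k)"
      by (simp add: power_mult_distrib power_mult)
    with \<open>(a * t\<^sup>2) ^ k / fact k \<le> exp (a * t\<^sup>2)\<close>
    have "a ^ k * t ^ (2 * k) \<le> fact k * exp (a * t\<^sup>2)"
      by (simp add: divide_le_eq mult.commute)
    then show ?thesis
      using assms by (simp only: times_divide_eq_left pos_le_divide_eq zero_less_power mult.commute)
  qed
  have "t ^ k \<le> 1 + t ^ (2 * k)"
  proof -
    have sq: "t ^ (2 * k) = t ^ k * t ^ k"
      by (simp add: mult_2 power_add)
    have "2 * t ^ k \<le> t ^ k * t ^ k + 1"
      using zero_le_square[of "t ^ k - 1"] by (simp add: left_diff_distrib right_diff_distrib)
    moreover have "t ^ k \<ge> 0" using \<open>t \<ge> 0\<close> by simp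
    ultimately show ?thesis unfolding sq by linarith
  qed
  also have "\<dots> \<le> exp (a * t\<^sup>2) + fact k / a ^ k * exp (a * t\<^sup>2)"
    using 1 assms by (intro add_mono) auto
  finally have "t ^ k \<le> (1 + fact k / a ^ k) * exp (a * t\<^sup>2)"
    by (simp add: algebra_simps)
  then show "t ^ k * exp (- a * t\<^sup>2) \<le> 1 + fact k / a ^ k"
    by (simp add: exp_minus field_simps)
qed

lemma gauss_class_decay:
  fixes f :: "'a::euclidean_space \<Rightarrow> complex"
  assumes "f \<in> gauss_class c" "c > 0"
  shows "\<exists>B. \<forall>x. norm x ^ k * norm (f x) \<le> B"
  using assms(1)
proof (induction arbitrary: k)
  case pure
  have c: "c\<^sup>2 / 2 > 0" using assms(2) by simp
  obtain B where B: "\<And>t::real. t \<ge> 0 \<Longrightarrow> t ^ k * exp (- (c\<^sup>2 / 2) * t\<^sup>2) \<le> B"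
    using power_mult_exp_neg_square_bounded[OF c] by blast
  have "norm x ^ k * norm (complex_of_real (gauss (c *\<^sub>R x))) \<le> (1 / sqrt (2 * pi)) ^ DIM('a) * B" for x :: 'a
    using mult_left_mono[OF B[of "norm x"], of "(1 / sqrt (2 * pi)) ^ DIM('a)"]
    unfolding norm_of_real by (simp add: gauss_def abs_mult power_mult_distrib mult_ac)
  then show ?case by blast
next
  case (transform h)
  have c: "c\<^sup>2 / 2 > 0" using assms(2) by simp
  obtain B where B: "\<And>t::real. t \<ge> 0 \<Longrightarrow> t ^ k * exp (- (c\<^sup>2 / 2) * t\<^sup>2) \<le> B"
    using power_mult_exp_neg_square_bounded[OF c] by blast
  have B': "norm x ^ k * gauss (c *\<^sub>R x) \<le> (1 / sqrt (2 * pi)) ^ DIM('a) * B" for x :: 'a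
    using mult_left_mono[OF B[of "norm x"], of "(1 / sqrt (2 * pi)) ^ DIM('a)"]
    by (simp add: gauss_def power_mult_distrib mult_ac)
  obtain M where M: "M \<ge> 0" "\<And>\<xi>. norm (fourier h \<xi>) \<le> M"
    using fourier_Cc_bounded[OF transform] by blast
  have "norm x ^ k * norm (fourier h x * complex_of_real (gauss (c *\<^sub>R x))) \<le> M * ((1 / sqrt (2 * pi)) ^ DIM('a) * B)" for x :: 'a
    using mult_mono[OF M(2) B' M(1), of x x] gauss_pos[of "c *\<^sub>R x"]
    by (simp add: norm_mult mult_ac)
  then show ?case by blast
next
  case (coord f b)
  obtain B where B: "\<And>x. norm x ^ Suc k * norm (f x) \<le> B"
    using coord.IH by blast
  have "norm x ^ k * norm (of_real (x \<bullet> b) * f x) \<le> norm b * B" for x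
  proof -
    have "norm x ^ k * norm (of_real (x \<bullet> b) * f x) = \<bar>x \<bullet> b\<bar> * (norm x ^ k * norm (f x))"
      by (simp add: norm_mult)
    also have "\<dots> \<le> (norm x * norm b) * (norm x ^ k * norm (f x))"
      by (intro mult_right_mono Cauchy_Schwarz_ineq2) auto
    also have "\<dots> = norm b * (norm x ^ Suc k * norm (f x))" by simp
    also have "\<dots> \<le> norm b * B" by (intro mult_left_mono B) auto
    finally show ?thesis .
  qed
  then show ?case by blast
next
  case (scale f a)
  obtain B where B: "\<And>x. norm x ^ k * norm (f x) \<le> B"
    using scale.IH by blast
  have "norm x ^ k * norm (a * f x) \<le> norm a * B" for x
    using mult_left_mono[OF B[of x], of "norm a"] by (simp add: norm_mult mult_ac)
  then show ?case by blast
next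
  case (add f g)
  obtain B B' where B: "\<And>x. norm x ^ k * norm (f x) \<le> B" "\<And>x. norm x ^ k * norm (g x) \<le> B'"
    using add.IH by blast
  have "norm x ^ k * norm (f x + g x) \<le> B + B'" for x
  proof -
    have "norm x ^ k * norm (f x + g x) \<le> norm x ^ k * (norm (f x) + norm (g x))"
      by (intro mult_left_mono norm_triangle_ineq) auto
    with B[of x] show ?thesis by (simp add: distrib_left)
  qed
  then show ?case by blast
qed

text \<open>
  Decay of every order together with closure under derivatives is the Schwartz property.
\<close>

lemma gauss_class_schwartz:
  assumes "c > 0" "f \<in> gauss_class c" shows "f \<in> schwartz"
proof -
  have iter: "iter_partial bs f \<in> gauss_class c" for bs
  proof (induction bs)
    case (Cons b bs)
    obtain f' where f': "\<And>x. (iter_partial bs f has_derivative f' x) (at x)"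
        "\<And>v. (\<lambda>x. f' x v) \<in> gauss_class c"
      using gauss_class_derivative[OF Cons.IH] by blast
    have "frechet_derivative (iter_partial bs f) (at x) = f' x" for x
      using frechet_derivative_at[OF f'(1)] by simp
    then show ?case using f'(2) by simp
  qed (use assms in simp)
  have "iter_partial bs f differentiable at x" for bs x
    using gauss_class_derivative[OF iter[of bs]] by (auto simp: differentiable_def)
  moreover have "bounded (range (\<lambda>x. norm x ^ k * norm (iter_partial bs f x)))" for bs k
    using gauss_class_decay[OF iter[of bs] assms(1), of k]
    by (auto simp: bounded_iff)
  ultimately show ?thesis by (simp add: schwartz_def)
qed

section \<open>Gaussian summation of Fourier integrals\<close>

text \<open>
  The factor \<open>(2\<pi>)\<^bsup>-d/2\<^esup>\<close> comes on top of the one in \<open>gauss\<close>. Together they are the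
  \<open>(2\<pi>)\<^bsup>-d\<^esup>\<close> of Fourier inversion, so that transforming once more recovers \<open>A\<close> as \<open>e\<close> tends to 0.
\<close>

definition gauss_cutoff :: "('a::euclidean_space \<Rightarrow> complex) \<Rightarrow> real \<Rightarrow> 'a \<Rightarrow> complex" where
  "gauss_cutoff A e \<xi> = of_real ((1 / sqrt (2 * pi)) ^ DIM('a)) * (fourier A \<xi> * of_real (gauss (e *\<^sub>R \<xi>)))"

lemma gauss_cutoff_schwartz:
  assumes "A \<in> Cc" "e > 0" shows "gauss_cutoff A e \<in> schwartz"
  unfolding gauss_cutoff_def[abs_def]
  by (rule gauss_class_schwartz[OF assms(2)]) (intro gauss_class.intros assms)

lemma borel_measurable_fourier [measurable]:
  assumes [measurable]: "f \<in> borel_measurable borel" shows "fourier f \<in> borel_measurable borel"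
  unfolding fourier_lborel[OF assms, abs_def] by measurable

text \<open>
  The form in which the integrability hypothesis of Fubini's theorem is checked below.
\<close>

lemma integrable_lborel_tensor:
  fixes f g :: "'a::euclidean_space \<Rightarrow> complex" and h :: "'a \<times> 'a \<Rightarrow> complex"
  assumes f: "integrable lborel f" and g: "integrable lborel g"
    and [measurable]: "h \<in> borel_measurable (lborel \<Otimes>\<^sub>M lborel)"
    and h: "\<And>x y. norm (h (x, y)) \<le> norm (f x) * norm (g y)"
  shows "integrable (lborel \<Otimes>\<^sub>M lborel) h"
proof (rule Bochner_Integration.integrable_bound)
  have [measurable]: "f \<in> borel_measurable borel" "g \<in> borel_measurable borel"
    using f g by (auto dest: borel_measurable_integrable)
  show "integrable (lborel \<Otimes>\<^sub>M lborel) (\<lambda>(x, y). f x * g y)"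
  proof (rule lborel_pair.Fubini_integrable)
    show "AE x in lborel. integrable lborel (\<lambda>y. (case (x, y) of (x, y) \<Rightarrow> f x * g y))"
      using g by auto
    show "integrable lborel (\<lambda>x. LINT y|lborel. norm (case (x, y) of (x, y) \<Rightarrow> f x * g y))"
      using f by (simp add: norm_mult)
  qed measurable
  show "AE x in lborel \<Otimes>\<^sub>M lborel. norm (h x) \<le> norm (case x of (x, y) \<Rightarrow> f x * g y)"
    using h by (auto simp: norm_mult)
qed measurable

lemma integrable_gauss_scaled: "e \<noteq> 0 \<Longrightarrow> integrable lborel (\<lambda>x::'a::euclidean_space. gauss (e *\<^sub>R x))"
  using lborel_integrable_affine[of e gauss "0::'a"] by simp

text \<open>
  Exchanging the two integrations leaves \<open>A\<close> integrated against a Gaussian of width \<open>e\<close> around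
  \<open>-z\<close>; rescaling this Gaussian to width 1 moves \<open>e\<close> into the argument of \<open>A\<close>.
\<close>

lemma fourier_gauss_cutoff:
  fixes A :: "'a::euclidean_space \<Rightarrow> complex"
  assumes A: "A \<in> Cc" and e: "e > 0"
  shows "fourier (gauss_cutoff A e) z = (LINT t|lborel. A (e *\<^sub>R t - z) * of_real (gauss t))"
proof -
  have [measurable]: "A \<in> borel_measurable borel" using A by (rule Cc_borel)
  have [measurable]: "gauss_cutoff A e \<in> borel_measurable borel"
    unfolding gauss_cutoff_def[abs_def] by measurable
  let ?c = "complex_of_real ((1 / sqrt (2 * pi)) ^ DIM('a))"
  let ?G = "\<lambda>\<xi>::'a. complex_of_real (gauss (e *\<^sub>R \<xi>))"
  let ?h = "\<lambda>x \<xi>. exp (- \<i> * of_real ((x + z) \<bullet> \<xi>)) * A x * ?G \<xi>"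
  have intG: "integrable lborel ?G"
    using integrable_gauss_scaled[of e] e by auto
  have int: "integrable (lborel \<Otimes>\<^sub>M lborel) (case_prod ?h)"
    by (rule integrable_lborel_tensor[OF Cc_integrable[OF A] intG]) (auto simp: norm_mult)
  have "fourier (gauss_cutoff A e) z =
      (LINT \<xi>|lborel. exp (- \<i> * of_real (\<xi> \<bullet> z)) * gauss_cutoff A e \<xi>)"
    by (rule fourier_lborel) measurable
  also have "\<dots> = (LINT \<xi>|lborel. ?c * (LINT x|lborel. ?h x \<xi>))"
  proof (rule Bochner_Integration.integral_cong[OF refl])
    fix \<xi>
    have "(LINT x|lborel. ?h x \<xi>) = (LINT x|lborel. (exp (- \<i> * of_real (\<xi> \<bullet> z)) * ?G \<xi>) * (exp (- \<i> * of_real (x \<bullet> \<xi>)) * A x))"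
    proof (rule Bochner_Integration.integral_cong[OF refl])
      fix x
      have "exp (- \<i> * of_real ((x + z) \<bullet> \<xi>)) = exp (- \<i> * of_real (\<xi> \<bullet> z)) * exp (- \<i> * complex_of_real (x \<bullet> \<xi>))"
        unfolding exp_add[symmetric] inner_add_left inner_commute[of z] by (simp add: algebra_simps)
      then show "?h x \<xi> = (exp (- \<i> * of_real (\<xi> \<bullet> z)) * ?G \<xi>) * (exp (- \<i> * of_real (x \<bullet> \<xi>)) * A x)"
        by (simp only: mult_ac)
    qed
    also have "\<dots> = exp (- \<i> * of_real (\<xi> \<bullet> z)) * ?G \<xi> * fourier A \<xi>"
      by (subst integral_mult_right_zero) (simp add: fourier_lborel)
    finally show "exp (- \<i> * of_real (\<xi> \<bullet> z)) * gauss_cutoff A e \<xi> = ?c * (LINT x|lborel. ?h x \<xi>)"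
      by (simp add: gauss_cutoff_def mult_ac)
  qed
  also have "\<dots> = ?c * (LINT \<xi>|lborel. (LINT x|lborel. ?h x \<xi>))"
    by simp
  also have "(LINT \<xi>|lborel. (LINT x|lborel. ?h x \<xi>)) = (LINT x|lborel. (LINT \<xi>|lborel. ?h x \<xi>))"
    by (rule lborel_pair.Fubini_integral[OF int])
  also have "\<dots> = (LINT x|lborel. A x * of_real (sqrt (2 * pi) ^ DIM('a) / e ^ DIM('a) * gauss ((x + z) /\<^sub>R e)))"
  proof (rule Bochner_Integration.integral_cong[OF refl])
    fix x
    have "(LINT \<xi>|lborel. ?h x \<xi>) = (LINT \<xi>|lborel. A x * (exp (- \<i> * of_real ((x + z) \<bullet> \<xi>)) * ?G \<xi>))"
      by (simp add: mult_ac)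
    then show "(LINT \<xi>|lborel. ?h x \<xi>) = A x * of_real (sqrt (2 * pi) ^ DIM('a) / e ^ DIM('a) * gauss ((x + z) /\<^sub>R e))"
      using fourier_gauss_scaled(2)[OF e, of "x + z"] by simp
  qed
  also have "\<dots> = e ^ DIM('a) *\<^sub>R (LINT t|lborel. A (- z + e *\<^sub>R t) *
      of_real (sqrt (2 * pi) ^ DIM('a) / e ^ DIM('a) * gauss ((- z + e *\<^sub>R t + z) /\<^sub>R e)))"
    using e by (subst lborel_integral_affine[of e _ "- z"]) auto
  also have "?c * \<dots> = ?c * (LINT t|lborel. of_real (sqrt (2 * pi) ^ DIM('a)) * (A (e *\<^sub>R t - z) * of_real (gauss t)))"
    using e by (subst integral_scaleR_right[symmetric]) (simp add: scaleR_conv_of_real mult_ac)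
  also have "\<dots> = ?c * of_real (sqrt (2 * pi) ^ DIM('a)) * (LINT t|lborel. A (e *\<^sub>R t - z) * of_real (gauss t))"
    by (subst integral_mult_right_zero) simp
  also have "?c * of_real (sqrt (2 * pi) ^ DIM('a)) = 1"
    unfolding of_real_mult[symmetric] power_mult_distrib[symmetric] by simp
  finally show ?thesis by simp
qed

lemma gauss_nonzero [simp]: "gauss x \<noteq> 0"
  using gauss_pos[of x] by simp

lemma gauss_nonneg [simp]: "0 \<le> gauss x"
  using gauss_pos[of x] by simp

lemma abs_gauss [simp]: "\<bar>gauss x\<bar> = gauss x"
  using gauss_pos[of x] by simp

text \<open>
  One half of the exponent keeps the integral finite, and the other half is spent on decay in a
  different variable.
\<close>

lemma gauss_split: "gauss t = gauss ((1 / sqrt 2) *\<^sub>R t) * exp (- (norm t)\<^sup>2 / 4)"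
  by (simp add: gauss_def power_divide exp_add[symmetric])

text \<open>
  A majorant that does not depend on \<open>e\<close>. If \<open>A\<close> does not vanish at \<open>e t - z\<close> and \<open>e \<le> 1\<close>, then
  \<open>\<bar>z\<bar> \<le> R + \<bar>t\<bar>\<close>, so decay in \<open>t\<close> becomes decay in \<open>z\<close>. A Gaussian majorant is needed because it
  is a Schwartz function, against which a tempered function can be integrated.
\<close>

lemma fourier_gauss_cutoff_bound:
  fixes A :: "'a::euclidean_space \<Rightarrow> complex"
  assumes A: "A \<in> Cc"
  obtains C where "\<And>e z. 0 < e \<Longrightarrow> e \<le> 1 \<Longrightarrow> norm (fourier (gauss_cutoff A e) z) \<le> C * gauss ((1 / 2) *\<^sub>R z)"
proof -
  obtain R where R: "R > 0" "\<And>x. R < norm x \<Longrightarrow> A x = 0" using Cc_support[OF A] by blast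
  obtain M where M: "M > 0" "\<And>x. norm (A x) \<le> M" using Cc_bounded[OF A] by blast
  have [measurable]: "A \<in> borel_measurable borel" using A by (rule Cc_borel)
  let ?g = "\<lambda>t::'a. gauss ((1 / sqrt 2) *\<^sub>R t)"
  have intg: "integrable lborel ?g"
    by (rule integrable_gauss_scaled) simp
  have bound: "norm (fourier (gauss_cutoff A e) z) \<le>
      (M * exp (R\<^sup>2 / 4) * (LINT t|lborel. ?g t) * sqrt (2 * pi) ^ DIM('a)) * gauss ((1 / 2) *\<^sub>R z)"
    if e: "0 < e" "e \<le> 1" for e z
  proof -
    have "norm (fourier (gauss_cutoff A e) z) \<le> (LINT t|lborel. (M * exp (R\<^sup>2 / 4) * exp (- (norm z)\<^sup>2 / 8)) * ?g t)"
      unfolding fourier_gauss_cutoff[OF A e(1)]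
    proof (rule Bochner_Integration.integral_norm_bound_integral)
      show "integrable lborel (\<lambda>t. A (e *\<^sub>R t - z) * complex_of_real (gauss t))"
      proof (rule Bochner_Integration.integrable_bound)
        show "integrable lborel (\<lambda>t::'a. M * gauss t)" by simp
        show "AE t in lborel. norm (A (e *\<^sub>R t - z) * complex_of_real (gauss t)) \<le> norm (M * gauss t)"
          using M gauss_pos by (intro AE_I2) (auto simp: norm_mult abs_mult intro!: mult_right_mono)
      qed measurable
      show "integrable lborel (\<lambda>t. (M * exp (R\<^sup>2 / 4) * exp (- (norm z)\<^sup>2 / 8)) * ?g t)"
        using intg by simp
      fix t :: 'a
      show "norm (A (e *\<^sub>R t - z) * complex_of_real (gauss t)) \<le> (M * exp (R\<^sup>2 / 4) * exp (- (norm z)\<^sup>2 / 8)) * ?g t"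
      proof (cases "R < norm (e *\<^sub>R t - z)")
        case True
        then show ?thesis using R(2) M gauss_pos[of "(1 / sqrt 2) *\<^sub>R t"] by simp
      next
        case False
        have "norm z \<le> R + e * norm t"
          using False norm_triangle_ineq4[of "e *\<^sub>R t" "e *\<^sub>R t - z"] e by simp
        also have "\<dots> \<le> R + norm t"
          using e by (simp add: mult_left_le_one_le)
        finally have "(norm z)\<^sup>2 \<le> (R + norm t)\<^sup>2" by (intro power_mono) auto
        also have "\<dots> \<le> 2 * R\<^sup>2 + 2 * (norm t)\<^sup>2"
          using zero_le_power2[of "R - norm t"] by (simp add: power2_eq_square algebra_simps)
        finally have "exp (- (norm t)\<^sup>2 / 4) \<le> exp (R\<^sup>2 / 4 + - (norm z)\<^sup>2 / 8)"
          by simp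
        then have "gauss t \<le> ?g t * (exp (R\<^sup>2 / 4) * exp (- (norm z)\<^sup>2 / 8))"
          unfolding gauss_split[of t] exp_add using gauss_pos[of "(1 / sqrt 2) *\<^sub>R t"]
          by (intro mult_left_mono) auto
        then have "norm (A (e *\<^sub>R t - z)) * gauss t \<le> M * (?g t * (exp (R\<^sup>2 / 4) * exp (- (norm z)\<^sup>2 / 8)))"
          using M gauss_pos[of t] by (intro mult_mono) auto
        then show ?thesis using gauss_pos[of t] by (simp add: norm_mult mult_ac)
      qed
    qed
    also have "\<dots> = (M * exp (R\<^sup>2 / 4) * (LINT t|lborel. ?g t) * sqrt (2 * pi) ^ DIM('a)) * gauss ((1 / 2) *\<^sub>R z)"
      by (simp add: gauss_def power_divide)
    finally show ?thesis .
  qed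
  then show thesis using that by blast
qed

lemma tempered_function_gauss_integrable:
  fixes K :: "'a::euclidean_space \<Rightarrow> complex"
  assumes "tempered_function K" "c > 0"
  shows "integrable lebesgue (\<lambda>x. K x * of_real (gauss (c *\<^sub>R x)))"
  using assms(1) gauss_class_schwartz[OF assms(2) gauss_class.pure]
  unfolding tempered_function_def by (rule bspec)

text \<open>
  Measurability is implicit in the integrability against a function without zeros.
\<close>

lemma tempered_function_measurable:
  fixes K :: "'a::euclidean_space \<Rightarrow> complex"
  assumes "tempered_function K" shows "K \<in> borel_measurable lebesgue"
proof -
  have "integrable lebesgue (\<lambda>x. K x * of_real (gauss x))"
    using tempered_function_gauss_integrable[OF assms, of 1] by simp
  moreover have "(\<lambda>x::'a. complex_of_real (1 / gauss x)) \<in> borel_measurable lebesgue"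
    by (rule measurable_completion) measurable
  ultimately have "(\<lambda>x. (K x * of_real (gauss x)) * complex_of_real (1 / gauss x)) \<in> borel_measurable lebesgue"
    by (rule borel_measurable_times[OF borel_measurable_integrable])
  also have "(\<lambda>x. (K x * of_real (gauss x)) * complex_of_real (1 / gauss x)) = K"
    by (simp add: fun_eq_iff)
  finally show ?thesis .
qed

text \<open>
  The averages of \<open>A\<close> converge to its values at \<open>-z\<close> because \<open>A\<close> is continuous, and the majorant
  above dominates them uniformly.
\<close>

lemma gauss_cutoff_limit:
  fixes A K :: "'a::euclidean_space \<Rightarrow> complex"
  assumes A: "A \<in> Cc" and K: "tempered_function K"
  shows "(\<lambda>n. LINT z|lebesgue. K z * fourier (gauss_cutoff A (1 / real (Suc n))) z)
     \<longlonglongrightarrow> (LINT z|lebesgue. K z * A (- z))"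
proof -
  have Am [measurable]: "A \<in> borel_measurable borel" using A by (rule Cc_borel)
  have Km [measurable]: "K \<in> borel_measurable lebesgue" using K by (rule tempered_function_measurable)
  obtain M where M: "M > 0" "\<And>x. norm (A x) \<le> M" using Cc_bounded[OF A] by blast
  obtain C where C: "\<And>e z. 0 < e \<Longrightarrow> e \<le> 1 \<Longrightarrow> norm (fourier (gauss_cutoff A e) z) \<le> C * gauss ((1 / 2) *\<^sub>R z)"
    using fourier_gauss_cutoff_bound[OF A] by blast
  have lim: "(\<lambda>n. fourier (gauss_cutoff A (1 / real (Suc n))) z) \<longlonglongrightarrow> A (- z)" for z
  proof -
    have "(\<lambda>n. LINT t|lborel. A ((1 / real (Suc n)) *\<^sub>R t - z) * complex_of_real (gauss t))
       \<longlonglongrightarrow> (LINT t|lborel. A (- z) * complex_of_real (gauss (t::'a)))"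
    proof (rule integral_dominated_convergence[where w = "\<lambda>t::'a. M * gauss t"])
      show "AE t in lborel. (\<lambda>n. A ((1 / real (Suc n)) *\<^sub>R t - z) * complex_of_real (gauss t))
              \<longlonglongrightarrow> A (- z) * complex_of_real (gauss t)"
      proof (intro AE_I2 tendsto_mult tendsto_const)
        fix t :: 'a
        have "isCont A (- z)"
          using Cc_continuous[OF A, of UNIV] by (simp add: continuous_on_eq_continuous_at)
        moreover have "(\<lambda>n. (1 / real (Suc n)) *\<^sub>R t - z) \<longlonglongrightarrow> - z"
          using tendsto_diff[OF tendsto_scaleR[OF LIMSEQ_Suc[OF lim_1_over_n] tendsto_const[of t]] tendsto_const[of z]]
          by simp
        ultimately show "(\<lambda>n. A ((1 / real (Suc n)) *\<^sub>R t - z)) \<longlonglongrightarrow> A (- z)"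
          by (rule isCont_tendsto_compose)
      qed
      show "AE t in lborel. norm (A ((1 / real (Suc n)) *\<^sub>R t - z) * complex_of_real (gauss t)) \<le> M * gauss t" for n
        using M gauss_pos by (intro AE_I2) (auto simp: norm_mult less_imp_le intro!: mult_right_mono)
    qed auto
    also have "(LINT t|lborel. A (- z) * complex_of_real (gauss (t::'a))) = A (- z)"
      by (subst integral_mult_right_zero) (simp del: of_real_eq_1_iff)
    finally show ?thesis by (subst fourier_gauss_cutoff[OF A]) auto
  qed
  have meas [measurable]: "fourier (gauss_cutoff A e) \<in> borel_measurable lebesgue" for e
    unfolding gauss_cutoff_def[abs_def] by (intro measurable_completion) measurable
  have [measurable]: "(\<lambda>z. A (- z)) \<in> borel_measurable lebesgue"
    by (intro measurable_completion) measurable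
  show ?thesis
  proof (rule integral_dominated_convergence[where w = "\<lambda>z. \<bar>C\<bar> * norm (K z * of_real (gauss ((1 / 2) *\<^sub>R z)))"])
    have "integrable lebesgue (\<lambda>z. K z * of_real (gauss ((1 / 2) *\<^sub>R z)))"
      using tempered_function_gauss_integrable[OF K, of "1 / 2"] by simp
    then show "integrable lebesgue (\<lambda>z. \<bar>C\<bar> * norm (K z * of_real (gauss ((1 / 2) *\<^sub>R z))))"
      by (intro integrable_mult_right integrable_norm)
    show "AE z in lebesgue. (\<lambda>n. K z * fourier (gauss_cutoff A (1 / real (Suc n))) z) \<longlonglongrightarrow> K z * A (- z)"
      by (intro AE_I2 tendsto_mult tendsto_const lim)
    show "AE z in lebesgue. norm (K z * fourier (gauss_cutoff A (1 / real (Suc n))) z)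
       \<le> \<bar>C\<bar> * norm (K z * of_real (gauss ((1 / 2) *\<^sub>R z)))" for n
    proof (rule AE_I2)
      fix z :: 'a
      have "norm (fourier (gauss_cutoff A (1 / real (Suc n))) z) \<le> C * gauss ((1 / 2) *\<^sub>R z)"
        by (rule C) auto
      also have "\<dots> \<le> \<bar>C\<bar> * gauss ((1 / 2) *\<^sub>R z)"
        using gauss_pos by (intro mult_right_mono) (auto simp: less_imp_le)
      finally have "norm (K z) * norm (fourier (gauss_cutoff A (1 / real (Suc n))) z)
          \<le> norm (K z) * (\<bar>C\<bar> * gauss ((1 / 2) *\<^sub>R z))"
        by (intro mult_left_mono) auto
      then show "norm (K z * fourier (gauss_cutoff A (1 / real (Suc n))) z)
       \<le> \<bar>C\<bar> * norm (K z * of_real (gauss ((1 / 2) *\<^sub>R z)))"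
        using gauss_pos[of "(1 / 2) *\<^sub>R z"] by (simp add: norm_mult mult_ac)
    qed
  qed measurable
qed

section \<open>Autocorrelations\<close>

lemma borel_measurable_cnj [measurable]: "cnj \<in> borel_measurable borel"
  by (intro borel_measurable_continuous_onI continuous_intros)

definition autocorrelation :: "('a::euclidean_space \<Rightarrow> complex) \<Rightarrow> 'a \<Rightarrow> complex" where
  "autocorrelation w u = (LINT y|lborel. w (y + u) * cnj (w y))"

lemma Cc_shift: "w \<in> Cc \<Longrightarrow> (\<lambda>y. w (y + u)) \<in> Cc"
  using Cc_affine[of w 1 u] by (simp add: add.commute)

lemma Cc_integrable_norm_sq: "w \<in> Cc \<Longrightarrow> integrable lborel (\<lambda>x. (norm (w x))\<^sup>2)"
  using integrable_norm[OF Cc_integrable[OF Cc_mult[of w w]]] Cc_continuous[of w UNIV]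
  by (simp add: norm_mult power2_eq_square)

text \<open>
  The integrand is at most the mean of \<open>\<bar>w(y + u)\<bar>\<^sup>2\<close> and \<open>\<bar>w(y)\<bar>\<^sup>2\<close>, whose integrals agree by
  translation invariance. The mass of a regularized \<open>\<bar>fourier w\<bar>\<^sup>2\<close> is an average of the
  autocorrelation, so this bound plays the part of Plancherel's theorem.
\<close>

lemma norm_autocorrelation_le:
  fixes w :: "'a::euclidean_space \<Rightarrow> complex"
  assumes w: "w \<in> Cc"
  shows "norm (autocorrelation w u) \<le> (LINT y|lborel. (norm (w y))\<^sup>2)"
proof -
  have sh: "(\<lambda>y. w (y + u)) \<in> Cc" using w by (rule Cc_shift)
  have "norm (autocorrelation w u) \<le> (LINT y|lborel. ((norm (w (y + u)))\<^sup>2 + (norm (w y))\<^sup>2) / 2)"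
    unfolding autocorrelation_def
  proof (rule Bochner_Integration.integral_norm_bound_integral)
    show "integrable lborel (\<lambda>y. w (y + u) * cnj (w y))"
      by (intro Cc_integrable Cc_mult Cc_cnj w Cc_continuous[OF sh])
    show "integrable lborel (\<lambda>y. ((norm (w (y + u)))\<^sup>2 + (norm (w y))\<^sup>2) / 2)"
      using Cc_integrable_norm_sq[OF w] Cc_integrable_norm_sq[OF sh] by simp
    show "norm (w (y + u) * cnj (w y)) \<le> ((norm (w (y + u)))\<^sup>2 + (norm (w y))\<^sup>2) / 2" for y
      using zero_le_power2[of "norm (w (y + u)) - norm (w y)"]
      by (simp add: norm_mult power2_eq_square algebra_simps)
  qed
  also have "\<dots> = ((LINT y|lborel. (norm (w (y + u)))\<^sup>2) + (LINT y|lborel. (norm (w y))\<^sup>2)) / 2"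
    using Cc_integrable_norm_sq[OF w] Cc_integrable_norm_sq[OF sh] by simp
  also have "(LINT y|lborel. (norm (w (y + u)))\<^sup>2) = (LINT y|lborel. (norm (w y))\<^sup>2)"
  proof -
    have [measurable]: "w \<in> borel_measurable borel" using w by (rule Cc_borel)
    show ?thesis
      by (subst (2) lborel_integral_affine[of 1 _ u]) (simp_all add: add.commute)
  qed
  finally show ?thesis by simp
qed

lemma autocorrelation_Cc:
  fixes w :: "'a::euclidean_space \<Rightarrow> complex"
  assumes w: "w \<in> Cc" shows "autocorrelation w \<in> Cc"
proof -
  have [measurable]: "w \<in> borel_measurable borel" using w by (rule Cc_borel)
  obtain R where R: "R > 0" "\<And>x. R < norm x \<Longrightarrow> w x = 0" using Cc_support[OF w] by blast
  obtain M where M: "M > 0" "\<And>x. norm (w x) \<le> M" using Cc_bounded[OF w] by blast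
  have "autocorrelation w u = 0" if "2 * R < norm u" for u
  proof -
    have "w (y + u) * cnj (w y) = 0" for y
      using R(2)[of y] R(2)[of "y + u"] norm_triangle_ineq4[of "y + u" y] that by fastforce
    then have "(\<lambda>y. w (y + u) * cnj (w y)) = (\<lambda>_. 0)" by (rule ext)
    then show ?thesis unfolding autocorrelation_def by (simp only: integral_zero)
  qed
  moreover have "continuous_on UNIV (autocorrelation w)"
  proof (subst continuous_on_sequentially, safe)
    fix U :: "nat \<Rightarrow> 'a" and u
    assume lim: "U \<longlonglongrightarrow> u"
    have "(\<lambda>n. LINT y|lborel. w (y + U n) * cnj (w y)) \<longlonglongrightarrow> (LINT y|lborel. w (y + u) * cnj (w y))"
    proof (rule integral_dominated_convergence[where w = "\<lambda>y. M * norm (w y)"])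
      show "integrable lborel (\<lambda>y. M * norm (w y))"
        using Cc_integrable[OF w] by simp
      show "AE y in lborel. (\<lambda>n. w (y + U n) * cnj (w y)) \<longlonglongrightarrow> w (y + u) * cnj (w y)"
      proof (intro AE_I2 tendsto_mult tendsto_const)
        fix y
        have "isCont w (y + u)"
          using Cc_continuous[OF w, of UNIV] by (simp add: continuous_on_eq_continuous_at)
        then show "(\<lambda>n. w (y + U n)) \<longlonglongrightarrow> w (y + u)"
          by (rule isCont_tendsto_compose) (intro tendsto_intros lim)
      qed
      show "AE y in lborel. norm (w (y + U n) * cnj (w y)) \<le> M * norm (w y)" for n
        using M by (auto simp: norm_mult intro!: mult_right_mono)
    qed measurable
    then show "(autocorrelation w \<circ> U) \<longlonglongrightarrow> autocorrelation w u"
      by (simp add: autocorrelation_def comp_def)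
  qed
  ultimately show ?thesis
    using R(1) unfolding Cc_def by (auto intro!: exI[of _ "2 * R"])
qed

lemma fourier_autocorrelation:
  fixes w :: "'a::euclidean_space \<Rightarrow> complex"
  assumes w: "w \<in> Cc"
  shows "fourier (autocorrelation w) \<xi> = of_real ((norm (fourier w \<xi>))\<^sup>2)"
proof -
  have wm [measurable]: "w \<in> borel_measurable borel" using w by (rule Cc_borel)
  have [measurable]: "autocorrelation w \<in> borel_measurable borel"
    using autocorrelation_Cc[OF w] by (rule Cc_borel)
  let ?h = "\<lambda>y u. exp (- \<i> * of_real (u \<bullet> \<xi>)) * (w (y + u) * cnj (w y))"
  have int: "integrable (lborel \<Otimes>\<^sub>M lborel) (case_prod ?h)"
  proof (rule lborel_pair.Fubini_integrable)
    have eq: "norm (?h y u) = norm (w (y + u)) * norm (w y)" for y u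
      by (simp add: norm_mult)
    have sh: "(\<lambda>u. w (y + u)) \<in> Cc" for y
      using Cc_affine[OF w, of 1 y] by simp
    have "(LINT u|lborel. norm (w (y + u))) = (LINT u|lborel. norm (w u))" for y
      by (subst (2) lborel_integral_affine[of 1 _ y]) auto
    then show "integrable lborel (\<lambda>y. LINT u|lborel. norm (case (y, u) of (y, u) \<Rightarrow> ?h y u))"
      unfolding prod.case eq using Cc_integrable[OF w] by simp
    show "AE y in lborel. integrable lborel (\<lambda>u. case (y, u) of (y, u) \<Rightarrow> ?h y u)"
    proof (rule AE_I2, unfold prod.case)
      fix y
      have "(\<lambda>u. (exp (- \<i> * of_real (u \<bullet> \<xi>)) * cnj (w y)) * w (y + u)) \<in> Cc"
        by (intro Cc_mult sh continuous_intros)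
      from Cc_integrable[OF this] show "integrable lborel (?h y)"
        by (simp add: mult_ac)
    qed
  qed measurable
  have "fourier (autocorrelation w) \<xi> = (LINT u|lborel. LINT y|lborel. ?h y u)"
    by (simp add: fourier_lborel autocorrelation_def)
  also have "\<dots> = (LINT y|lborel. LINT u|lborel. ?h y u)"
    by (rule lborel_pair.Fubini_integral[OF int])
  also have "\<dots> = (LINT y|lborel. fourier w \<xi> * cnj (exp (- \<i> * of_real (y \<bullet> \<xi>)) * w y))"
  proof (rule Bochner_Integration.integral_cong[OF refl])
    fix y
    have "fourier w \<xi> = (LINT u|lborel. exp (- \<i> * of_real ((y + u) \<bullet> \<xi>)) * w (y + u))"
      by (subst fourier_lborel, simp, subst lborel_integral_affine[of 1 _ y]) auto
    then have "fourier w \<xi> * cnj (exp (- \<i> * of_real (y \<bullet> \<xi>)) * w y) =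
      (LINT u|lborel. exp (- \<i> * of_real ((y + u) \<bullet> \<xi>)) * w (y + u) * cnj (exp (- \<i> * of_real (y \<bullet> \<xi>)) * w y))"
      by (subst integral_mult_left_zero) simp
    also have "\<dots> = (LINT u|lborel. ?h y u)"
    proof (rule Bochner_Integration.integral_cong[OF refl])
      fix u
      have "exp (- \<i> * of_real ((y + u) \<bullet> \<xi>)) * exp (\<i> * of_real (y \<bullet> \<xi>)) = exp (- \<i> * complex_of_real (u \<bullet> \<xi>))"
        by (simp add: exp_add[symmetric] inner_add_left distrib_left)
      then show "exp (- \<i> * of_real ((y + u) \<bullet> \<xi>)) * w (y + u) * cnj (exp (- \<i> * of_real (y \<bullet> \<xi>)) * w y) = ?h y u"
        by (simp add: exp_cnj mult_ac)
    qed
    finally show "(LINT u|lborel. ?h y u) = fourier w \<xi> * cnj (exp (- \<i> * of_real (y \<bullet> \<xi>)) * w y)"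
      by simp
  qed
  also have "\<dots> = fourier w \<xi> * cnj (fourier w \<xi>)"
    by (subst integral_mult_right_zero, subst Bochner_Integration.integral_cnj) (simp add: fourier_lborel)
  finally show ?thesis unfolding complex_norm_square .
qed

section \<open>The trace inequality for test functions\<close>

text \<open>
  The heart of the proof. The pairing with \<open>K\<close> is moved to \<open>Khat\<close>, where the test functions
  \<open>\<phi> i\<close> are nonnegative, and \<open>\<bar>Khat\<bar>\<close> is split as \<open>\<bar>Khat\<bar> \<le> (\<bar>Khat\<bar> - 1)\<^sub>+ + 1\<close>. The first part
  meets the pointwise bound \<open>B\<close> on \<open>\<Sum>\<^sub>i \<bar>fourier (w i)\<bar>\<^sup>2\<close>, and the second one meets the masses of the
  \<open>\<phi> i\<close>.
\<close>

lemma trace_inequality_regularized: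
  fixes K Khat :: "'a::euclidean_space \<Rightarrow> complex" and w :: "'i \<Rightarrow> 'a \<Rightarrow> complex"
  assumes ft: "has_fourier_transform K Khat" and I: "finite I"
    and w: "\<And>i. i \<in> I \<Longrightarrow> w i \<in> Cc" and \<sigma>: "\<And>i. i \<in> I \<Longrightarrow> \<bar>\<sigma> i\<bar> \<le> 1"
    and B: "\<And>\<xi>. (\<Sum>i\<in>I. (norm (fourier (w i) \<xi>))\<^sup>2) \<le> B"
    and J: "integrable lebesgue (\<lambda>\<xi>. max (norm (Khat \<xi>) - 1) 0)"
    and e: "e > 0"
  shows "(\<Sum>i\<in>I. \<sigma> i * Re (LINT z|lebesgue. K z * fourier (gauss_cutoff (autocorrelation (w i)) e) z))
     \<le> (2 * pi) powr (- real DIM('a)) * B * (LINT \<xi>|lebesgue. max (norm (Khat \<xi>) - 1) 0)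
        + (\<Sum>i\<in>I. LINT x|lborel. (norm (w i x))\<^sup>2)"
proof -
  define c where "c = (1 / sqrt (2 * pi)) ^ DIM('a)"
  have c: "c > 0" by (simp add: c_def)
  have c2: "c * c = (2 * pi) powr (- real DIM('a))"
  proof -
    have "1 / sqrt (2 * pi) * (1 / sqrt (2 * pi)) = 1 / (2 * pi)" by simp
    then have "c * c = (1 / (2 * pi)) ^ DIM('a)"
      unfolding c_def power_mult_distrib[symmetric] by (rule arg_cong)
    then show ?thesis by (simp add: powr_minus_divide powr_realpow power_one_over)
  qed
  define \<phi> where "\<phi> i \<xi> = c * (norm (fourier (w i) \<xi>))\<^sup>2 * gauss (e *\<^sub>R \<xi>)" for i \<xi>
  have \<phi>_nonneg: "\<phi> i \<xi> \<ge> 0" for i \<xi>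
    using c gauss_pos[of "e *\<^sub>R \<xi>"] by (simp add: \<phi>_def)
  have cutoff: "gauss_cutoff (autocorrelation (w i)) e = (\<lambda>\<xi>. of_real (\<phi> i \<xi>))" if "i \<in> I" for i
    by (simp add: fun_eq_iff gauss_cutoff_def fourier_autocorrelation[OF w[OF that]] \<phi>_def c_def)
  have schw: "(\<lambda>\<xi>. complex_of_real (\<phi> i \<xi>)) \<in> schwartz" if "i \<in> I" for i
    using gauss_cutoff_schwartz[OF autocorrelation_Cc[OF w[OF that]] e] unfolding cutoff[OF that] .
  have \<phi>_int: "integrable lborel (\<phi> i)" if i: "i \<in> I" for i
  proof -
    have [measurable]: "w i \<in> borel_measurable borel" using w[OF i] by (rule Cc_borel)
    obtain M where M: "M \<ge> 0" "\<And>\<xi>. norm (fourier (w i) \<xi>) \<le> M"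
      using fourier_Cc_bounded[OF w[OF i]] by blast
    show ?thesis
    proof (rule Bochner_Integration.integrable_bound)
      show "integrable lborel (\<lambda>\<xi>::'a. c * M\<^sup>2 * gauss (e *\<^sub>R \<xi>))"
        using e by (intro integrable_mult_right integrable_gauss_scaled) simp
      show "\<phi> i \<in> borel_measurable lborel"
        unfolding \<phi>_def by measurable
      show "AE \<xi> in lborel. norm (\<phi> i \<xi>) \<le> norm (c * M\<^sup>2 * gauss (e *\<^sub>R \<xi>))"
        using c M gauss_pos
        by (intro AE_I2) (auto simp: \<phi>_def abs_mult less_imp_le intro!: mult_right_mono mult_left_mono power_mono)
    qed
  qed
  have \<phi>_int': "integrable lebesgue (\<phi> i)" if "i \<in> I" for i
    using \<phi>_int[OF that] by (subst integrable_completion) auto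
  have mass: "(LINT \<xi>|lebesgue. \<phi> i \<xi>) \<le> (LINT x|lborel. (norm (w i x))\<^sup>2)" if i: "i \<in> I" for i
  proof -
    have "complex_of_real (LINT \<xi>|lebesgue. \<phi> i \<xi>) = fourier (gauss_cutoff (autocorrelation (w i)) e) 0"
      by (simp add: cutoff[OF i] fourier_def)
    also have "\<dots> = (LINT t|lborel. autocorrelation (w i) (e *\<^sub>R t) * of_real (gauss t))"
      using fourier_gauss_cutoff[OF autocorrelation_Cc[OF w[OF i]] e, of 0] by simp
    finally have "\<bar>LINT \<xi>|lebesgue. \<phi> i \<xi>\<bar> = norm (LINT t|lborel. autocorrelation (w i) (e *\<^sub>R t) * of_real (gauss t))"
      by (metis norm_of_real)
    also have "\<dots> \<le> (LINT t|lborel. (LINT x|lborel. (norm (w i x))\<^sup>2) * gauss (t::'a))"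
    proof (rule order_trans[OF integral_norm_bound], rule integral_mono_AE')
      show "integrable lborel (\<lambda>t::'a. (LINT x|lborel. (norm (w i x))\<^sup>2) * gauss t)" by simp
      show "AE t in lborel. norm (autocorrelation (w i) (e *\<^sub>R t) * of_real (gauss t)) \<le> (LINT x|lborel. (norm (w i x))\<^sup>2) * gauss t"
        using norm_autocorrelation_le[OF w[OF i]] gauss_pos
        by (intro AE_I2) (auto simp: norm_mult less_imp_le intro!: mult_right_mono)
      show "AE t in lborel. 0 \<le> (LINT x|lborel. (norm (w i x))\<^sup>2) * gauss (t::'a)"
        by (simp add: integral_nonneg_AE)
    qed
    also have "\<dots> = (LINT x|lborel. (norm (w i x))\<^sup>2)" by simp
    finally show ?thesis by simp
  qed
  have S_le: "(\<Sum>i\<in>I. \<phi> i \<xi>) \<le> c * c * B" for \<xi>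
  proof -
    \<comment> \<open>One factor \<open>c\<close> is the prefactor of \<open>\<phi>\<close>, the other one is the maximum of \<open>gauss\<close>.\<close>
    have g: "gauss (e *\<^sub>R \<xi>) \<le> c"
      by (simp add: gauss_def c_def)
    have "(\<Sum>i\<in>I. \<phi> i \<xi>) = (\<Sum>i\<in>I. (norm (fourier (w i) \<xi>))\<^sup>2) * (c * gauss (e *\<^sub>R \<xi>))"
      unfolding \<phi>_def sum_distrib_right by (rule sum.cong[OF refl]) (simp add: mult_ac)
    also have "\<dots> \<le> B * (c * c)"
      using B[of \<xi>] g c gauss_pos[of "e *\<^sub>R \<xi>"]
      by (intro mult_mono) (auto intro: order_trans[OF sum_nonneg B] simp: less_imp_le)
    finally show ?thesis by (simp add: mult_ac)
  qed
  have Khat_int: "integrable lebesgue (\<lambda>\<xi>. Khat \<xi> * of_real (\<phi> i \<xi>))" if "i \<in> I" for i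
    using ft schw[OF that] by (simp add: has_fourier_transform_def tempered_function_def)
  have nKhat_int: "integrable lebesgue (\<lambda>\<xi>. norm (Khat \<xi>) * \<phi> i \<xi>)" if "i \<in> I" for i
    using integrable_norm[OF Khat_int[OF that]] \<phi>_nonneg by (simp add: norm_mult)
  have "\<sigma> i * Re (LINT z|lebesgue. K z * fourier (gauss_cutoff (autocorrelation (w i)) e) z)
     \<le> (LINT \<xi>|lebesgue. norm (Khat \<xi>) * \<phi> i \<xi>)" if i: "i \<in> I" for i
  proof -
    have "(LINT z|lebesgue. K z * fourier (gauss_cutoff (autocorrelation (w i)) e) z) =
       (LINT \<xi>|lebesgue. Khat \<xi> * of_real (\<phi> i \<xi>))" (is "?L = ?R")
      using ft schw[OF i] unfolding has_fourier_transform_def cutoff[OF i] by metis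
    then have "\<sigma> i * Re ?L \<le> norm ?R"
    proof -
      have "\<sigma> i * Re ?R \<le> \<bar>\<sigma> i\<bar> * \<bar>Re ?R\<bar>"
        unfolding abs_mult[symmetric] by (rule abs_ge_self)
      also have "\<dots> \<le> 1 * norm ?R"
        by (intro mult_mono \<sigma>[OF i] abs_Re_le_cmod) auto
      finally show ?thesis unfolding \<open>?L = ?R\<close> by simp
    qed
    also have "\<dots> \<le> (LINT \<xi>|lebesgue. norm (Khat \<xi> * of_real (\<phi> i \<xi>)))"
      by (rule integral_norm_bound)
    finally show ?thesis using \<phi>_nonneg by (simp add: norm_mult)
  qed
  then have "(\<Sum>i\<in>I. \<sigma> i * Re (LINT z|lebesgue. K z * fourier (gauss_cutoff (autocorrelation (w i)) e) z))
     \<le> (\<Sum>i\<in>I. LINT \<xi>|lebesgue. norm (Khat \<xi>) * \<phi> i \<xi>)"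
    by (rule sum_mono)
  also have "\<dots> = (LINT \<xi>|lebesgue. (\<Sum>i\<in>I. norm (Khat \<xi>) * \<phi> i \<xi>))"
    by (rule Bochner_Integration.integral_sum[symmetric]) (rule nKhat_int)
  also have "\<dots> \<le> (LINT \<xi>|lebesgue. c * c * B * max (norm (Khat \<xi>) - 1) 0 + (\<Sum>i\<in>I. \<phi> i \<xi>))"
  proof (rule integral_mono)
    show "integrable lebesgue (\<lambda>\<xi>. \<Sum>i\<in>I. norm (Khat \<xi>) * \<phi> i \<xi>)"
      by (intro Bochner_Integration.integrable_sum nKhat_int)
    show "integrable lebesgue (\<lambda>\<xi>. c * c * B * max (norm (Khat \<xi>) - 1) 0 + (\<Sum>i\<in>I. \<phi> i \<xi>))"
      by (intro Bochner_Integration.integrable_add integrable_mult_right J Bochner_Integration.integrable_sum \<phi>_int')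
    fix \<xi>
    let ?S = "\<Sum>i\<in>I. \<phi> i \<xi>" and ?m = "max (norm (Khat \<xi>) - 1) 0"
    have S0: "?S \<ge> 0" by (intro sum_nonneg \<phi>_nonneg)
    have "(\<Sum>i\<in>I. norm (Khat \<xi>) * \<phi> i \<xi>) = norm (Khat \<xi>) * ?S"
      by (simp add: sum_distrib_left)
    also have "\<dots> \<le> (?m + 1) * ?S"
      by (intro mult_right_mono S0) auto
    also have "\<dots> = ?S * ?m + ?S" by (simp add: algebra_simps)
    also have "?S * ?m \<le> c * c * B * ?m"
      by (intro mult_right_mono S_le) auto
    finally show "(\<Sum>i\<in>I. norm (Khat \<xi>) * \<phi> i \<xi>) \<le> c * c * B * ?m + ?S" by simp
  qed
  also have "\<dots> = c * c * B * (LINT \<xi>|lebesgue. max (norm (Khat \<xi>) - 1) 0) + (\<Sum>i\<in>I. LINT \<xi>|lebesgue. \<phi> i \<xi>)"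
    using J \<phi>_int' by (simp add: Bochner_Integration.integral_add Bochner_Integration.integral_sum)
  also have "\<dots> \<le> c * c * B * (LINT \<xi>|lebesgue. max (norm (Khat \<xi>) - 1) 0) + (\<Sum>i\<in>I. LINT x|lborel. (norm (w i x))\<^sup>2)"
    by (intro add_left_mono sum_mono mass)
  finally show ?thesis unfolding c2 .
qed

lemma trace_inequality_test_functions:
  fixes K Khat :: "'a::euclidean_space \<Rightarrow> complex" and w :: "'i \<Rightarrow> 'a \<Rightarrow> complex"
  assumes ft: "has_fourier_transform K Khat" and I: "finite I"
    and w: "\<And>i. i \<in> I \<Longrightarrow> w i \<in> Cc" and \<sigma>: "\<And>i. i \<in> I \<Longrightarrow> \<bar>\<sigma> i\<bar> \<le> 1"
    and B: "\<And>\<xi>. (\<Sum>i\<in>I. (norm (fourier (w i) \<xi>))\<^sup>2) \<le> B"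
    and J: "integrable lebesgue (\<lambda>\<xi>. max (norm (Khat \<xi>) - 1) 0)"
  shows "(\<Sum>i\<in>I. \<sigma> i * Re (LINT z|lebesgue. K z * autocorrelation (w i) (- z)))
     \<le> (2 * pi) powr (- real DIM('a)) * B * (LINT \<xi>|lebesgue. max (norm (Khat \<xi>) - 1) 0)
        + (\<Sum>i\<in>I. LINT x|lborel. (norm (w i x))\<^sup>2)"
proof (rule LIMSEQ_le_const2)
  have K: "tempered_function K" using ft by (simp add: has_fourier_transform_def)
  show "(\<lambda>n. \<Sum>i\<in>I. \<sigma> i * Re (LINT z|lebesgue. K z * fourier (gauss_cutoff (autocorrelation (w i)) (1 / real (Suc n))) z))
     \<longlonglongrightarrow> (\<Sum>i\<in>I. \<sigma> i * Re (LINT z|lebesgue. K z * autocorrelation (w i) (- z)))"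
    by (intro tendsto_sum tendsto_mult tendsto_const tendsto_Re gauss_cutoff_limit autocorrelation_Cc w K)
qed (intro exI[of _ 0] allI impI trace_inequality_regularized assms, auto)

section \<open>The quadratic form of the convolution operator\<close>

text \<open>
  Replacing \<open>K\<close> by an almost everywhere equal Borel function, which Fubini's theorem calls for,
  changes \<open>y \<mapsto> K(x - y)\<close> only on a null set, for every \<open>x\<close>.
\<close>

lemma AE_lborel_reflect:
  fixes P :: "'a::euclidean_space \<Rightarrow> bool"
  assumes "AE z in lborel. P z" shows "AE y in lborel. P (x - y)"
proof -
  obtain N where N: "{z. \<not> P z} \<subseteq> N" "N \<in> sets lborel" "emeasure lborel N = 0"
    using assms by (auto elim!: AE_E)
  have [measurable]: "N \<in> sets borel" using N by simp
  have "AE z in lborel. z \<notin> N"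
    using N by (intro AE_not_in) (auto simp: null_sets_def)
  then have "AE z in density (distr lborel borel (\<lambda>y. x + (-1) *\<^sub>R y)) (\<lambda>_. \<bar>-1::real\<bar> ^ DIM('a)). z \<notin> N"
    by (subst (asm) lborel_affine[of "-1" x]) simp_all
  then have "AE y in lborel. x + (-1) *\<^sub>R y \<notin> N"
    by (simp add: AE_density AE_distr_iff)
  then show ?thesis using N(1) by (auto elim!: eventually_mono)
qed

lemma lebesgue_measurable_reflect:
  fixes x :: "'a::euclidean_space"
  shows "(\<lambda>y. x - y) \<in> lebesgue \<rightarrow>\<^sub>M lebesgue"
proof -
  have "(\<Sum>j\<in>Basis. (- 1 * (y \<bullet> j)) *\<^sub>R j) = - y" for y :: 'a
    by (simp add: sum_negf euclidean_representation)
  then show ?thesis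
    using lebesgue_affine_measurable[of "\<lambda>_::'a. - 1" x] by simp
qed

lemma complex_borel_version:
  fixes K :: "'a::euclidean_space \<Rightarrow> complex"
  assumes [measurable]: "K \<in> borel_measurable lebesgue"
  obtains K' where "K' \<in> borel_measurable borel" "AE z in lborel. K z = K' z"
proof -
  have "(\<lambda>x. Re (K x)) \<in> borel_measurable lebesgue" "(\<lambda>x. Im (K x)) \<in> borel_measurable lebesgue"
    by measurable
  then obtain f g where f: "f \<in> borel_measurable lborel" "AE x in lborel. Re (K x) = f x"
     and g: "g \<in> borel_measurable lborel" "AE x in lborel. Im (K x) = g x"
    by (metis completion_ex_borel_measurable_real)
  have [measurable]: "f \<in> borel_measurable borel" "g \<in> borel_measurable borel"
    using f g by simp_all
  have "(\<lambda>x. complex_of_real (f x) + \<i> * complex_of_real (g x)) \<in> borel_measurable borel" by measurable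
  moreover have "AE z in lborel. K z = complex_of_real (f z) + \<i> * complex_of_real (g z)"
    using f(2) g(2) by eventually_elim (simp add: complex_eq_iff)
  ultimately show thesis using that by blast
qed

text \<open>
  Substituting \<open>z = x - y\<close> and exchanging the integrations collects \<open>w(x - z)\<close> and \<open>cnj (w x)\<close> into
  the autocorrelation. The exchange is allowed since only \<open>\<bar>z\<bar> \<le> 2R\<close> contributes when \<open>w\<close> is
  supported in the ball of radius \<open>R\<close>, and \<open>K\<close> is integrable there.
\<close>

lemma L2_inner_conv_operator:
  fixes K w :: "'a::euclidean_space \<Rightarrow> complex"
  assumes \<Omega>: "\<Omega> \<in> sets lebesgue" and K: "tempered_function K"
    and w: "w \<in> Cc" and supp: "\<And>x. x \<notin> \<Omega> \<Longrightarrow> w x = 0"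
  shows "L2_inner \<Omega> (conv_operator K \<Omega> w) w = (LINT z|lebesgue. K z * autocorrelation w (- z))"
proof -
  have wm [measurable]: "w \<in> borel_measurable borel" using w by (rule Cc_borel)
  have Km [measurable]: "K \<in> borel_measurable lebesgue" using K by (rule tempered_function_measurable)
  obtain K' where K'm [measurable]: "K' \<in> borel_measurable borel" and K': "AE z in lborel. K z = K' z"
    using complex_borel_version[OF Km] by blast
  obtain R where R: "R > 0" "\<And>x. R < norm x \<Longrightarrow> w x = 0" using Cc_support[OF w] by blast
  obtain M where M: "M > 0" "\<And>x. norm (w x) \<le> M" using Cc_bounded[OF w] by blast
  have \<Omega>': "\<Omega> \<inter> space lebesgue \<in> sets lebesgue"
    using \<Omega> by (simp only: space_completion space_lborel space_borel Int_UNIV_right)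
  have conv: "conv_operator K \<Omega> w x = (LINT y|lborel. K' (x - y) * w y)" for x
  proof -
    have "conv_operator K \<Omega> w x = (LINT y|lebesgue. indicator \<Omega> y *\<^sub>R (K (x - y) * w y))"
      unfolding conv_operator_def by (rule integral_restrict_space[OF \<Omega>'])
    also have "\<dots> = (LINT y|lebesgue. K (x - y) * w y)"
      by (rule Bochner_Integration.integral_cong[OF refl]) (use supp in \<open>auto simp: indicator_def\<close>)
    also have "\<dots> = (LINT y|lebesgue. K' (x - y) * w y)"
    proof -
      have ae: "AE y in lebesgue. K (x - y) * w y = K' (x - y) * w y"
        using AE_lborel_reflect[OF K', of x] by (intro AE_completion) (auto elim!: eventually_mono)
      have m: "(\<lambda>y. K' (x - y) * w y) \<in> borel_measurable lebesgue"
        by (rule measurable_completion) measurable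
      have m2: "w \<in> borel_measurable lebesgue"
        by (rule measurable_completion) measurable
      show ?thesis
        by (rule integral_cong_AE[OF borel_measurable_times[OF measurable_compose[OF lebesgue_measurable_reflect Km] m2] m ae])
    qed
    also have "\<dots> = (LINT y|lborel. K' (x - y) * w y)"
      by (rule integral_completion) measurable
    finally show ?thesis .
  qed
  have "L2_inner \<Omega> (conv_operator K \<Omega> w) w =
      (LINT x|lebesgue. indicator \<Omega> x *\<^sub>R ((LINT y|lborel. K' (x - y) * w y) * cnj (w x)))"
    unfolding L2_inner_def conv by (rule integral_restrict_space[OF \<Omega>'])
  also have "\<dots> = (LINT x|lebesgue. (LINT y|lborel. K' (x - y) * w y) * cnj (w x))"
    by (rule Bochner_Integration.integral_cong[OF refl]) (use supp in \<open>auto simp: indicator_def\<close>)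
  also have "\<dots> = (LINT x|lborel. (LINT y|lborel. K' (x - y) * w y) * cnj (w x))"
    by (rule integral_completion) measurable
  also have "\<dots> = (LINT x|lborel. (LINT z|lborel. K' z * w (x - z) * cnj (w x)))"
  proof (rule Bochner_Integration.integral_cong[OF refl])
    fix x
    have "(LINT y|lborel. K' (x - y) * w y) = (LINT z|lborel. K' z * w (x - z))"
      by (subst lborel_integral_affine[of "-1" _ x]) (simp_all add: algebra_simps)
    then show "(LINT y|lborel. K' (x - y) * w y) * cnj (w x) = (LINT z|lborel. K' z * w (x - z) * cnj (w x))"
      by (subst integral_mult_left_zero) simp
  qed
  also have "\<dots> = (LINT z|lborel. (LINT x|lborel. K' z * w (x - z) * cnj (w x)))"
  proof (rule lborel_pair.Fubini_integral[symmetric])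
    have "integrable lebesgue (\<lambda>x. K x * of_real (gauss x))"
      using tempered_function_gauss_integrable[OF K, of 1] by simp
    then have "integrable lebesgue (\<lambda>x. K' x * of_real (gauss x))"
      by (rule integrable_cong_AE_imp) (use K' in \<open>auto intro!: AE_completion measurable_completion elim!: eventually_mono\<close>)
    then have intK: "integrable lborel (\<lambda>x. K' x * of_real (gauss x))"
      by (subst (asm) integrable_completion) auto
    have [measurable]: "cball (0::'a) (2 * R) \<in> sets borel" by simp
    \<comment> \<open>On a ball the Gaussian is bounded below, so integrability against it is local integrability.\<close>
    have K'R: "integrable lborel (\<lambda>z. K' z * of_real (indicator (cball 0 (2 * R)) z))"
    proof (rule Bochner_Integration.integrable_bound)
      let ?c = "(1 / sqrt (2 * pi)) ^ DIM('a) * exp (- (2 * R)\<^sup>2 / 2)"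
      have c: "?c > 0" by simp
      show "integrable lborel (\<lambda>x. (1 / ?c) *\<^sub>R (K' x * of_real (gauss x)))"
        using intK by (rule integrable_scaleR_right)
      show "AE z in lborel. norm (K' z * complex_of_real (indicator (cball 0 (2 * R)) z))
          \<le> norm ((1 / ?c) *\<^sub>R (K' z * complex_of_real (gauss z)))"
      proof (rule AE_I2)
        fix z :: 'a
        show "norm (K' z * complex_of_real (indicator (cball 0 (2 * R)) z))
          \<le> norm ((1 / ?c) *\<^sub>R (K' z * complex_of_real (gauss z)))"
        proof (cases "norm z \<le> 2 * R")
          case True
          then have "(norm z)\<^sup>2 \<le> (2 * R)\<^sup>2" by (intro power_mono) auto
          then have "gauss z \<ge> ?c" by (simp add: gauss_def)
          then have "1 \<le> gauss z / ?c" using c by (simp add: pos_le_divide_eq)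
          then have "norm (K' z) * 1 \<le> norm (K' z) * (gauss z / ?c)"
            by (intro mult_left_mono) auto
          then show ?thesis
            using True c gauss_pos[of z] by (simp add: norm_mult abs_mult)
        qed simp
      qed
    qed measurable
    let ?f = "\<lambda>z. K' z * of_real (indicator (cball 0 (2 * R)) z)"
    have "integrable (lborel \<Otimes>\<^sub>M lborel) (\<lambda>(x, z). K' z * w (x - z) * cnj (w x))"
    proof (rule integrable_lborel_tensor[where f = "\<lambda>x. of_real M * w x" and g = ?f])
      show "integrable lborel (\<lambda>x. complex_of_real M * w x)"
        using Cc_integrable[OF w] by simp
      show "norm (case (x, z) of (x, z) \<Rightarrow> K' z * w (x - z) * cnj (w x)) \<le> norm (complex_of_real M * w x) * norm (?f z)" for x z
      proof (cases "norm z \<le> 2 * R")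
        case True
        have "norm (w (x - z)) * (norm (K' z) * norm (w x)) \<le> M * (norm (K' z) * norm (w x))"
          using M by (intro mult_right_mono) auto
        then show ?thesis using True M(1) by (simp add: norm_mult mult_ac)
      next
        case False
        then have "w x = 0 \<or> w (x - z) = 0"
          using R(2)[of x] R(2)[of "x - z"] norm_triangle_ineq4[of x "x - z"] by fastforce
        then show ?thesis by auto
      qed
    qed (use K'R in auto)
    then show "integrable (lborel \<Otimes>\<^sub>M lborel) (\<lambda>(x, z). K' z * w (x - z) * cnj (w x))" .
  qed
  also have "\<dots> = (LINT z|lborel. K' z * autocorrelation w (- z))"
  proof (rule Bochner_Integration.integral_cong[OF refl])
    fix z
    show "(LINT x|lborel. K' z * w (x - z) * cnj (w x)) = K' z * autocorrelation w (- z)"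
      unfolding autocorrelation_def
      by (subst integral_mult_right_zero[symmetric]) (simp add: mult_ac)
  qed
  also have "\<dots> = (LINT z|lebesgue. K' z * autocorrelation w (- z))"
  proof (rule integral_completion[symmetric])
    have [measurable]: "autocorrelation w \<in> borel_measurable borel"
      using autocorrelation_Cc[OF w] by (rule Cc_borel)
    show "(\<lambda>z. K' z * autocorrelation w (- z)) \<in> borel_measurable lborel" by measurable
  qed
  also have "\<dots> = (LINT z|lebesgue. K z * autocorrelation w (- z))"
  proof (rule integral_cong_AE)
    have [measurable]: "autocorrelation w \<in> borel_measurable borel"
      using autocorrelation_Cc[OF w] by (rule Cc_borel)
    have [measurable]: "(\<lambda>z. autocorrelation w (- z)) \<in> borel_measurable lebesgue"
      by (rule measurable_completion) measurable
    show "(\<lambda>z. K' z * autocorrelation w (- z)) \<in> borel_measurable lebesgue"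
      by (rule measurable_completion) measurable
    show "(\<lambda>z. K z * autocorrelation w (- z)) \<in> borel_measurable lebesgue" by measurable
    show "AE z in lebesgue. K' z * autocorrelation w (- z) = K z * autocorrelation w (- z)"
      using K' by (intro AE_completion) (auto elim!: eventually_mono)
  qed
  finally show ?thesis .
qed

section \<open>Scaling\<close>

lemma lebesgue_integral_scaling:
  fixes f :: "'a::euclidean_space \<Rightarrow> complex"
  assumes r: "r > 0" and [measurable]: "f \<in> borel_measurable lebesgue"
  shows "(LINT x|lebesgue. f x) = r ^ DIM('a) *\<^sub>R (LINT x|lebesgue. f (r *\<^sub>R x))"
proof -
  have T: "0 + (\<Sum>j\<in>Basis. (r * (x \<bullet> j)) *\<^sub>R j) = r *\<^sub>R x" for x :: 'a
    by (simp add: scaleR_scaleR[symmetric] scaleR_sum_right[symmetric] euclidean_representation del: scaleR_scaleR)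
  have eq: "(lebesgue :: 'a measure) = density (distr lebesgue lebesgue (\<lambda>x. r *\<^sub>R x)) (\<lambda>_. ennreal (r ^ DIM('a)))"
    using lebesgue_affine_euclidean[of "\<lambda>_::'a. r" 0] r unfolding T by simp
  show ?thesis
    using r by (subst eq) (simp add: integral_density integral_distr)
qed

lemma autocorrelation_scaled:
  fixes w :: "'a::euclidean_space \<Rightarrow> complex"
  assumes r: "r > 0" and w: "w \<in> Cc"
  shows "autocorrelation w (r *\<^sub>R u) = r ^ DIM('a) *\<^sub>R autocorrelation (\<lambda>x. w (r *\<^sub>R x)) u"
proof -
  have [measurable]: "w \<in> borel_measurable borel" using w by (rule Cc_borel)
  show ?thesis unfolding autocorrelation_def
    using r by (subst lborel_integral_affine[of r _ 0]) (auto simp: scaleR_add_right)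
qed

lemma fourier_scaled:
  fixes w :: "'a::euclidean_space \<Rightarrow> complex"
  assumes r: "r > 0" and w: "w \<in> Cc"
  shows "fourier w (\<xi> /\<^sub>R r) = r ^ DIM('a) *\<^sub>R fourier (\<lambda>x. w (r *\<^sub>R x)) \<xi>"
proof -
  have [measurable]: "w \<in> borel_measurable borel" using w by (rule Cc_borel)
  have "exp (- \<i> * of_real ((0 + r *\<^sub>R x) \<bullet> (\<xi> /\<^sub>R r))) = exp (- \<i> * complex_of_real (x \<bullet> \<xi>))" for x
  proof -
    have "(0 + r *\<^sub>R x) \<bullet> (\<xi> /\<^sub>R r) = x \<bullet> \<xi>" using r by simp
    then show ?thesis by (simp only:)
  qed
  then show ?thesis
    using r by (subst (1 2) fourier_lborel) (measurable, subst lborel_integral_affine[of r _ 0], auto)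
qed

text \<open>
  Of the exponent \<open>\<alpha> + d\<close>, the change of variables and the homogeneity of \<open>K\<close> give \<open>d\<close> and
  \<open>\<alpha> - d\<close>; the remaining \<open>d\<close> comes from the autocorrelation.
\<close>

lemma quadratic_form_scaled:
  fixes K w :: "'a::euclidean_space \<Rightarrow> complex"
  assumes r: "r > 0" and w: "w \<in> Cc" and Km [measurable]: "K \<in> borel_measurable lebesgue"
    and hom: "homogeneous_of_order (\<alpha> - real DIM('a)) K"
  shows "(LINT z|lebesgue. K z * autocorrelation w (- z)) =
     of_real (r powr (\<alpha> + real DIM('a))) * (LINT z|lebesgue. K z * autocorrelation (\<lambda>x. w (r *\<^sub>R x)) (- z))"
proof -
  let ?v = "\<lambda>x. w (r *\<^sub>R x)"
  have v: "?v \<in> Cc" using Cc_affine[OF w, of r 0] r by simp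
  have [measurable]: "autocorrelation w \<in> borel_measurable borel" "autocorrelation ?v \<in> borel_measurable borel"
    using Cc_borel[OF autocorrelation_Cc[OF w]] Cc_borel[OF autocorrelation_Cc[OF v]] by auto
  have [measurable]: "(\<lambda>z. autocorrelation w (- z)) \<in> borel_measurable lebesgue"
    by (rule measurable_completion) measurable
  have [measurable]: "(\<lambda>z. autocorrelation ?v (- z)) \<in> borel_measurable lebesgue"
    by (rule measurable_completion) measurable
  have "(LINT z|lebesgue. K z * autocorrelation w (- z)) =
     r ^ DIM('a) *\<^sub>R (LINT z|lebesgue. K (r *\<^sub>R z) * autocorrelation w (- (r *\<^sub>R z)))"
    by (rule lebesgue_integral_scaling[OF r]) measurable
  also have "(LINT z|lebesgue. K (r *\<^sub>R z) * autocorrelation w (- (r *\<^sub>R z))) =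
     (LINT z|lebesgue. of_real (r powr \<alpha>) * (K z * autocorrelation ?v (- z)))"
  proof (rule integral_cong_AE)
    have "AE z in lborel. z \<noteq> (0::'a)"
      by (rule AE_lborel_singleton)
    then have "AE z in lebesgue. z \<noteq> (0::'a)" by (rule AE_completion)
    then show "AE z in lebesgue. K (r *\<^sub>R z) * autocorrelation w (- (r *\<^sub>R z)) =
       of_real (r powr \<alpha>) * (K z * autocorrelation ?v (- z))"
    proof eventually_elim
      fix z :: 'a assume "z \<noteq> 0"
      then have "K (r *\<^sub>R z) = of_real (r powr (\<alpha> - real DIM('a))) * K z"
        using hom r by (simp add: homogeneous_of_order_def)
      moreover have "autocorrelation w (- (r *\<^sub>R z)) = r ^ DIM('a) *\<^sub>R autocorrelation ?v (- z)"
        using autocorrelation_scaled[OF r w, of "- z"] by simp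
      moreover have "r powr (\<alpha> - real DIM('a)) * r ^ DIM('a) = r powr \<alpha>"
        using r by (simp add: powr_realpow[symmetric] powr_add[symmetric])
      ultimately show "K (r *\<^sub>R z) * autocorrelation w (- (r *\<^sub>R z)) =
         of_real (r powr \<alpha>) * (K z * autocorrelation ?v (- z))"
        by (simp add: scaleR_conv_of_real mult_ac flip: of_real_mult of_real_power)
    qed
    have "(\<lambda>z::'a. K (r *\<^sub>R z)) \<in> borel_measurable lebesgue" by measurable
    moreover have "(\<lambda>z::'a. autocorrelation w (- (r *\<^sub>R z))) \<in> borel_measurable lebesgue"
      by (rule measurable_completion) measurable
    ultimately show "(\<lambda>z. K (r *\<^sub>R z) * autocorrelation w (- (r *\<^sub>R z))) \<in> borel_measurable lebesgue"
      by (rule borel_measurable_times)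
    show "(\<lambda>z. of_real (r powr \<alpha>) * (K z * autocorrelation ?v (- z))) \<in> borel_measurable lebesgue"
      by measurable
  qed
  also have "\<dots> = of_real (r powr \<alpha>) * (LINT z|lebesgue. K z * autocorrelation ?v (- z))"
    by simp
  finally show ?thesis
    using r by (simp add: scaleR_conv_of_real powr_add powr_realpow mult_ac)
qed

text \<open>
  The inequality at level 1 applied to \<open>x \<mapsto> w i (r x)\<close> with \<open>r\<^sup>\<alpha> = s\<close>. Against the factor
  \<open>r\<^bsup>\<alpha> + d\<^esup>\<close> of the quadratic form, the squared norms lose \<open>r\<^sup>d\<close>, which leaves \<open>s\<close>, and the squared
  transforms lose \<open>r\<^bsup>2d\<^esup>\<close>, which leaves \<open>r\<^bsup>\<alpha> - d\<^esup> = s\<^bsup>1 - d/\<alpha>\<^esup>\<close>.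
\<close>

lemma trace_inequality_scaled:
  fixes K Khat :: "'a::euclidean_space \<Rightarrow> complex" and w :: "'i \<Rightarrow> 'a \<Rightarrow> complex"
  assumes ft: "has_fourier_transform K Khat" and I: "finite I"
    and w: "\<And>i. i \<in> I \<Longrightarrow> w i \<in> Cc" and \<sigma>: "\<And>i. i \<in> I \<Longrightarrow> \<bar>\<sigma> i\<bar> \<le> 1"
    and B: "\<And>\<xi>. (\<Sum>i\<in>I. (norm (fourier (w i) \<xi>))\<^sup>2) \<le> B"
    and J: "integrable lebesgue (\<lambda>\<xi>. max (norm (Khat \<xi>) - 1) 0)"
    and hom: "homogeneous_of_order (\<alpha> - real DIM('a)) K" and \<alpha>: "\<alpha> > 0" and s: "s > 0"
  shows "(\<Sum>i\<in>I. \<sigma> i * Re (LINT z|lebesgue. K z * autocorrelation (w i) (- z)))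
     \<le> (2 * pi) powr (- real DIM('a)) * B * s powr (1 - real DIM('a) / \<alpha>) *
         (LINT \<xi>|lebesgue. max (norm (Khat \<xi>) - 1) 0)
        + s * (\<Sum>i\<in>I. LINT x|lborel. (norm (w i x))\<^sup>2)"
proof -
  define r where "r = s powr (1 / \<alpha>)"
  have r: "r > 0" using s by (simp add: r_def)
  let ?d = "DIM('a)" and ?J = "LINT \<xi>|lebesgue. max (norm (Khat \<xi>) - 1) 0"
  define v where "v i x = w i (r *\<^sub>R x)" for i x
  have v: "v i \<in> Cc" if "i \<in> I" for i
    using Cc_affine[OF w[OF that], of r 0] r by (simp add: v_def[abs_def])
  have Km: "K \<in> borel_measurable lebesgue"
    using ft by (auto simp: has_fourier_transform_def intro: tempered_function_measurable)
  have fourier_v: "(norm (fourier (v i) \<xi>))\<^sup>2 = (norm (fourier (w i) (\<xi> /\<^sub>R r)))\<^sup>2 / (r ^ ?d)\<^sup>2" if "i \<in> I" for i \<xi>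
    using fourier_scaled[OF r w[OF that], of \<xi>] r by (simp add: v_def[abs_def] power_mult_distrib)
  have "(\<Sum>i\<in>I. (norm (fourier (v i) \<xi>))\<^sup>2) \<le> B / (r ^ ?d)\<^sup>2" for \<xi>
    using B[of "\<xi> /\<^sub>R r"] by (simp add: fourier_v sum_divide_distrib[symmetric] divide_right_mono cong: sum.cong)
  note key = trace_inequality_test_functions[OF ft I v \<sigma> this J]
  have norm_v: "(LINT x|lborel. (norm (v i x))\<^sup>2) = (LINT x|lborel. (norm (w i x))\<^sup>2) / r ^ ?d" if "i \<in> I" for i
  proof -
    have [measurable]: "w i \<in> borel_measurable borel" using w[OF that] by (rule Cc_borel)
    have "(LINT x|lborel. (norm (w i x))\<^sup>2) = r ^ ?d *\<^sub>R (LINT x|lborel. (norm (w i (0 + r *\<^sub>R x)))\<^sup>2)"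
      using r by (subst lborel_integral_affine[of r _ 0]) auto
    then show ?thesis using r by (simp add: v_def)
  qed
  have "(\<Sum>i\<in>I. \<sigma> i * Re (LINT z|lebesgue. K z * autocorrelation (w i) (- z))) =
     r powr (\<alpha> + ?d) * (\<Sum>i\<in>I. \<sigma> i * Re (LINT z|lebesgue. K z * autocorrelation (v i) (- z)))"
    unfolding sum_distrib_left
    by (rule sum.cong[OF refl]) (simp add: quadratic_form_scaled[OF r w Km hom] v_def[abs_def])
  also have "\<dots> \<le> r powr (\<alpha> + ?d) * ((2 * pi) powr (- real ?d) * (B / (r ^ ?d)\<^sup>2) * ?J
        + (\<Sum>i\<in>I. LINT x|lborel. (norm (v i x))\<^sup>2))"
    by (intro mult_left_mono key) auto
  also have "(\<Sum>i\<in>I. LINT x|lborel. (norm (v i x))\<^sup>2) = (\<Sum>i\<in>I. LINT x|lborel. (norm (w i x))\<^sup>2) / r ^ ?d"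
    by (simp add: norm_v sum_divide_distrib)
  also have "r powr (\<alpha> + ?d) * ((2 * pi) powr (- real ?d) * (B / (r ^ ?d)\<^sup>2) * ?J
        + (\<Sum>i\<in>I. LINT x|lborel. (norm (w i x))\<^sup>2) / r ^ ?d) =
     (2 * pi) powr (- real ?d) * B * (r powr (\<alpha> + ?d) / (r ^ ?d)\<^sup>2) * ?J
     + (r powr (\<alpha> + ?d) / r ^ ?d) * (\<Sum>i\<in>I. LINT x|lborel. (norm (w i x))\<^sup>2)"
    by (simp add: algebra_simps)
  also have "r powr (\<alpha> + ?d) / r ^ ?d = s"
  proof -
    have "r powr (\<alpha> + ?d) / r ^ ?d = r powr \<alpha>"
      using r by (simp add: powr_add powr_realpow)
    also have "\<dots> = s" using s \<alpha> by (simp add: r_def powr_powr)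
    finally show ?thesis .
  qed
  also have "r powr (\<alpha> + ?d) / (r ^ ?d)\<^sup>2 = s powr (1 - ?d / \<alpha>)"
  proof -
    have "r powr (\<alpha> + ?d) / (r ^ ?d)\<^sup>2 = r powr (\<alpha> - ?d)"
      using r by (simp add: powr_add powr_diff powr_realpow power2_eq_square)
    also have "\<dots> = s powr (1 - ?d / \<alpha>)"
      using \<alpha> by (simp add: r_def powr_powr diff_divide_distrib)
    finally show ?thesis .
  qed
  finally show ?thesis .
qed

section \<open>The Hilbert space \<open>L\<^sup>2(\<Omega>)\<close>\<close>

lemma norm_mult_le_half_squares: "norm (a * cnj b) \<le> ((norm a)\<^sup>2 + (norm b)\<^sup>2) / 2" for a b :: complex
  using zero_le_power2[of "norm a - norm b"] by (simp add: norm_mult power2_eq_square algebra_simps)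

lemma norm_add_sq_le: "(norm (a + b))\<^sup>2 \<le> 2 * (norm a)\<^sup>2 + 2 * (norm b)\<^sup>2" for a b :: complex
proof -
  have "(norm (a + b))\<^sup>2 \<le> (norm a + norm b)\<^sup>2"
    by (intro power_mono norm_triangle_ineq) auto
  also have "\<dots> \<le> 2 * (norm a)\<^sup>2 + 2 * (norm b)\<^sup>2"
    using zero_le_power2[of "norm a - norm b"] by (simp add: power2_eq_square algebra_simps)
  finally show ?thesis .
qed

lemma L2_measurable [measurable_dest]: "u \<in> L2 \<Omega> \<Longrightarrow> u \<in> borel_measurable (lebesgue_on \<Omega>)"
  by (simp add: L2_def)

lemma L2_integrable: "u \<in> L2 \<Omega> \<Longrightarrow> integrable (lebesgue_on \<Omega>) (\<lambda>x. (norm (u x))\<^sup>2)"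
  by (simp add: L2_def)

lemma L2_integrable_inner:
  assumes u: "u \<in> L2 \<Omega>" and v: "v \<in> L2 \<Omega>"
  shows "integrable (lebesgue_on \<Omega>) (\<lambda>x. u x * cnj (v x))"
proof (rule Bochner_Integration.integrable_bound)
  note [measurable] = L2_measurable[OF u] L2_measurable[OF v]
  show "integrable (lebesgue_on \<Omega>) (\<lambda>x. ((norm (u x))\<^sup>2 + (norm (v x))\<^sup>2) / 2)"
    using L2_integrable[OF u] L2_integrable[OF v] by simp
  show "AE x in lebesgue_on \<Omega>. norm (u x * cnj (v x)) \<le> norm (((norm (u x))\<^sup>2 + (norm (v x))\<^sup>2) / 2)"
    using norm_mult_le_half_squares by (intro AE_I2) (auto intro: order_trans)
  show "(\<lambda>x. u x * cnj (v x)) \<in> borel_measurable (lebesgue_on \<Omega>)" by measurable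
qed

lemma L2_add:
  assumes u: "u \<in> L2 \<Omega>" and v: "v \<in> L2 \<Omega>" shows "(\<lambda>x. u x + v x) \<in> L2 \<Omega>"
proof -
  note [measurable] = L2_measurable[OF u] L2_measurable[OF v]
  have "integrable (lebesgue_on \<Omega>) (\<lambda>x. (norm (u x + v x))\<^sup>2)"
  proof (rule Bochner_Integration.integrable_bound)
    show "integrable (lebesgue_on \<Omega>) (\<lambda>x. 2 * (norm (u x))\<^sup>2 + 2 * (norm (v x))\<^sup>2)"
      using L2_integrable[OF u] L2_integrable[OF v] by simp
    show "AE x in lebesgue_on \<Omega>. norm ((norm (u x + v x))\<^sup>2) \<le> norm (2 * (norm (u x))\<^sup>2 + 2 * (norm (v x))\<^sup>2)"
      using norm_add_sq_le by (intro AE_I2) auto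
  qed measurable
  then show ?thesis by (simp add: L2_def)
qed

lemma L2_cmult:
  assumes u: "u \<in> L2 \<Omega>" shows "(\<lambda>x. c * u x) \<in> L2 \<Omega>"
  using L2_measurable[OF u] L2_integrable[OF u] by (simp add: L2_def norm_mult power_mult_distrib)

lemma L2_zero: "(\<lambda>x. 0) \<in> L2 \<Omega>"
  by (simp add: L2_def)

lemma L2_diff: "u \<in> L2 \<Omega> \<Longrightarrow> v \<in> L2 \<Omega> \<Longrightarrow> (\<lambda>x. u x - v x) \<in> L2 \<Omega>"
  using L2_add[of u \<Omega> "\<lambda>x. - 1 * v x"] L2_cmult[of v \<Omega> "- 1"] by simp

lemma L2_sum: "(\<And>i. i \<in> I \<Longrightarrow> u i \<in> L2 \<Omega>) \<Longrightarrow> (\<lambda>x. \<Sum>i\<in>I. u i x) \<in> L2 \<Omega>"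
  by (induction I rule: infinite_finite_induct) (auto intro: L2_add L2_zero)

lemma L2_inner_add_left:
  "u \<in> L2 \<Omega> \<Longrightarrow> v \<in> L2 \<Omega> \<Longrightarrow> w \<in> L2 \<Omega> \<Longrightarrow>
     L2_inner \<Omega> (\<lambda>x. u x + v x) w = L2_inner \<Omega> u w + L2_inner \<Omega> v w"
  unfolding L2_inner_def distrib_right
  by (intro Bochner_Integration.integral_add L2_integrable_inner)

lemma L2_inner_diff_left:
  "u \<in> L2 \<Omega> \<Longrightarrow> v \<in> L2 \<Omega> \<Longrightarrow> w \<in> L2 \<Omega> \<Longrightarrow>
     L2_inner \<Omega> (\<lambda>x. u x - v x) w = L2_inner \<Omega> u w - L2_inner \<Omega> v w"
  unfolding L2_inner_def left_diff_distrib
  by (intro Bochner_Integration.integral_diff L2_integrable_inner)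

lemma L2_inner_cmult_left: "L2_inner \<Omega> (\<lambda>x. c * u x) v = c * L2_inner \<Omega> u v"
  by (simp add: L2_inner_def mult.assoc)

lemma L2_inner_cnj: "L2_inner \<Omega> u v = cnj (L2_inner \<Omega> v u)"
  unfolding L2_inner_def Bochner_Integration.integral_cnj[symmetric] by (simp add: mult.commute)

lemma L2_inner_diff_right:
  "u \<in> L2 \<Omega> \<Longrightarrow> v \<in> L2 \<Omega> \<Longrightarrow> w \<in> L2 \<Omega> \<Longrightarrow>
     L2_inner \<Omega> u (\<lambda>x. v x - w x) = L2_inner \<Omega> u v - L2_inner \<Omega> u w"
  by (subst (1 2 3) L2_inner_cnj) (simp add: L2_inner_diff_left)

lemma L2_inner_cmult_right: "L2_inner \<Omega> u (\<lambda>x. c * v x) = cnj c * L2_inner \<Omega> u v"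
  by (subst (1 2) L2_inner_cnj) (simp add: L2_inner_cmult_left)

lemma L2_inner_sum_left:
  assumes "\<And>i. i \<in> I \<Longrightarrow> u i \<in> L2 \<Omega>" "w \<in> L2 \<Omega>"
  shows "L2_inner \<Omega> (\<lambda>x. \<Sum>i\<in>I. u i x) w = (\<Sum>i\<in>I. L2_inner \<Omega> (u i) w)"
  unfolding L2_inner_def sum_distrib_right
  by (intro Bochner_Integration.integral_sum L2_integrable_inner assms)

lemma L2_inner_cong_AE:
  assumes "u \<in> L2 \<Omega>" "u' \<in> L2 \<Omega>" "v \<in> L2 \<Omega>" "AE x in lebesgue_on \<Omega>. u x = u' x"
  shows "L2_inner \<Omega> u v = L2_inner \<Omega> u' v"
  unfolding L2_inner_def
proof (rule integral_cong_AE)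
  note [measurable] = L2_measurable[OF assms(1)] L2_measurable[OF assms(2)] L2_measurable[OF assms(3)]
  show "(\<lambda>x. u x * cnj (v x)) \<in> borel_measurable (lebesgue_on \<Omega>)"
    "(\<lambda>x. u' x * cnj (v x)) \<in> borel_measurable (lebesgue_on \<Omega>)" by measurable
  show "AE x in lebesgue_on \<Omega>. u x * cnj (v x) = u' x * cnj (v x)"
    using assms(4) by eventually_elim simp
qed

lemma L2_norm_nonneg: "L2_norm \<Omega> u \<ge> 0"
  by (simp add: L2_norm_def integral_nonneg_AE)

lemma L2_norm_sq: "(L2_norm \<Omega> u)\<^sup>2 = (LINT x|lebesgue_on \<Omega>. (norm (u x))\<^sup>2)"
  by (simp add: L2_norm_def integral_nonneg_AE)

lemma L2_inner_self: "L2_inner \<Omega> u u = of_real ((L2_norm \<Omega> u)\<^sup>2)"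
  unfolding L2_norm_sq L2_inner_def complex_norm_square[symmetric]
  by (simp only: integral_complex_of_real)

lemma L2_norm_eq_0_iff:
  assumes "u \<in> L2 \<Omega>"
  shows "L2_norm \<Omega> u = 0 \<longleftrightarrow> (AE x in lebesgue_on \<Omega>. u x = 0)"
  using integral_nonneg_eq_0_iff_AE[OF L2_integrable[OF assms]] by (simp add: L2_norm_def)

text \<open>
  The squared norm of the component of \<open>u\<close> orthogonal to \<open>v\<close> is nonnegative.
\<close>

lemma L2_Cauchy_Schwarz:
  assumes u: "u \<in> L2 \<Omega>" and v: "v \<in> L2 \<Omega>"
  shows "norm (L2_inner \<Omega> u v) \<le> L2_norm \<Omega> u * L2_norm \<Omega> v"
proof (cases "L2_norm \<Omega> v = 0")
  case True
  then have "AE x in lebesgue_on \<Omega>. v x = 0"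
    using L2_norm_eq_0_iff[OF v] by simp
  then have "L2_inner \<Omega> v u = L2_inner \<Omega> (\<lambda>x. 0) u"
    by (intro L2_inner_cong_AE u v L2_zero)
  then have "L2_inner \<Omega> v u = 0" by (simp add: L2_inner_def)
  then show ?thesis using L2_inner_cnj[of \<Omega> u v] True by simp
next
  case False
  let ?n = "L2_norm \<Omega> v"
  define c where "c = L2_inner \<Omega> u v / of_real (?n\<^sup>2)"
  have cv: "(\<lambda>x. c * v x) \<in> L2 \<Omega>" using v by (rule L2_cmult)
  have d: "(\<lambda>x. u x - c * v x) \<in> L2 \<Omega>" by (intro L2_diff u cv)
  have c1: "c * of_real (?n\<^sup>2) = L2_inner \<Omega> u v" using False by (simp add: c_def)
  have orth: "L2_inner \<Omega> (\<lambda>x. u x - c * v x) v = 0"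
    using c1 by (simp add: L2_inner_diff_left u v cv L2_inner_cmult_left L2_inner_self)
  have "L2_inner \<Omega> (\<lambda>x. u x - c * v x) (\<lambda>x. u x - c * v x) = L2_inner \<Omega> (\<lambda>x. u x - c * v x) u"
    by (simp add: L2_inner_diff_right d u cv L2_inner_cmult_right orth)
  also have "\<dots> = of_real ((L2_norm \<Omega> u)\<^sup>2) - c * cnj (L2_inner \<Omega> u v)"
    using L2_inner_cnj[of \<Omega> v u] by (simp add: L2_inner_diff_left u cv L2_inner_cmult_left L2_inner_self)
  also have "c * cnj (L2_inner \<Omega> u v) = of_real ((norm (L2_inner \<Omega> u v))\<^sup>2 / ?n\<^sup>2)"
    by (simp add: c_def complex_norm_square[symmetric])
  finally have "complex_of_real ((L2_norm \<Omega> (\<lambda>x. u x - c * v x))\<^sup>2) =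
      complex_of_real ((L2_norm \<Omega> u)\<^sup>2 - (norm (L2_inner \<Omega> u v))\<^sup>2 / ?n\<^sup>2)"
    unfolding L2_inner_self by simp
  then have "(L2_norm \<Omega> (\<lambda>x. u x - c * v x))\<^sup>2 = (L2_norm \<Omega> u)\<^sup>2 - (norm (L2_inner \<Omega> u v))\<^sup>2 / ?n\<^sup>2"
    unfolding of_real_eq_iff .
  then have "(norm (L2_inner \<Omega> u v))\<^sup>2 / ?n\<^sup>2 \<le> (L2_norm \<Omega> u)\<^sup>2"
    using zero_le_power2[of "L2_norm \<Omega> (\<lambda>x. u x - c * v x)"] by linarith
  then have "(norm (L2_inner \<Omega> u v))\<^sup>2 \<le> (L2_norm \<Omega> u * ?n)\<^sup>2"
    using False by (simp add: divide_le_eq power_mult_distrib)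
  then show ?thesis
    by (rule power2_le_imp_le) (simp add: L2_norm_nonneg)
qed

lemma L2_norm_triangle:
  assumes u: "u \<in> L2 \<Omega>" and v: "v \<in> L2 \<Omega>"
  shows "L2_norm \<Omega> (\<lambda>x. u x + v x) \<le> L2_norm \<Omega> u + L2_norm \<Omega> v"
proof (rule power2_le_imp_le)
  let ?s = "\<lambda>x. u x + v x"
  have s: "?s \<in> L2 \<Omega>" by (intro L2_add u v)
  have "complex_of_real ((L2_norm \<Omega> ?s)\<^sup>2) = L2_inner \<Omega> u ?s + L2_inner \<Omega> v ?s"
    unfolding L2_inner_self[symmetric] by (simp add: L2_inner_add_left u v s)
  then have "(L2_norm \<Omega> ?s)\<^sup>2 = Re (L2_inner \<Omega> u ?s + L2_inner \<Omega> v ?s)"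
    by (metis Re_complex_of_real)
  also have "L2_inner \<Omega> u ?s + L2_inner \<Omega> v ?s =
      cnj (L2_inner \<Omega> u u + L2_inner \<Omega> v u) + cnj (L2_inner \<Omega> u v + L2_inner \<Omega> v v)"
    using L2_inner_cnj[of \<Omega> u ?s] L2_inner_cnj[of \<Omega> v ?s] by (simp add: L2_inner_add_left u v)
  also have "Re \<dots> = (L2_norm \<Omega> u)\<^sup>2 + 2 * Re (L2_inner \<Omega> u v) + (L2_norm \<Omega> v)\<^sup>2"
    using L2_inner_cnj[of \<Omega> v u] by (simp add: L2_inner_self)
  also have "\<dots> \<le> (L2_norm \<Omega> u)\<^sup>2 + 2 * (L2_norm \<Omega> u * L2_norm \<Omega> v) + (L2_norm \<Omega> v)\<^sup>2"
    using L2_Cauchy_Schwarz[OF u v] complex_Re_le_cmod[of "L2_inner \<Omega> u v"] by simp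
  finally show "(L2_norm \<Omega> ?s)\<^sup>2 \<le> (L2_norm \<Omega> u + L2_norm \<Omega> v)\<^sup>2"
    by (simp add: power2_sum)
qed (simp add: L2_norm_nonneg)

definition orthonormal_on :: "'a::euclidean_space set \<Rightarrow> 'i set \<Rightarrow> ('i \<Rightarrow> 'a \<Rightarrow> complex) \<Rightarrow> bool" where
  "orthonormal_on \<Omega> I u \<longleftrightarrow> (\<forall>i\<in>I. u i \<in> L2 \<Omega>) \<and>
     (\<forall>i\<in>I. \<forall>j\<in>I. L2_inner \<Omega> (u i) (u j) = (if i = j then 1 else 0))"

text \<open>
  The difference of the two sides is the squared distance from \<open>f\<close> to its projection \<open>p\<close>.
\<close>

lemma Bessel_inequality:
  assumes on: "orthonormal_on \<Omega> I u" and I: "finite I" and f: "f \<in> L2 \<Omega>"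
  shows "(\<Sum>i\<in>I. (norm (L2_inner \<Omega> f (u i)))\<^sup>2) \<le> (L2_norm \<Omega> f)\<^sup>2"
proof -
  define c where "c i = L2_inner \<Omega> f (u i)" for i
  define p where "p x = (\<Sum>i\<in>I. c i * u i x)" for x
  have u: "u i \<in> L2 \<Omega>" if "i \<in> I" for i using on that by (simp add: orthonormal_on_def)
  have cu: "(\<lambda>x. c i * u i x) \<in> L2 \<Omega>" if "i \<in> I" for i using u[OF that] by (rule L2_cmult)
  have p: "p \<in> L2 \<Omega>" unfolding p_def[abs_def] by (intro L2_sum cu)
  have d: "(\<lambda>x. f x - p x) \<in> L2 \<Omega>" by (intro L2_diff f p)
  have pin: "L2_inner \<Omega> p v = (\<Sum>i\<in>I. c i * L2_inner \<Omega> (u i) v)" if "v \<in> L2 \<Omega>" for v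
    unfolding p_def[abs_def] using cu that by (simp add: L2_inner_sum_left L2_inner_cmult_left)
  have orth: "L2_inner \<Omega> (\<lambda>x. f x - p x) (u j) = 0" if "j \<in> I" for j
  proof -
    have "L2_inner \<Omega> p (u j) = (\<Sum>i\<in>I. if i = j then c i else 0)"
      unfolding pin[OF u[OF that]] using on that by (intro sum.cong) (auto simp: orthonormal_on_def)
    then show ?thesis using I that f p u by (simp add: L2_inner_diff_left c_def)
  qed
  have "L2_inner \<Omega> p (\<lambda>x. f x - p x) = 0"
    unfolding pin[OF d] using orth L2_inner_cnj[of \<Omega> "u _" "\<lambda>x. f x - p x"] by (simp add: sum.neutral)
  then have "L2_inner \<Omega> (\<lambda>x. f x - p x) (\<lambda>x. f x - p x) = L2_inner \<Omega> f (\<lambda>x. f x - p x)"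
    by (simp add: L2_inner_diff_left f p d)
  also have "\<dots> = of_real ((L2_norm \<Omega> f)\<^sup>2) - cnj (L2_inner \<Omega> p f)"
    using L2_inner_cnj[of \<Omega> f p] by (simp add: L2_inner_diff_right f p L2_inner_self)
  also have "L2_inner \<Omega> p f = (\<Sum>i\<in>I. of_real ((norm (c i))\<^sup>2))"
    unfolding pin[OF f]
  proof (intro sum.cong refl)
    fix i
    show "c i * L2_inner \<Omega> (u i) f = of_real ((norm (c i))\<^sup>2)"
      unfolding complex_norm_square using L2_inner_cnj[of \<Omega> "u i" f] by (simp add: c_def)
  qed
  finally have "complex_of_real ((L2_norm \<Omega> (\<lambda>x. f x - p x))\<^sup>2) =
      complex_of_real ((L2_norm \<Omega> f)\<^sup>2 - (\<Sum>i\<in>I. (norm (c i))\<^sup>2))"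
    unfolding L2_inner_self by simp
  then have "(L2_norm \<Omega> (\<lambda>x. f x - p x))\<^sup>2 = (L2_norm \<Omega> f)\<^sup>2 - (\<Sum>i\<in>I. (norm (c i))\<^sup>2)"
    unfolding of_real_eq_iff .
  then show ?thesis
    using zero_le_power2[of "L2_norm \<Omega> (\<lambda>x. f x - p x)"] unfolding c_def by linarith
qed

text \<open>
  Linear independence is the only source of nonzero norms, so the induction records the new vectors
  as explicit linear combinations of the given ones: the next residual has coefficient 1 at \<open>f n\<close> and
  therefore cannot vanish almost everywhere.
\<close>

lemma Gram_Schmidt_L2:
  assumes f: "\<And>i. i < n \<Longrightarrow> f i \<in> L2 \<Omega>" and ind: "ae_independent (lebesgue_on \<Omega>) n f"
  shows "\<exists>e a. orthonormal_on \<Omega> {..<n} e \<and> (\<forall>j<n. e j = (\<lambda>x. \<Sum>i<n. a j i * f i x))"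
  using assms
proof (induction n)
  case 0
  then show ?case by (simp add: orthonormal_on_def)
next
  case (Suc n)
  have "ae_independent (lebesgue_on \<Omega>) n f"
    unfolding ae_independent_def
  proof (intro allI impI)
    fix c :: "nat \<Rightarrow> complex" and i
    assume 0: "AE x in lebesgue_on \<Omega>. (\<Sum>i<n. c i * f i x) = 0" and i: "i < n"
    have "(\<Sum>i<Suc n. (c(n := 0)) i * f i x) = (\<Sum>i<n. c i * f i x)" for x
      by simp
    then have "\<forall>i<Suc n. (c(n := 0)) i = 0"
      using Suc.prems(2)[unfolded ae_independent_def, rule_format, of "c(n := 0)"] 0 by simp
    then show "c i = 0" using i by (metis fun_upd_apply less_SucI nat_neq_iff)
  qed
  then obtain e a where on: "orthonormal_on \<Omega> {..<n} e"
      and e: "\<And>j. j < n \<Longrightarrow> e j = (\<lambda>x. \<Sum>i<n. a j i * f i x)"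
    using Suc.IH Suc.prems(1) by (metis less_SucI)
  have fn: "f n \<in> L2 \<Omega>" using Suc.prems(1) by simp
  have eL2: "e j \<in> L2 \<Omega>" if "j < n" for j using on that by (simp add: orthonormal_on_def)
  define c where "c j = L2_inner \<Omega> (f n) (e j)" for j
  define g where "g x = f n x - (\<Sum>j<n. c j * e j x)" for x
  have ce: "(\<lambda>x. c j * e j x) \<in> L2 \<Omega>" if "j < n" for j using eL2[OF that] by (rule L2_cmult)
  have sumL2: "(\<lambda>x. \<Sum>j<n. c j * e j x) \<in> L2 \<Omega>" using ce by (intro L2_sum) auto
  have g: "g \<in> L2 \<Omega>" unfolding g_def[abs_def] by (intro L2_diff fn sumL2)
  have g_orth: "L2_inner \<Omega> g (e k) = 0" if k: "k < n" for k
  proof -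
    have "L2_inner \<Omega> (\<lambda>x. \<Sum>j<n. c j * e j x) (e k) = (\<Sum>j<n. c j * L2_inner \<Omega> (e j) (e k))"
      by (subst L2_inner_sum_left) (use ce eL2[OF k] in \<open>auto simp: L2_inner_cmult_left\<close>)
    also have "\<dots> = (\<Sum>j<n. if j = k then c j else 0)"
      using on k by (intro sum.cong) (auto simp: orthonormal_on_def)
    also have "\<dots> = c k" using k by simp
    finally show ?thesis
      unfolding g_def[abs_def] using fn sumL2 eL2[OF k] by (simp add: L2_inner_diff_left c_def)
  qed
  \<comment> \<open>The coefficients of \<open>g\<close> in terms of the given functions.\<close>
  define b where "b i = (if i = n then 1 else - (\<Sum>j<n. c j * a j i))" for i
  have g_eq: "g x = (\<Sum>i<Suc n. b i * f i x)" for x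
  proof -
    have "(\<Sum>j<n. c j * e j x) = (\<Sum>j<n. \<Sum>i<n. c j * a j i * f i x)"
      by (intro sum.cong) (auto simp: e sum_distrib_left mult.assoc)
    also have "\<dots> = (\<Sum>i<n. (\<Sum>j<n. c j * a j i) * f i x)"
      by (subst sum.swap) (simp add: sum_distrib_right)
    finally show ?thesis by (simp add: g_def b_def sum_negf)
  qed
  have "L2_norm \<Omega> g \<noteq> 0"
  proof
    assume "L2_norm \<Omega> g = 0"
    then have "AE x in lebesgue_on \<Omega>. (\<Sum>i<Suc n. b i * f i x) = 0"
      using L2_norm_eq_0_iff[OF g] by (simp only: g_eq)
    then have "b n = 0" using Suc.prems(2) unfolding ae_independent_def by blast
    then show False by (simp add: b_def)
  qed
  define t where "t = complex_of_real (1 / L2_norm \<Omega> g)"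
  define e' where "e' = e(n := (\<lambda>x. t * g x))"
  have e'n: "L2_inner \<Omega> (e' n) (e' n) = 1"
  proof -
    have "L2_inner \<Omega> (e' n) (e' n) = t * (cnj t * of_real ((L2_norm \<Omega> g)\<^sup>2))"
      unfolding e'_def fun_upd_same L2_inner_cmult_left L2_inner_cmult_right L2_inner_self ..
    then show ?thesis
      using \<open>L2_norm \<Omega> g \<noteq> 0\<close> by (simp add: t_def power2_eq_square)
  qed
  have e'k: "L2_inner \<Omega> (e' n) (e' k) = 0" "L2_inner \<Omega> (e' k) (e' n) = 0" if "k < n" for k
    using g_orth[OF that] L2_inner_cnj[of \<Omega> "e k" g] that
    by (simp_all add: e'_def L2_inner_cmult_left L2_inner_cmult_right)
  have e'jk: "L2_inner \<Omega> (e' j) (e' k) = (if j = k then 1 else 0)" if "j < n" "k < n" for j k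
    using on that by (simp add: e'_def orthonormal_on_def)
  have e'L2: "e' j \<in> L2 \<Omega>" if "j < Suc n" for j
    using that eL2 L2_cmult[OF g] by (auto simp: e'_def less_Suc_eq)
  have "orthonormal_on \<Omega> {..<Suc n} e'"
    unfolding orthonormal_on_def using e'L2 e'n e'k e'jk by (auto simp: less_Suc_eq)
  moreover define a' where "a' j i = (if j = n then t * b i else if i = n then 0 else a j i)" for j i
  have "e' j = (\<lambda>x. \<Sum>i<Suc n. a' j i * f i x)" if "j < Suc n" for j
  proof (cases "j = n")
    case True
    then show ?thesis
      by (simp add: fun_eq_iff e'_def a'_def g_eq sum_distrib_left distrib_left mult.assoc)
  next
    case False
    then have "j < n" using that by simp
    then show ?thesis using False
      by (simp add: fun_eq_iff e'_def a'_def e)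
  qed
  ultimately show ?case by blast
qed

section \<open>Test functions are dense in \<open>L\<^sup>2(\<Omega>)\<close>\<close>

lemma AE_lebesgue_on:
  assumes "\<Omega> \<in> sets lebesgue" "AE x in lebesgue. x \<in> \<Omega> \<longrightarrow> P x"
  shows "AE x in lebesgue_on \<Omega>. P x"
  using assms by (subst AE_restrict_space_iff) auto

lemma lebesgue_on_integral_supported:
  fixes f :: "'a::euclidean_space \<Rightarrow> 'b::{banach, second_countable_topology}"
  assumes \<Omega>: "\<Omega> \<in> sets lebesgue" and [measurable]: "f \<in> borel_measurable borel"
    and supp: "\<And>x. x \<notin> \<Omega> \<Longrightarrow> f x = 0"
  shows "(LINT x|lebesgue_on \<Omega>. f x) = (LINT x|lborel. f x)"
proof -
  have "(LINT x|lebesgue_on \<Omega>. f x) = (LINT x|lebesgue. indicator \<Omega> x *\<^sub>R f x)"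
    using \<Omega> by (intro integral_restrict_space) simp
  also have "\<dots> = (LINT x|lebesgue. f x)"
    by (rule Bochner_Integration.integral_cong[OF refl]) (use supp in \<open>auto simp: indicator_def\<close>)
  also have "\<dots> = (LINT x|lborel. f x)"
    by (rule integral_completion) measurable
  finally show ?thesis .
qed

lemma lebesgue_on_borel:
  "f \<in> borel_measurable borel \<Longrightarrow> f \<in> borel_measurable (lebesgue_on \<Omega>)"
  by (intro measurable_restrict_space1 measurable_completion) simp

lemma Cc_L2:
  assumes w: "w \<in> Cc" and \<Omega>: "\<Omega> \<in> sets lebesgue" shows "w \<in> L2 \<Omega>"
proof -
  have m: "w \<in> borel_measurable borel" using w by (rule Cc_borel)
  have "integrable lebesgue (\<lambda>x. (norm (w x))\<^sup>2)"
    using Cc_integrable_norm_sq[OF w] m by (subst integrable_completion) auto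
  from integrable_mult_indicator[OF \<Omega> this] have "integrable (lebesgue_on \<Omega>) (\<lambda>x. (norm (w x))\<^sup>2)"
    using \<Omega> by (subst integrable_restrict_space) simp_all
  then show ?thesis using lebesgue_on_borel[OF m] by (simp add: L2_def)
qed

lemma L2_norm_Cc:
  assumes w: "w \<in> Cc" and \<Omega>: "\<Omega> \<in> sets lebesgue" and supp: "\<And>x. x \<notin> \<Omega> \<Longrightarrow> w x = 0"
  shows "(L2_norm \<Omega> w)\<^sup>2 = (LINT x|lborel. (norm (w x))\<^sup>2)"
proof -
  have [measurable]: "w \<in> borel_measurable borel" using w by (rule Cc_borel)
  show ?thesis
    unfolding L2_norm_sq using supp by (intro lebesgue_on_integral_supported \<Omega>) auto
qed

definition wave :: "'a::euclidean_space \<Rightarrow> 'a \<Rightarrow> complex" where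
  "wave \<xi> x = exp (\<i> * of_real (x \<bullet> \<xi>))"

lemma norm_wave [simp]: "norm (wave \<xi> x) = 1"
  by (simp add: wave_def norm_exp_i_times)

lemma finite_lebesgue_on:
  "\<Omega> \<in> sets lebesgue \<Longrightarrow> emeasure lebesgue \<Omega> < \<infinity> \<Longrightarrow> finite_measure (lebesgue_on \<Omega>)"
  by (intro finite_measure_lebesgue_on) (simp add: fmeasurable_def)

lemma wave_L2:
  assumes \<Omega>: "\<Omega> \<in> sets lebesgue" "emeasure lebesgue \<Omega> < \<infinity>"
  shows "wave \<xi> \<in> L2 \<Omega>" and "(L2_norm \<Omega> (wave \<xi>))\<^sup>2 = measure lebesgue \<Omega>"
proof -
  interpret finite_measure "lebesgue_on \<Omega>" by (rule finite_lebesgue_on[OF \<Omega>])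
  have "wave \<xi> \<in> borel_measurable borel" unfolding wave_def[abs_def] by measurable
  then show "wave \<xi> \<in> L2 \<Omega>"
    by (simp add: L2_def lebesgue_on_borel)
  show "(L2_norm \<Omega> (wave \<xi>))\<^sup>2 = measure lebesgue \<Omega>"
    using \<Omega> by (simp add: L2_norm_sq measure_restrict_space)
qed

text \<open>
  This identity lets Bessel's inequality bound the transforms at each frequency.
\<close>

lemma fourier_eq_L2_inner:
  assumes w: "w \<in> Cc" and \<Omega>: "\<Omega> \<in> sets lebesgue" and supp: "\<And>x. x \<notin> \<Omega> \<Longrightarrow> w x = 0"
  shows "fourier w \<xi> = L2_inner \<Omega> w (wave \<xi>)"
proof -
  have [measurable]: "w \<in> borel_measurable borel" using w by (rule Cc_borel)
  have cnj_wave: "cnj (wave \<xi> x) = exp (- \<i> * of_real (x \<bullet> \<xi>))" for x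
    by (simp add: wave_def exp_cnj)
  have "L2_inner \<Omega> w (wave \<xi>) = (LINT x|lborel. w x * cnj (wave \<xi> x))"
    unfolding L2_inner_def cnj_wave using supp
    by (intro lebesgue_on_integral_supported \<Omega>) auto
  then show ?thesis unfolding cnj_wave by (simp add: fourier_lborel mult.commute)
qed

lemma L2_norm_dominated_convergence:
  assumes u: "u \<in> L2 \<Omega>" and h: "\<And>n. h n \<in> borel_measurable (lebesgue_on \<Omega>)"
    and lim: "AE x in lebesgue_on \<Omega>. (\<lambda>n. h n x) \<longlonglongrightarrow> u x"
    and G: "integrable (lebesgue_on \<Omega>) G"
    and bound: "\<And>n. AE x in lebesgue_on \<Omega>. (norm (h n x - u x))\<^sup>2 \<le> G x"
  shows "(\<lambda>n. L2_norm \<Omega> (\<lambda>x. h n x - u x)) \<longlonglongrightarrow> 0"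
proof -
  note [measurable] = L2_measurable[OF u] h
  have "(\<lambda>n. LINT x|lebesgue_on \<Omega>. (norm (h n x - u x))\<^sup>2) \<longlonglongrightarrow> (LINT x|lebesgue_on \<Omega>. 0)"
  proof (rule integral_dominated_convergence[OF _ _ G])
    show "AE x in lebesgue_on \<Omega>. (\<lambda>n. (norm (h n x - u x))\<^sup>2) \<longlonglongrightarrow> 0"
      using lim
    proof eventually_elim
      fix x assume "(\<lambda>n. h n x) \<longlonglongrightarrow> u x"
      then have "(\<lambda>n. (norm (h n x - u x))\<^sup>2) \<longlonglongrightarrow> (norm (u x - u x))\<^sup>2"
        by (intro tendsto_intros)
      then show "(\<lambda>n. (norm (h n x - u x))\<^sup>2) \<longlonglongrightarrow> 0" by simp
    qed
    show "AE x in lebesgue_on \<Omega>. norm ((norm (h n x - u x))\<^sup>2) \<le> G x" for n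
      using bound[of n] by simp
  qed measurable
  from tendsto_real_sqrt[OF this] show ?thesis by (simp add: L2_norm_def)
qed

text \<open>
  A continuous truncation, for \<open>M > 0\<close>: the identity on the ball of radius \<open>M\<close>, and the radial projection onto that
  ball outside.
\<close>

definition clip :: "real \<Rightarrow> complex \<Rightarrow> complex" where
  "clip M z = z / of_real (max 1 (norm z / M))"

lemma continuous_clip: "M > 0 \<Longrightarrow> continuous_on UNIV (clip M)"
  unfolding clip_def by (intro continuous_intros) (auto simp: max_def)

lemma norm_clip_le: assumes "M > 0" shows "norm (clip M z) \<le> M"
proof -
  have "norm z \<le> M * max 1 (norm z / M)"
    using assms by (simp add: max_mult_distrib_left)
  then show ?thesis using assms by (simp add: clip_def norm_divide divide_le_eq max_def del: of_real_divide)
qed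

lemma clip_eq: "M > 0 \<Longrightarrow> norm z \<le> M \<Longrightarrow> clip M z = z"
  by (simp add: clip_def max_def)

lemma norm_clip_diff_le: "norm (clip M z - z) \<le> norm z"
proof -
  define m where "m = max 1 (norm z / M)"
  have "m \<ge> 1" by (simp add: m_def)
  have "clip M z - z = of_real (1 / m - 1) * z"
    by (simp add: clip_def algebra_simps flip: m_def)
  moreover have "\<bar>1 / m - 1\<bar> \<le> 1" using \<open>m \<ge> 1\<close> by (simp add: abs_le_iff divide_le_eq)
  ultimately show ?thesis
    by (simp only: norm_mult norm_of_real mult_left_le_one_le norm_ge_zero abs_ge_zero)
qed

lemma clip_measurable [measurable]: "M > 0 \<Longrightarrow> clip M \<in> borel_measurable borel"
  by (intro borel_measurable_continuous_onI continuous_clip)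

lemma L2_approx_clip:
  assumes u: "u \<in> L2 \<Omega>"
  shows "(\<lambda>n. L2_norm \<Omega> (\<lambda>x. clip (real (Suc n)) (u x) - u x)) \<longlonglongrightarrow> 0"
proof (rule L2_norm_dominated_convergence[OF u _ _ L2_integrable[OF u]])
  note [measurable] = L2_measurable[OF u]
  show "(\<lambda>x. clip (real (Suc n)) (u x)) \<in> borel_measurable (lebesgue_on \<Omega>)" for n
    by (rule measurable_compose[OF L2_measurable[OF u] clip_measurable]) simp
  show "AE x in lebesgue_on \<Omega>. (\<lambda>n. clip (real (Suc n)) (u x)) \<longlonglongrightarrow> u x"
  proof (rule AE_I2)
    fix x
    obtain N :: nat where "norm (u x) \<le> real N" using real_arch_simple by blast
    then have "\<forall>n\<ge>N. clip (real (Suc n)) (u x) = u x"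
      by (auto intro!: clip_eq)
    then have "eventually (\<lambda>n. clip (real (Suc n)) (u x) = u x) sequentially"
      unfolding eventually_sequentially by blast
    then show "(\<lambda>n. clip (real (Suc n)) (u x)) \<longlonglongrightarrow> u x"
      by (rule tendsto_eventually)
  qed
  show "AE x in lebesgue_on \<Omega>. (norm (clip (real (Suc n)) (u x) - u x))\<^sup>2 \<le> (norm (u x))\<^sup>2" for n
    by (intro AE_I2 power_mono norm_clip_diff_le) simp
qed

text \<open>
  Continuous functions with values in \<open>[0, 1]\<close> and bounded support in \<open>\<Omega>\<close> that tend to 1
  everywhere on an open \<open>\<Omega>\<close> with nonempty complement. (The distance to the empty set is 0, so for
  \<open>\<Omega> = UNIV\<close> they vanish.)
\<close>

definition cutoff :: "'a::euclidean_space set \<Rightarrow> nat \<Rightarrow> 'a \<Rightarrow> real" where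
  "cutoff \<Omega> n x = min 1 (real n * infdist x (- \<Omega>)) * max 0 (min 1 (real n - norm x))"

lemma cutoff_bounds: "0 \<le> cutoff \<Omega> n x" "cutoff \<Omega> n x \<le> 1"
  unfolding cutoff_def by (auto intro!: mult_nonneg_nonneg mult_le_one simp: infdist_nonneg)

lemma continuous_cutoff: "continuous_on UNIV (cutoff \<Omega> n)"
  unfolding cutoff_def by (intro continuous_intros continuous_on_infdist)

lemma cutoff_outside: "x \<notin> \<Omega> \<Longrightarrow> cutoff \<Omega> n x = 0"
  by (simp add: cutoff_def)

lemma cutoff_far: "real n < norm x \<Longrightarrow> cutoff \<Omega> n x = 0"
  by (simp add: cutoff_def)

lemma cutoff_tendsto:
  assumes "open \<Omega>" "\<Omega> \<noteq> UNIV" "x \<in> \<Omega>"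
  shows "(\<lambda>n. cutoff \<Omega> n x) \<longlonglongrightarrow> 1"
proof -
  have d: "infdist x (- \<Omega>) > 0"
  proof -
    have "closed (- \<Omega>)" "- \<Omega> \<noteq> {}" using assms by auto
    then have "infdist x (- \<Omega>) \<noteq> 0"
      using in_closed_iff_infdist_zero[of "- \<Omega>" x] assms(3) by simp
    then show ?thesis using infdist_nonneg[of x "- \<Omega>"] by simp
  qed
  obtain N :: nat where N: "1 / infdist x (- \<Omega>) + norm x + 1 \<le> real N"
    using real_arch_simple by blast
  have "cutoff \<Omega> n x = 1" if "n \<ge> N" for n
  proof -
    have n: "1 / infdist x (- \<Omega>) + norm x + 1 \<le> real n"
      using N that by linarith
    have "1 / infdist x (- \<Omega>) \<le> real n"
      using n norm_ge_zero[of x] by linarith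
    then have "1 \<le> real n * infdist x (- \<Omega>)"
      using d by (simp add: divide_le_eq)
    moreover have "1 \<le> real n - norm x"
      using n d by (smt (verit) divide_nonneg_pos)
    ultimately show ?thesis by (simp add: cutoff_def)
  qed
  then have "eventually (\<lambda>n. cutoff \<Omega> n x = 1) sequentially"
    unfolding eventually_sequentially by blast
  then show ?thesis by (rule tendsto_eventually)
qed

text \<open>
  A bounded measurable function on \<open>\<Omega>\<close> is an almost everywhere limit of continuous functions. Clipping
  them and multiplying by the cutoffs keeps the limit and makes them test functions with a common
  bound, so dominated convergence applies because \<open>\<Omega>\<close> has finite measure. General elements of
  \<open>L\<^sup>2(\<Omega>)\<close> are approximated by bounded ones first.
\<close>

lemma L2_dense_Cc:
  fixes \<Omega> :: "'a::euclidean_space set"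
  assumes \<Omega>: "open \<Omega>" "emeasure lebesgue \<Omega> < \<infinity>" and u: "u \<in> L2 \<Omega>" and \<epsilon>: "\<epsilon> > 0"
  obtains w where "w \<in> Cc" "\<And>x. x \<notin> \<Omega> \<Longrightarrow> w x = 0" "L2_norm \<Omega> (\<lambda>x. w x - u x) < \<epsilon>"
proof -
  have S: "\<Omega> \<in> sets lebesgue" using \<Omega>(1) by simp
  have not_UNIV: "\<Omega> \<noteq> UNIV"
    using \<Omega>(2) by auto
  interpret finite_measure "lebesgue_on \<Omega>" by (rule finite_lebesgue_on[OF S \<Omega>(2)])
  have "eventually (\<lambda>n. L2_norm \<Omega> (\<lambda>x. clip (real (Suc n)) (u x) - u x) < \<epsilon> / 2) sequentially"
    using L2_approx_clip[OF u] \<epsilon> by (intro order_tendstoD(2)) auto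
  then obtain m where m: "L2_norm \<Omega> (\<lambda>x. clip (real (Suc m)) (u x) - u x) < \<epsilon> / 2"
    by (auto simp: eventually_sequentially)
  define M where "M = real (Suc m)"
  have M: "M > 0" by (simp add: M_def)
  define v where "v x = clip M (u x)" for x
  have vm: "v \<in> borel_measurable (lebesgue_on \<Omega>)"
    unfolding v_def[abs_def] by (rule measurable_compose[OF L2_measurable[OF u] clip_measurable[OF M]])
  have v: "v \<in> L2 \<Omega>"
  proof -
    have "integrable (lebesgue_on \<Omega>) (\<lambda>x. (norm (v x))\<^sup>2)"
    proof (rule Bochner_Integration.integrable_bound)
      show "integrable (lebesgue_on \<Omega>) (\<lambda>x. M\<^sup>2)" by simp
      show "AE x in lebesgue_on \<Omega>. norm ((norm (v x))\<^sup>2) \<le> norm (M\<^sup>2)"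
        using norm_clip_le[OF M] by (intro AE_I2) (auto simp: v_def intro!: power_mono)
    qed (use vm in measurable)
    then show ?thesis using vm by (simp add: L2_def)
  qed
  have "u measurable_on \<Omega>"
    using measurable_on_iff_borel_measurable[OF S] L2_measurable[OF u] by blast
  then obtain N g where N: "negligible N" and g: "\<And>n. continuous_on UNIV (g n)"
      and lim: "\<And>x. x \<notin> N \<Longrightarrow> (\<lambda>n. g n x) \<longlonglongrightarrow> (if x \<in> \<Omega> then u x else 0)"
    unfolding measurable_on_def by blast
  define h where "h n x = of_real (cutoff \<Omega> n x) * clip M (g n x)" for n x
  have h_cont: "continuous_on UNIV (h n)" for n
    unfolding h_def
    by (intro continuous_intros continuous_on_compose2[OF continuous_clip[OF M]] g continuous_cutoff) auto
  have h_Cc: "h n \<in> Cc" for n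
    unfolding Cc_def using h_cont by (auto simp: h_def cutoff_far intro!: exI[of _ "real (Suc n)"])
  have "(\<lambda>n. L2_norm \<Omega> (\<lambda>x. h n x - v x)) \<longlonglongrightarrow> 0"
  proof (rule L2_norm_dominated_convergence[OF v, where G = "\<lambda>_. (2 * M)\<^sup>2"])
    show "h n \<in> borel_measurable (lebesgue_on \<Omega>)" for n
      by (intro lebesgue_on_borel Cc_borel h_Cc)
    have "N \<in> null_sets lebesgue" using N by (simp add: negligible_iff_null_sets)
    then have "AE x in lebesgue. x \<notin> N" by (rule AE_not_in)
    then have "AE x in lebesgue. x \<in> \<Omega> \<longrightarrow> (\<lambda>n. h n x) \<longlonglongrightarrow> v x"
    proof eventually_elim
      fix x assume x: "x \<notin> N"
      show "x \<in> \<Omega> \<longrightarrow> (\<lambda>n. h n x) \<longlonglongrightarrow> v x"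
      proof
        assume "x \<in> \<Omega>"
        then have "(\<lambda>n. g n x) \<longlonglongrightarrow> u x" using lim[OF x] by simp
        moreover have "isCont (clip M) (u x)"
          using continuous_clip[OF M] by (simp add: continuous_on_eq_continuous_at)
        ultimately have "(\<lambda>n. clip M (g n x)) \<longlonglongrightarrow> v x"
          unfolding v_def by (rule isCont_tendsto_compose[rotated])
        then have "(\<lambda>n. of_real (cutoff \<Omega> n x) * clip M (g n x)) \<longlonglongrightarrow> of_real 1 * v x"
          by (intro tendsto_mult tendsto_of_real cutoff_tendsto \<Omega>(1) not_UNIV \<open>x \<in> \<Omega>\<close>)
        then show "(\<lambda>n. h n x) \<longlonglongrightarrow> v x" by (simp add: h_def)
      qed
    qed
    then show "AE x in lebesgue_on \<Omega>. (\<lambda>n. h n x) \<longlonglongrightarrow> v x"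
      by (rule AE_lebesgue_on[OF S])
    show "AE x in lebesgue_on \<Omega>. (norm (h n x - v x))\<^sup>2 \<le> (2 * M)\<^sup>2" for n
    proof (intro AE_I2 power_mono)
      fix x
      have "norm (h n x) \<le> 1 * M"
        unfolding h_def norm_mult using cutoff_bounds[of \<Omega> n x] norm_clip_le[OF M, of "g n x"]
        by (intro mult_mono) auto
      moreover have "norm (v x) \<le> M" unfolding v_def by (rule norm_clip_le[OF M])
      ultimately show "norm (h n x - v x) \<le> 2 * M"
        using norm_triangle_ineq4[of "h n x" "v x"] by linarith
    qed simp
  qed simp
  then have "eventually (\<lambda>n. L2_norm \<Omega> (\<lambda>x. h n x - v x) < \<epsilon> / 2) sequentially"
    using \<epsilon> by (intro order_tendstoD(2)) auto
  then obtain n where n: "L2_norm \<Omega> (\<lambda>x. h n x - v x) < \<epsilon> / 2"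
    by (auto simp: eventually_sequentially)
  have "L2_norm \<Omega> (\<lambda>x. h n x - u x) = L2_norm \<Omega> (\<lambda>x. (h n x - v x) + (v x - u x))"
    by simp
  also have "\<dots> \<le> L2_norm \<Omega> (\<lambda>x. h n x - v x) + L2_norm \<Omega> (\<lambda>x. v x - u x)"
    by (intro L2_norm_triangle L2_diff Cc_L2 h_Cc S u v)
  also have "\<dots> < \<epsilon>" using n m by (simp add: v_def M_def)
  finally show thesis
    using that[of "h n"] h_Cc by (auto simp: h_def cutoff_outside)
qed

section \<open>The compact self-adjoint convolution operator\<close>

locale compact_convolution =
  fixes \<Omega> :: "'a::euclidean_space set" and K :: "'a \<Rightarrow> complex"
  assumes operator: "conv_operator_on_L2 K \<Omega>"
    and compact: "compact_on_L2 \<Omega> (conv_operator K \<Omega>)"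
    and selfadjoint: "selfadjoint_on_L2 \<Omega> (conv_operator K \<Omega>)"
begin

abbreviation T :: "('a \<Rightarrow> complex) \<Rightarrow> 'a \<Rightarrow> complex" where
  "T \<equiv> conv_operator K \<Omega>"

lemma T_L2: "u \<in> L2 \<Omega> \<Longrightarrow> T u \<in> L2 \<Omega>"
  using operator by (simp add: conv_operator_on_L2_def)

lemma T_symmetric: "u \<in> L2 \<Omega> \<Longrightarrow> v \<in> L2 \<Omega> \<Longrightarrow> L2_inner \<Omega> (T u) v = L2_inner \<Omega> u (T v)"
  using selfadjoint by (simp add: selfadjoint_on_L2_def)

text \<open>
  Additivity holds only where both integrals converge, hence almost everywhere.
\<close>

lemma T_add_AE:
  assumes u: "u \<in> L2 \<Omega>" and v: "v \<in> L2 \<Omega>"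
  shows "AE x in lebesgue_on \<Omega>. T (\<lambda>x. u x + v x) x = T u x + T v x"
proof -
  have "AE x in lebesgue_on \<Omega>. integrable (lebesgue_on \<Omega>) (\<lambda>y. K (x - y) * u y)"
    "AE x in lebesgue_on \<Omega>. integrable (lebesgue_on \<Omega>) (\<lambda>y. K (x - y) * v y)"
    using operator u v by (auto simp: conv_operator_on_L2_def)
  then show ?thesis
    by eventually_elim (simp add: conv_operator_def distrib_left)
qed

lemma T_cmult: "T (\<lambda>x. c * u x) = (\<lambda>x. c * T u x)"
proof
  fix x
  have "T (\<lambda>x. c * u x) x = (LINT y|lebesgue_on \<Omega>. c * (K (x - y) * u y))"
    unfolding conv_operator_def by (simp add: mult_ac)
  then show "T (\<lambda>x. c * u x) x = c * T u x"
    by (simp add: conv_operator_def)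
qed

lemma T_sum_AE:
  fixes n :: nat
  assumes "\<And>i. i < n \<Longrightarrow> f i \<in> L2 \<Omega>"
  shows "AE x in lebesgue_on \<Omega>. T (\<lambda>x. \<Sum>i<n. a i * f i x) x = (\<Sum>i<n. a i * T (f i) x)"
  using assms
proof (induction n)
  case 0
  show ?case by (simp add: conv_operator_def)
next
  case (Suc n)
  have 1: "(\<lambda>x. \<Sum>i<n. a i * f i x) \<in> L2 \<Omega>"
    using Suc.prems by (intro L2_sum L2_cmult) auto
  have 2: "(\<lambda>x. a n * f n x) \<in> L2 \<Omega>"
    using Suc.prems by (intro L2_cmult) auto
  have IH: "AE x in lebesgue_on \<Omega>. T (\<lambda>x. \<Sum>i<n. a i * f i x) x = (\<Sum>i<n. a i * T (f i) x)"
    using Suc by simp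
  from T_add_AE[OF 1 2] IH show ?case
    by eventually_elim (simp add: T_cmult)
qed

text \<open>
  If \<open>T\<close> were unbounded on the unit ball, some sequence in the ball would have images with norms
  tending to infinity, and no subsequence of these images could converge.
\<close>

lemma T_bounded:
  obtains C where "C \<ge> 0" "\<And>v. v \<in> L2 \<Omega> \<Longrightarrow> L2_norm \<Omega> v \<le> 1 \<Longrightarrow> L2_norm \<Omega> (T v) \<le> C"
proof (rule ccontr)
  assume "\<not> thesis"
  then have "\<exists>v. v \<in> L2 \<Omega> \<and> L2_norm \<Omega> v \<le> 1 \<and> real n < L2_norm \<Omega> (T v)" for n :: nat
    using that[of "real n"] by fastforce
  then obtain u where u: "\<And>n. u n \<in> L2 \<Omega>" "\<And>n. L2_norm \<Omega> (u n) \<le> 1"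
      and large: "\<And>n. real n < L2_norm \<Omega> (T (u n))"
    by metis
  then obtain v r where v: "v \<in> L2 \<Omega>" and r: "strict_mono r"
      and lim: "(\<lambda>n. L2_norm \<Omega> (\<lambda>x. T (u (r n)) x - v x)) \<longlonglongrightarrow> 0"
    using compact unfolding compact_on_L2_def by meson
  have "eventually (\<lambda>n. L2_norm \<Omega> (\<lambda>x. T (u (r n)) x - v x) < 1) sequentially"
    using lim by (rule order_tendstoD) simp
  then obtain N where N: "\<And>n. n \<ge> N \<Longrightarrow> L2_norm \<Omega> (\<lambda>x. T (u (r n)) x - v x) < 1"
    unfolding eventually_sequentially by blast
  obtain m :: nat where m: "1 + L2_norm \<Omega> v \<le> real m" using real_arch_simple by blast
  \<comment> \<open>Beyond \<open>N\<close> the images stay within 1 of \<open>v\<close>, and beyond \<open>m\<close> they are larger than that allows.\<close>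
  let ?n = "max N m"
  have "L2_norm \<Omega> (T (u (r ?n))) = L2_norm \<Omega> (\<lambda>x. (T (u (r ?n)) x - v x) + v x)"
    by simp
  also have "\<dots> \<le> L2_norm \<Omega> (\<lambda>x. T (u (r ?n)) x - v x) + L2_norm \<Omega> v"
    by (intro L2_norm_triangle L2_diff T_L2 u v)
  also have "\<dots> < 1 + L2_norm \<Omega> v" using N[of ?n] by simp
  also have "\<dots> \<le> real (r ?n)"
    using m seq_suble[OF r, of ?n] by linarith
  finally show False using large[of "r ?n"] by simp
qed

lemma quadratic_form_continuous:
  assumes u: "u \<in> L2 \<Omega>"
  obtains D where "D \<ge> 0" "\<And>w. w \<in> L2 \<Omega> \<Longrightarrow> L2_norm \<Omega> (\<lambda>x. w x - u x) \<le> 1 \<Longrightarrow>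
     norm (L2_inner \<Omega> (T w) w - L2_inner \<Omega> (T u) u) \<le> D * L2_norm \<Omega> (\<lambda>x. w x - u x)"
proof -
  obtain C where C: "C \<ge> 0" "\<And>v. v \<in> L2 \<Omega> \<Longrightarrow> L2_norm \<Omega> v \<le> 1 \<Longrightarrow> L2_norm \<Omega> (T v) \<le> C"
    using T_bounded by blast
  have "norm (L2_inner \<Omega> (T w) w - L2_inner \<Omega> (T u) u) \<le>
      (2 * L2_norm \<Omega> (T u) + C) * L2_norm \<Omega> (\<lambda>x. w x - u x)"
    if w: "w \<in> L2 \<Omega>" and le: "L2_norm \<Omega> (\<lambda>x. w x - u x) \<le> 1" for w
  proof -
    define v where "v x = w x - u x" for x
    have v: "v \<in> L2 \<Omega>" unfolding v_def[abs_def] by (intro L2_diff w u)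
    have v1: "L2_norm \<Omega> v \<le> 1" using le by (simp add: v_def[abs_def])
    have w_eq: "w = (\<lambda>x. u x + v x)" by (simp add: v_def fun_eq_iff)
    have "L2_inner \<Omega> (T w) w = L2_inner \<Omega> (\<lambda>x. T u x + T v x) w"
      using T_add_AE[OF u v] unfolding w_eq[symmetric]
      by (intro L2_inner_cong_AE T_L2 L2_add u v w)
    also have "\<dots> = cnj (L2_inner \<Omega> u (T u) + L2_inner \<Omega> v (T u)) + cnj (L2_inner \<Omega> u (T v) + L2_inner \<Omega> v (T v))"
      using L2_inner_cnj[of \<Omega> "T u" w] L2_inner_cnj[of \<Omega> "T v" w] u v w
      unfolding w_eq by (simp add: L2_inner_add_left T_L2 L2_add)
    also have "\<dots> = L2_inner \<Omega> (T u) u + L2_inner \<Omega> (T u) v + L2_inner \<Omega> (T v) u + L2_inner \<Omega> (T v) v"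
      by (simp add: L2_inner_cnj[of \<Omega> "T _"])
    also have "L2_inner \<Omega> (T v) u = L2_inner \<Omega> v (T u)"
      by (rule T_symmetric[OF v u])
    finally have "norm (L2_inner \<Omega> (T w) w - L2_inner \<Omega> (T u) u) =
       norm (L2_inner \<Omega> (T u) v + L2_inner \<Omega> v (T u) + L2_inner \<Omega> (T v) v)"
      by (simp add: add.assoc)
    also have "\<dots> \<le> norm (L2_inner \<Omega> (T u) v) + norm (L2_inner \<Omega> v (T u)) + norm (L2_inner \<Omega> (T v) v)"
      by (intro norm_triangle_le add_right_mono norm_triangle_ineq)
    also have "\<dots> \<le> L2_norm \<Omega> (T u) * L2_norm \<Omega> v + L2_norm \<Omega> v * L2_norm \<Omega> (T u) + L2_norm \<Omega> (T v) * L2_norm \<Omega> v"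
      by (intro add_mono L2_Cauchy_Schwarz T_L2 u v)
    also have "\<dots> \<le> L2_norm \<Omega> (T u) * L2_norm \<Omega> v + L2_norm \<Omega> v * L2_norm \<Omega> (T u) + C * L2_norm \<Omega> v"
      by (intro add_left_mono mult_right_mono C v v1 L2_norm_nonneg)
    finally show ?thesis by (simp add: v_def[abs_def] algebra_simps)
  qed
  moreover have "2 * L2_norm \<Omega> (T u) + C \<ge> 0" using C(1) L2_norm_nonneg[of \<Omega> "T u"] by simp
  ultimately show thesis using that by blast
qed

lemma eigenspace_sum:
  fixes n :: nat
  assumes "\<And>i. i < n \<Longrightarrow> f i \<in> eigenspace \<Omega> T \<mu>"
  shows "(\<lambda>x. \<Sum>i<n. a i * f i x) \<in> eigenspace \<Omega> T \<mu>"
proof -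
  have f: "f i \<in> L2 \<Omega>" if "i < n" for i using assms[OF that] by (simp add: eigenspace_def)
  have "AE x in lebesgue_on \<Omega>. T (\<lambda>x. \<Sum>i<n. a i * f i x) x = (\<Sum>i<n. a i * T (f i) x)"
    by (rule T_sum_AE) (rule f)
  moreover have "AE x in lebesgue_on \<Omega>. \<forall>i\<in>{..<n}. T (f i) x = of_real \<mu> * f i x"
    using assms by (intro AE_finite_allI) (auto simp: eigenspace_def)
  ultimately have "AE x in lebesgue_on \<Omega>. T (\<lambda>x. \<Sum>i<n. a i * f i x) x = of_real \<mu> * (\<Sum>i<n. a i * f i x)"
    by eventually_elim (simp add: sum_distrib_left mult_ac)
  moreover have "(\<lambda>x. \<Sum>i<n. a i * f i x) \<in> L2 \<Omega>"
    using f by (intro L2_sum L2_cmult) auto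
  ultimately show ?thesis by (simp add: eigenspace_def)
qed

lemma eigenspace_L2: "u \<in> eigenspace \<Omega> T \<mu> \<Longrightarrow> u \<in> L2 \<Omega>"
  by (simp add: eigenspace_def)

lemma eigenspace_inner:
  assumes u: "u \<in> eigenspace \<Omega> T \<mu>" and v: "v \<in> L2 \<Omega>"
  shows "L2_inner \<Omega> (T u) v = of_real \<mu> * L2_inner \<Omega> u v"
proof -
  have "L2_inner \<Omega> (T u) v = L2_inner \<Omega> (\<lambda>x. of_real \<mu> * u x) v"
    using u v by (intro L2_inner_cong_AE T_L2 L2_cmult) (auto simp: eigenspace_def)
  then show ?thesis by (simp add: L2_inner_cmult_left)
qed

lemma eigenspaces_orthogonal:
  assumes u: "u \<in> eigenspace \<Omega> T \<mu>" and v: "v \<in> eigenspace \<Omega> T \<nu>" and "\<mu> \<noteq> \<nu>"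
  shows "L2_inner \<Omega> u v = 0"
proof -
  note L2 = eigenspace_L2[OF u] eigenspace_L2[OF v]
  have "of_real \<mu> * L2_inner \<Omega> u v = L2_inner \<Omega> u (T v)"
    using eigenspace_inner[OF u L2(2)] T_symmetric[OF L2] by simp
  also have "\<dots> = cnj (of_real \<nu> * L2_inner \<Omega> v u)"
    using eigenspace_inner[OF v L2(1)] L2_inner_cnj[of \<Omega> u "T v"] by simp
  also have "\<dots> = of_real \<nu> * L2_inner \<Omega> u v"
    using L2_inner_cnj[of \<Omega> u v] by simp
  finally show ?thesis using \<open>\<mu> \<noteq> \<nu>\<close> by simp
qed

lemma eigenspace_orthonormal:
  assumes f: "\<And>i. i < n \<Longrightarrow> f i \<in> eigenspace \<Omega> T \<mu>" and "ae_independent (lebesgue_on \<Omega>) n f"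
  obtains e where "orthonormal_on \<Omega> {..<n} e" "\<And>i. i < n \<Longrightarrow> e i \<in> eigenspace \<Omega> T \<mu>"
proof -
  obtain e a where e: "orthonormal_on \<Omega> {..<n} e" "\<And>j. j < n \<Longrightarrow> e j = (\<lambda>x. \<Sum>i<n. a j i * f i x)"
    using Gram_Schmidt_L2[OF eigenspace_L2[OF f] assms(2)] by blast
  show thesis
    by (rule that[OF e(1)]) (use e(2) eigenspace_sum[OF f] in auto)
qed

section \<open>The trace inequality for eigenfunctions\<close>

text \<open>
  The eigenfunctions are replaced by test functions at distance at most \<open>\<delta>\<close>. Each \<open>\<mu> i\<close>, each
  squared norm and the Bessel bound then change by an amount that vanishes with \<open>\<delta>\<close>. The test
  functions are not orthonormal, but their transforms are uniformly close to those of the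
  eigenfunctions, for which Bessel's inequality holds.
\<close>

lemma trace_inequality_eigenfunctions:
  fixes u :: "'i \<Rightarrow> 'a \<Rightarrow> complex" and \<mu> :: "'i \<Rightarrow> real"
  assumes \<Omega>: "open \<Omega>" "emeasure lebesgue \<Omega> < \<infinity>"
    and \<alpha>: "\<alpha> > 0" and hom: "homogeneous_of_order (\<alpha> - real DIM('a)) K"
    and ft: "has_fourier_transform K Khat" and s: "s > 0"
    and J: "integrable lebesgue (\<lambda>\<xi>. max (norm (Khat \<xi>) - 1) 0)"
    and I: "finite I" and on: "orthonormal_on \<Omega> I u"
    and eig: "\<And>i. i \<in> I \<Longrightarrow> u i \<in> eigenspace \<Omega> T (\<mu> i)"
  shows "(\<Sum>i\<in>I. \<bar>\<mu> i\<bar> - s) \<le> (2 * pi) powr (- real DIM('a)) * measure lebesgue \<Omega> *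
     s powr (1 - real DIM('a) / \<alpha>) * (LINT \<xi>|lebesgue. max (norm (Khat \<xi>) - 1) 0)"
proof -
  let ?m = "measure lebesgue \<Omega>" and ?N = "real (card I)"
  let ?J = "LINT \<xi>|lebesgue. max (norm (Khat \<xi>) - 1) 0"
  define P where "P = s powr (1 - real DIM('a) / \<alpha>) * ?J"
  let ?c = "(2 * pi) powr (- real DIM('a))"
  have S: "\<Omega> \<in> sets lebesgue" using \<Omega>(1) by simp
  have u: "u i \<in> L2 \<Omega>" if "i \<in> I" for i using on that by (simp add: orthonormal_on_def)
  have u1: "L2_norm \<Omega> (u i) = 1" if "i \<in> I" for i
  proof -
    have "complex_of_real ((L2_norm \<Omega> (u i))\<^sup>2) = of_real 1"
      using on that unfolding L2_inner_self[symmetric] by (simp add: orthonormal_on_def)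
    then have "(L2_norm \<Omega> (u i))\<^sup>2 = 1" unfolding of_real_eq_iff .
    then show ?thesis using L2_norm_nonneg[of \<Omega> "u i"] by (simp add: power2_eq_1_iff)
  qed
  have K: "tempered_function K" using ft by (simp add: has_fourier_transform_def)
  have "\<exists>D\<ge>0. \<forall>w. w \<in> L2 \<Omega> \<longrightarrow> L2_norm \<Omega> (\<lambda>x. w x - u i x) \<le> 1 \<longrightarrow>
     norm (L2_inner \<Omega> (T w) w - L2_inner \<Omega> (T (u i)) (u i)) \<le> D * L2_norm \<Omega> (\<lambda>x. w x - u i x)"
    if "i \<in> I" for i
    using quadratic_form_continuous[OF u[OF that]] by metis
  then obtain D where D: "\<And>i. i \<in> I \<Longrightarrow> D i \<ge> 0"
     "\<And>i w. i \<in> I \<Longrightarrow> w \<in> L2 \<Omega> \<Longrightarrow> L2_norm \<Omega> (\<lambda>x. w x - u i x) \<le> 1 \<Longrightarrow>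
     norm (L2_inner \<Omega> (T w) w - L2_inner \<Omega> (T (u i)) (u i)) \<le> D i * L2_norm \<Omega> (\<lambda>x. w x - u i x)"
    by metis
  have approx: "(\<Sum>i\<in>I. \<bar>\<mu> i\<bar> - D i * \<delta>) \<le> ?c * (?m + ?N * (?m * (2 * \<delta> + \<delta>\<^sup>2))) * P + s * (?N * (1 + \<delta>)\<^sup>2)"
    if \<delta>: "0 < \<delta>" "\<delta> \<le> 1" for \<delta>
  proof -
    have "\<exists>w. w \<in> Cc \<and> (\<forall>x. x \<notin> \<Omega> \<longrightarrow> w x = 0) \<and> L2_norm \<Omega> (\<lambda>x. w x - u i x) < \<delta>" if "i \<in> I" for i
      using L2_dense_Cc[OF \<Omega> u[OF that] \<delta>(1)] by metis
    then obtain w where w: "\<And>i. i \<in> I \<Longrightarrow> w i \<in> Cc" "\<And>i x. i \<in> I \<Longrightarrow> x \<notin> \<Omega> \<Longrightarrow> w i x = 0"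
        and wu: "\<And>i. i \<in> I \<Longrightarrow> L2_norm \<Omega> (\<lambda>x. w i x - u i x) < \<delta>"
      by metis
    have wL2: "w i \<in> L2 \<Omega>" if "i \<in> I" for i using Cc_L2[OF w(1)[OF that] S] .
    have w_norm: "(LINT x|lborel. (norm (w i x))\<^sup>2) \<le> (1 + \<delta>)\<^sup>2" if i: "i \<in> I" for i
    proof -
      have "L2_norm \<Omega> (w i) = L2_norm \<Omega> (\<lambda>x. u i x + (w i x - u i x))" by simp
      also have "\<dots> \<le> L2_norm \<Omega> (u i) + L2_norm \<Omega> (\<lambda>x. w i x - u i x)"
        by (intro L2_norm_triangle L2_diff wL2 u i)
      also have "\<dots> \<le> 1 + \<delta>" using u1[OF i] wu[OF i] by simp
      finally have "(L2_norm \<Omega> (w i))\<^sup>2 \<le> (1 + \<delta>)\<^sup>2"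
        by (intro power_mono L2_norm_nonneg)
      then show ?thesis using L2_norm_Cc[OF w(1)[OF i] S w(2)[OF i]] by simp
    qed
    have B: "(\<Sum>i\<in>I. (norm (fourier (w i) \<xi>))\<^sup>2) \<le> ?m + ?N * (?m * (2 * \<delta> + \<delta>\<^sup>2))" for \<xi>
    proof -
      note wave = wave_L2[OF S \<Omega>(2), of \<xi>]
      let ?n = "L2_norm \<Omega> (wave \<xi>)"
      have "(norm (fourier (w i) \<xi>))\<^sup>2 \<le> (norm (L2_inner \<Omega> (wave \<xi>) (u i)))\<^sup>2 + ?m * (2 * \<delta> + \<delta>\<^sup>2)" if i: "i \<in> I" for i
      proof -
        let ?a = "norm (L2_inner \<Omega> (u i) (wave \<xi>))"
        have "fourier (w i) \<xi> = L2_inner \<Omega> (u i) (wave \<xi>) + L2_inner \<Omega> (\<lambda>x. w i x - u i x) (wave \<xi>)"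
          using fourier_eq_L2_inner[OF w(1)[OF i] S w(2)[OF i]]
          by (simp add: L2_inner_diff_left wL2 u i wave(1))
        then have "norm (fourier (w i) \<xi>) \<le> ?a + norm (L2_inner \<Omega> (\<lambda>x. w i x - u i x) (wave \<xi>))"
          by (simp add: norm_triangle_ineq)
        also have "norm (L2_inner \<Omega> (\<lambda>x. w i x - u i x) (wave \<xi>)) \<le> L2_norm \<Omega> (\<lambda>x. w i x - u i x) * ?n"
          by (intro L2_Cauchy_Schwarz L2_diff wL2 u i wave(1))
        also have "\<dots> \<le> \<delta> * ?n"
          using wu[OF i] by (intro mult_right_mono L2_norm_nonneg) simp
        finally have "(norm (fourier (w i) \<xi>))\<^sup>2 \<le> (?a + \<delta> * ?n)\<^sup>2"
          by (intro power_mono) auto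
        also have "\<dots> = ?a\<^sup>2 + 2 * (?a * (\<delta> * ?n)) + \<delta>\<^sup>2 * ?n\<^sup>2"
          by (simp add: power2_sum power_mult_distrib)
        also have "?a * (\<delta> * ?n) \<le> ?n * (\<delta> * ?n)"
          using L2_Cauchy_Schwarz[OF u[OF i] wave(1)] u1[OF i] \<delta>(1) L2_norm_nonneg[of \<Omega> "wave \<xi>"]
          by (intro mult_right_mono) auto
        also have "?n * (\<delta> * ?n) = \<delta> * ?n\<^sup>2" by (simp add: power2_eq_square)
        also have "?a = norm (L2_inner \<Omega> (wave \<xi>) (u i))"
          using L2_inner_cnj[of \<Omega> "u i" "wave \<xi>"] by simp
        finally show ?thesis unfolding wave(2) by (simp add: algebra_simps)
      qed
      then have "(\<Sum>i\<in>I. (norm (fourier (w i) \<xi>))\<^sup>2) \<le>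
          (\<Sum>i\<in>I. (norm (L2_inner \<Omega> (wave \<xi>) (u i)))\<^sup>2 + ?m * (2 * \<delta> + \<delta>\<^sup>2))"
        by (rule sum_mono)
      also have "\<dots> = (\<Sum>i\<in>I. (norm (L2_inner \<Omega> (wave \<xi>) (u i)))\<^sup>2) + ?N * (?m * (2 * \<delta> + \<delta>\<^sup>2))"
        by (simp add: sum.distrib)
      also have "(\<Sum>i\<in>I. (norm (L2_inner \<Omega> (wave \<xi>) (u i)))\<^sup>2) \<le> ?m"
        using Bessel_inequality[OF on I wave(1)] wave(2) by simp
      finally show ?thesis by simp
    qed
    have sgn: "\<bar>sgn (\<mu> i)\<bar> \<le> 1" for i by (simp add: abs_sgn_eq)
    have "(\<Sum>i\<in>I. \<bar>\<mu> i\<bar> - D i * \<delta>) \<le> (\<Sum>i\<in>I. sgn (\<mu> i) * Re (LINT z|lebesgue. K z * autocorrelation (w i) (- z)))"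
    proof (rule sum_mono)
      fix i assume i: "i \<in> I"
      let ?q = "L2_inner \<Omega> (T (w i)) (w i)" and ?p = "L2_inner \<Omega> (T (u i)) (u i)"
      have q: "?q = (LINT z|lebesgue. K z * autocorrelation (w i) (- z))"
        by (rule L2_inner_conv_operator[OF S K w(1)[OF i] w(2)[OF i]])
      have p: "?p = of_real (\<mu> i)"
        using eigenspace_inner[OF eig[OF i] u[OF i]] on i by (simp add: orthonormal_on_def)
      have "norm (?q - ?p) \<le> D i * L2_norm \<Omega> (\<lambda>x. w i x - u i x)"
        using D(2)[OF i wL2[OF i]] wu[OF i] \<delta> by simp
      also have "\<dots> \<le> D i * \<delta>" using wu[OF i] D(1)[OF i] by (intro mult_left_mono) auto
      finally have "\<bar>Re ?q - \<mu> i\<bar> \<le> D i * \<delta>"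
        using abs_Re_le_cmod[of "?q - ?p"] p by simp
      then have "\<bar>sgn (\<mu> i)\<bar> * \<bar>Re ?q - \<mu> i\<bar> \<le> 1 * (D i * \<delta>)"
        by (intro mult_mono sgn) auto
      then have "\<bar>sgn (\<mu> i) * Re ?q - \<bar>\<mu> i\<bar>\<bar> \<le> D i * \<delta>"
        unfolding abs_mult[symmetric] by (simp add: right_diff_distrib abs_sgn mult.commute)
      then show "\<bar>\<mu> i\<bar> - D i * \<delta> \<le> sgn (\<mu> i) * Re (LINT z|lebesgue. K z * autocorrelation (w i) (- z))"
        unfolding q by linarith
    qed
    also have "\<dots> \<le> ?c * (?m + ?N * (?m * (2 * \<delta> + \<delta>\<^sup>2))) * s powr (1 - real DIM('a) / \<alpha>) * ?J
        + s * (\<Sum>i\<in>I. LINT x|lborel. (norm (w i x))\<^sup>2)"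
      by (rule trace_inequality_scaled[OF ft I w(1) sgn B J hom \<alpha> s])
    also have "(\<Sum>i\<in>I. LINT x|lborel. (norm (w i x))\<^sup>2) \<le> ?N * (1 + \<delta>)\<^sup>2"
      using sum_mono[OF w_norm] by simp
    finally show ?thesis using s by (simp add: P_def mult.assoc)
  qed
  have "(\<Sum>i\<in>I. \<bar>\<mu> i\<bar> - D i * 0) \<le> ?c * (?m + ?N * (?m * (2 * 0 + 0\<^sup>2))) * P + s * (?N * (1 + 0)\<^sup>2)"
  proof (rule LIMSEQ_le)
    let ?\<delta> = "\<lambda>n. 1 / real (Suc n)"
    have \<delta>: "?\<delta> \<longlonglongrightarrow> 0" by (rule LIMSEQ_Suc[OF lim_1_over_n])
    show "(\<lambda>n. \<Sum>i\<in>I. \<bar>\<mu> i\<bar> - D i * ?\<delta> n) \<longlonglongrightarrow> (\<Sum>i\<in>I. \<bar>\<mu> i\<bar> - D i * 0)"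
      by (intro tendsto_intros \<delta>)
    show "(\<lambda>n. ?c * (?m + ?N * (?m * (2 * ?\<delta> n + (?\<delta> n)\<^sup>2))) * P + s * (?N * (1 + ?\<delta> n)\<^sup>2))
       \<longlonglongrightarrow> ?c * (?m + ?N * (?m * (2 * 0 + 0\<^sup>2))) * P + s * (?N * (1 + 0)\<^sup>2)"
      by (intro tendsto_intros \<delta>)
    show "\<exists>N. \<forall>n\<ge>N. (\<Sum>i\<in>I. \<bar>\<mu> i\<bar> - D i * ?\<delta> n) \<le>
       ?c * (?m + ?N * (?m * (2 * ?\<delta> n + (?\<delta> n)\<^sup>2))) * P + s * (?N * (1 + ?\<delta> n)\<^sup>2)"
      by (intro exI[of _ 0] allI impI approx) auto
  qed
  then show ?thesis by (simp add: P_def sum_subtractf mult_ac)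
qed

section \<open>Counting eigenvalues with multiplicity\<close>

lemma sum_multiplicities_le:
  fixes k :: "real \<Rightarrow> nat"
  assumes \<Omega>: "open \<Omega>" "emeasure lebesgue \<Omega> < \<infinity>"
    and \<alpha>: "\<alpha> > 0" and hom: "homogeneous_of_order (\<alpha> - real DIM('a)) K"
    and ft: "has_fourier_transform K Khat" and s: "s > 0"
    and J: "integrable lebesgue (\<lambda>\<xi>. max (norm (Khat \<xi>) - 1) 0)"
    and F: "finite F"
    and k: "\<And>\<mu>. \<mu> \<in> F \<Longrightarrow> \<exists>f. (\<forall>i<k \<mu>. f i \<in> eigenspace \<Omega> T \<mu>) \<and> ae_independent (lebesgue_on \<Omega>) (k \<mu>) f"
  shows "(\<Sum>\<mu>\<in>F. real (k \<mu>) * (\<bar>\<mu>\<bar> - s)) \<le> (2 * pi) powr (- real DIM('a)) * measure lebesgue \<Omega> *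
     s powr (1 - real DIM('a) / \<alpha>) * (LINT \<xi>|lebesgue. max (norm (Khat \<xi>) - 1) 0)"
proof -
  have "\<exists>e. orthonormal_on \<Omega> {..<k \<mu>} e \<and> (\<forall>i<k \<mu>. e i \<in> eigenspace \<Omega> T \<mu>)" if "\<mu> \<in> F" for \<mu>
    using k[OF that] eigenspace_orthonormal by metis
  then obtain e where e: "\<And>\<mu>. \<mu> \<in> F \<Longrightarrow> orthonormal_on \<Omega> {..<k \<mu>} (e \<mu>)"
      "\<And>\<mu> i. \<mu> \<in> F \<Longrightarrow> i < k \<mu> \<Longrightarrow> e \<mu> i \<in> eigenspace \<Omega> T \<mu>"
    by metis
  let ?I = "SIGMA \<mu>:F. {..<k \<mu>}"
  have "orthonormal_on \<Omega> ?I (\<lambda>(\<mu>, i). e \<mu> i)"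
    unfolding orthonormal_on_def
  proof (intro conjI ballI)
    show "(case p of (\<mu>, i) \<Rightarrow> e \<mu> i) \<in> L2 \<Omega>" if "p \<in> ?I" for p
      using that e(2) by (auto intro: eigenspace_L2)
    fix p q assume p: "p \<in> ?I" and q: "q \<in> ?I"
    obtain \<mu> i \<nu> j where pq: "p = (\<mu>, i)" "q = (\<nu>, j)" by fastforce
    show "L2_inner \<Omega> (case p of (\<mu>, i) \<Rightarrow> e \<mu> i) (case q of (\<mu>, i) \<Rightarrow> e \<mu> i) = (if p = q then 1 else 0)"
    proof (cases "\<mu> = \<nu>")
      case True
      then show ?thesis using e(1)[of \<mu>] p q pq by (auto simp: orthonormal_on_def)
    next
      case False
      then have "L2_inner \<Omega> (e \<mu> i) (e \<nu> j) = 0"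
        using p q pq by (intro eigenspaces_orthogonal[OF e(2) e(2)]) auto
      then show ?thesis using False pq by simp
    qed
  qed
  from trace_inequality_eigenfunctions[OF \<Omega> \<alpha> hom ft s J _ this, of fst]
  have "(\<Sum>p\<in>?I. \<bar>fst p\<bar> - s) \<le> (2 * pi) powr (- real DIM('a)) * measure lebesgue \<Omega> *
     s powr (1 - real DIM('a) / \<alpha>) * (LINT \<xi>|lebesgue. max (norm (Khat \<xi>) - 1) 0)"
    using F e(2) by auto
  also have "(\<Sum>p\<in>?I. \<bar>fst p\<bar> - s) = (\<Sum>\<mu>\<in>F. \<Sum>i<k \<mu>. \<bar>\<mu>\<bar> - s)"
    using F by (subst sum.Sigma) (auto simp: split_beta simp del: sum_constant)
  finally show ?thesis by (simp add: algebra_simps)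
qed

text \<open>
  An upper bound for all finite families bounds the multiplicity of every eigenvalue with
  \<open>\<bar>\<mu>\<bar> > s\<close>. Its defining supremum is therefore attained, and the other eigenvalues contribute nothing.
\<close>

lemma riesz_mean_le:
  assumes bound: "\<And>F k. finite F \<Longrightarrow>
      (\<And>\<mu>. \<mu> \<in> F \<Longrightarrow> \<exists>f. (\<forall>i<k \<mu>. f i \<in> eigenspace \<Omega> T \<mu>) \<and> ae_independent (lebesgue_on \<Omega>) (k \<mu>) f) \<Longrightarrow>
      (\<Sum>\<mu>\<in>F. real (k \<mu>) * (\<bar>\<mu>\<bar> - s)) \<le> R"
  shows "riesz_mean \<Omega> T s \<le> ennreal R"
proof -
  let ?indep = "\<lambda>\<mu> n. \<exists>f. (\<forall>i<n. f i \<in> eigenspace \<Omega> T \<mu>) \<and> ae_independent (lebesgue_on \<Omega>) n f"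
  have attained: "\<exists>n. multiplicity_on_L2 \<Omega> T \<mu> = enat n \<and> ?indep \<mu> n" if \<mu>: "\<bar>\<mu>\<bar> > s" for \<mu>
  proof -
    let ?A = "{enat n | n. ?indep \<mu> n}"
    have "n \<le> nat \<lceil>R / (\<bar>\<mu>\<bar> - s)\<rceil>" if "?indep \<mu> n" for n
    proof -
      have "real n * (\<bar>\<mu>\<bar> - s) \<le> R"
        using bound[of "{\<mu>}" "\<lambda>_. n"] that by simp
      then have "real n \<le> R / (\<bar>\<mu>\<bar> - s)" using \<mu> by (simp add: le_divide_eq)
      then show ?thesis by linarith
    qed
    then have "?A \<subseteq> enat ` {..nat \<lceil>R / (\<bar>\<mu>\<bar> - s)\<rceil>}" by auto
    then have fin: "finite ?A" by (rule finite_subset) simp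
    have "?indep \<mu> 0" by (simp add: ae_independent_def)
    then have ne: "?A \<noteq> {}" by blast
    have "multiplicity_on_L2 \<Omega> T \<mu> = Max ?A"
      unfolding multiplicity_on_L2_def Sup_enat_def by (simp only: fin ne if_True if_False)
    then have "multiplicity_on_L2 \<Omega> T \<mu> \<in> ?A" using Max_in[OF fin ne] by simp
    then show ?thesis by blast
  qed
  then obtain k where k: "\<And>\<mu>. \<bar>\<mu>\<bar> > s \<Longrightarrow> multiplicity_on_L2 \<Omega> T \<mu> = enat (k \<mu>)"
      "\<And>\<mu>. \<bar>\<mu>\<bar> > s \<Longrightarrow> ?indep \<mu> (k \<mu>)"
    by metis
  let ?term = "\<lambda>\<mu>. ennreal_of_enat (multiplicity_on_L2 \<Omega> T \<mu>) * ennreal (max (\<bar>\<mu>\<bar> - s) 0)"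
  have "sum ?term F \<le> ennreal R" if F: "finite F" for F
  proof -
    let ?F = "{\<mu> \<in> F. \<bar>\<mu>\<bar> > s}"
    have "sum ?term F = sum ?term ?F"
      using F by (intro sum.mono_neutral_right) (auto simp: max_def)
    also have "\<dots> = (\<Sum>\<mu>\<in>?F. ennreal (real (k \<mu>) * (\<bar>\<mu>\<bar> - s)))"
      by (intro sum.cong refl) (auto simp: k(1) max_def ennreal_mult' ennreal_of_nat_eq_real_of_nat)
    also have "\<dots> = ennreal (\<Sum>\<mu>\<in>?F. real (k \<mu>) * (\<bar>\<mu>\<bar> - s))"
      by (intro sum_ennreal) auto
    also have "\<dots> \<le> ennreal R"
      using F k(2) by (intro ennreal_leI bound) auto
    finally show ?thesis .
  qed
  then show ?thesis
    unfolding riesz_mean_def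
    by (subst nonneg_infsum_complete) (auto intro!: SUP_least)
qed

end

theorem corollary2:
  fixes \<Omega> :: "'a::euclidean_space set"
    and K Khat :: "'a \<Rightarrow> complex"
    and \<alpha> s :: real
  assumes domain: "open \<Omega>" "connected \<Omega>" "\<Omega> \<noteq> {}"
    and finite_measure: "emeasure lebesgue \<Omega> < \<infinity>"
    and alpha: "0 < \<alpha>" "\<alpha> < real DIM('a)"
    and homogeneous: "homogeneous_of_order (\<alpha> - real DIM('a)) K"
    and hermitian: "\<And>x. x \<noteq> 0 \<Longrightarrow> K x = cnj (K (- x))"
    and fourier_K: "has_fourier_transform K Khat"
    and operator: "conv_operator_on_L2 K \<Omega>"
    and compact: "compact_on_L2 \<Omega> (conv_operator K \<Omega>)"
    and selfadjoint: "selfadjoint_on_L2 \<Omega> (conv_operator K \<Omega>)"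
    and lambda: "0 < s"
  shows "riesz_mean \<Omega> (conv_operator K \<Omega>) s
    \<le> ennreal ((2 * pi) powr (- real DIM('a)) * measure lebesgue \<Omega>
                 * s powr (1 - real DIM('a) / \<alpha>))
      * (\<integral>\<^sup>+ \<xi>. ennreal (max (norm (Khat \<xi>) - 1) 0) \<partial>lebesgue)"
proof -
  interpret compact_convolution \<Omega> K
    by unfold_locales (fact operator compact selfadjoint)+
  let ?C = "(2 * pi) powr (- real DIM('a)) * measure lebesgue \<Omega> * s powr (1 - real DIM('a) / \<alpha>)"
  let ?f = "\<lambda>\<xi>. max (norm (Khat \<xi>) - 1) 0"
  \<comment> \<open>The constant is positive, so the right-hand side is infinite whenever its integral is.\<close>
  have "emeasure lebesgue \<Omega> \<noteq> 0"
  proof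
    assume "emeasure lebesgue \<Omega> = 0"
    then have "negligible \<Omega>"
      using domain(1) by (simp add: negligible_iff_emeasure0)
    then show False using open_not_negligible[OF domain(1,3)] by blast
  qed
  then have "measure lebesgue \<Omega> > 0"
    using finite_measure by (simp add: measure_def enn2real_positive_iff zero_less_iff_neq_zero)
  then have C: "?C > 0" using lambda by simp
  have Khat [measurable]: "Khat \<in> borel_measurable lebesgue"
    using fourier_K by (auto simp: has_fourier_transform_def intro: tempered_function_measurable)
  show ?thesis
  proof (cases "(\<integral>\<^sup>+ \<xi>. ennreal (?f \<xi>) \<partial>lebesgue) = \<infinity>")
    case True
    from C have "ennreal ?C \<noteq> 0" by (simp only: ennreal_eq_0_iff not_le)
    then have "ennreal ?C * \<infinity> = \<infinity>"
      by (simp only: infinity_ennreal_def ennreal_mult_top if_False)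
    then show ?thesis unfolding True by (simp only: infinity_ennreal_def top_greatest)
  next
    case False
    then have J: "integrable lebesgue ?f"
      by (intro integrableI_nonneg) (auto simp: top.not_eq_extremum)
    have "riesz_mean \<Omega> (conv_operator K \<Omega>) s \<le> ennreal (?C * (LINT \<xi>|lebesgue. ?f \<xi>))"
      by (rule riesz_mean_le)
         (rule sum_multiplicities_le[OF domain(1) finite_measure alpha(1) homogeneous fourier_K lambda J])
    also have "\<dots> = ennreal ?C * ennreal (LINT \<xi>|lebesgue. ?f \<xi>)"
      using C by (intro ennreal_mult') simp
    also have "ennreal (LINT \<xi>|lebesgue. ?f \<xi>) = (\<integral>\<^sup>+ \<xi>. ennreal (?f \<xi>) \<partial>lebesgue)"
      by (rule nn_integral_eq_integral[symmetric, OF J]) simp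
    finally show ?thesis .
  qed
qed

end
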